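(* Let $\Omega,\widetilde{\Omega}\subset\mathbb{R}^n$ be domains and let $n-1<p<n$. Let $\varphi:\Omega\to\widetilde{\Omega}$ be a homeomorphism that generates a bounded composition operator $$\varphi^{\ast}: L^1_p(\widetilde{\Omega})\to L^1_p(\Omega),\qquad \varphi^{\ast}(f)=f\circ\varphi.$$ Then for every $\lambda>1$ there exists a constant $H_p^{\lambda}<\infty$ such that $$\limsup_{r\to 0}\frac{L_{\varphi}^{p}(x_0,r)\,r^{n-p}}{|\varphi(B(x_0,\lambda r))|}\leq H_p^{\lambda}\quad\text{for all } x_0\in\Omega,$$ where $L_{\varphi}(x_0,r)=\max_{|x_0-y|=r}|\varphi(x_0)-\varphi(y)|$.
   Context: $|E|$ denotes the $n$-dimensional Lebesgue measure of $E\subset\mathbb{R}^n$ and $B(x,r)$ the ball with center $x$ and radius $r$; only $r$ small enough that the relevant balls lie in $\Omega$ are considered. For $1\leq p\leq\infty$, $L^1_p(\Omega)$ is the homogeneous Sobolev space of locally integrable weakly differentiable functions $f:\Omega\to\mathbb{R}$ with finite seminorm $\|f\mid L^1_p(\Omega)\|=\|\nabla f\mid L_p(\Omega)\|$. Elements of Sobolev spaces with exponent $p$ are regarded as equivalence classes up to sets of $p$-capacity zero. A homeomorphism $\varphi:\Omega\to\widetilde{\Omega}$ generates a bounded composition operator $\varphi^{\ast}:L^1_p(\widetilde{\Omega})\to L^1_q(\Omega)$, $1\leq q\leq p\leq\infty$, by the rule $\varphi^\ast(f)=f\circ\varphi$, if for every $f\in L^1_p(\widetilde{\Omega})$ the composition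 $\varphi^{\ast}(f)\in L^1_q(\Omega)$ is defined quasi-everywhere in $\Omega$ (i.e. outside a set of capacity zero) and there is a constant $K_{p,q}(\varphi;\Omega)<\infty$ such that $\|\varphi^{\ast}(f)\mid L^1_q(\Omega)\|\leq K_{p,q}(\varphi;\Omega)\|f\mid L^1_p(\widetilde{\Omega})\|$ for all such $f$. Here this is used with $q=p$. *)

theory Defs
  imports "HOL-Analysis.Analysis"
begin

definition partial_deriv :: "'n::finite \<Rightarrow> (real ^ 'n \<Rightarrow> real) \<Rightarrow> real ^ 'n \<Rightarrow> real" where
  "partial_deriv i \<eta> x = frechet_derivative \<eta> (at x) (axis i 1)"

primrec Ck :: "nat \<Rightarrow> (real ^ 'n::finite \<Rightarrow> real) \<Rightarrow> bool" where
  "Ck 0 \<eta> \<longleftrightarrow> continuous_on UNIV \<eta>"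
| "Ck (Suc k) \<eta> \<longleftrightarrow>
     (\<forall>x. \<eta> differentiable at x) \<and> (\<forall>i. Ck k (partial_deriv i \<eta>))"

definition compactly_supported_in :: "(real ^ 'n::finite) set \<Rightarrow> (real ^ 'n \<Rightarrow> real) \<Rightarrow> bool" where
  "compactly_supported_in \<Omega> u \<longleftrightarrow> (\<exists>C. compact C \<and> C \<subseteq> \<Omega> \<and> (\<forall>x. x \<notin> C \<longrightarrow> u x = 0))"

definition test_function :: "(real ^ 'n::finite) set \<Rightarrow> (real ^ 'n \<Rightarrow> real) \<Rightarrow> bool" where
  "test_function \<Omega> \<eta> \<longleftrightarrow> (\<forall>k. Ck k \<eta>) \<and> compactly_supported_in \<Omega> \<eta>"

definition locally_integrable_on ::
    "(real ^ 'n::finite \<Rightarrow> 'b::euclidean_space) \<Rightarrow> (real ^ 'n) set \<Rightarrow> bool" where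
  "locally_integrable_on f \<Omega> \<longleftrightarrow> (\<forall>C. compact C \<longrightarrow> C \<subseteq> \<Omega> \<longrightarrow> f absolutely_integrable_on C)"

text \<open>Functions on \<open>\<Omega>\<close> are represented by total functions whose values outside \<open>\<Omega>\<close> are
  irrelevant: weak gradients, the space and its seminorm depend only on the values on \<open>\<Omega>\<close>.\<close>

definition is_weak_gradient ::
    "(real ^ 'n::finite) set \<Rightarrow> (real ^ 'n \<Rightarrow> real) \<Rightarrow> (real ^ 'n \<Rightarrow> real ^ 'n) \<Rightarrow> bool" where
  "is_weak_gradient \<Omega> f g \<longleftrightarrow>
     locally_integrable_on f \<Omega> \<and> locally_integrable_on g \<Omega> \<and>
     (\<forall>\<eta>. test_function \<Omega> \<eta> \<longrightarrow>
       (\<forall>i. (LINT x:\<Omega>|lebesgue. f x * partial_deriv i \<eta> x) =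
            - (LINT x:\<Omega>|lebesgue. g x $ i * \<eta> x)))"

text \<open>For open \<open>\<Omega>\<close> the weak gradient is unique almost everywhere in \<open>\<Omega>\<close>, so the choice below
  does not affect any integral.\<close>

definition weak_gradient ::
    "(real ^ 'n::finite) set \<Rightarrow> (real ^ 'n \<Rightarrow> real) \<Rightarrow> real ^ 'n \<Rightarrow> real ^ 'n" where
  "weak_gradient \<Omega> f = (SOME g. is_weak_gradient \<Omega> f g)"

definition L1p :: "real \<Rightarrow> (real ^ 'n::finite) set \<Rightarrow> (real ^ 'n \<Rightarrow> real) set" where
  "L1p p \<Omega> = {f. (\<exists>g. is_weak_gradient \<Omega> f g) \<and>
     (\<lambda>x. norm (weak_gradient \<Omega> f x) powr p) absolutely_integrable_on \<Omega>}"

definition L1p_seminorm :: "real \<Rightarrow> (real ^ 'n::finite) set \<Rightarrow> (real ^ 'n \<Rightarrow> real) \<Rightarrow> real" where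
  "L1p_seminorm p \<Omega> f =
     (LINT x:\<Omega>|lebesgue. norm (weak_gradient \<Omega> f x) powr p) powr (1 / p)"

text \<open>The \<open>p\<close>-capacity relative to \<open>\<Omega>\<close> as in Maz'ya's book: first for compact sets, then by inner
  approximation for open sets, and by outer approximation for arbitrary subsets of \<open>\<Omega>\<close>.\<close>

definition capacity_compact :: "real \<Rightarrow> (real ^ 'n::finite) set \<Rightarrow> (real ^ 'n) set \<Rightarrow> ennreal" where
  "capacity_compact p \<Omega> F =
     (INF u \<in> {u \<in> L1p p \<Omega>. continuous_on UNIV u \<and> compactly_supported_in \<Omega> u \<and> (\<forall>x\<in>F. 1 \<le> u x)}.
        ennreal (L1p_seminorm p \<Omega> u powr p))"

definition capacity_open :: "real \<Rightarrow> (real ^ 'n::finite) set \<Rightarrow> (real ^ 'n) set \<Rightarrow> ennreal" where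
  "capacity_open p \<Omega> U = (SUP F \<in> {F. compact F \<and> F \<subseteq> U}. capacity_compact p \<Omega> F)"

definition capacity :: "real \<Rightarrow> (real ^ 'n::finite) set \<Rightarrow> (real ^ 'n) set \<Rightarrow> ennreal" where
  "capacity p \<Omega> E = (INF U \<in> {U. open U \<and> E \<subseteq> U \<and> U \<subseteq> \<Omega>}. capacity_open p \<Omega> U)"

definition eq_quasi_everywhere ::
    "real \<Rightarrow> (real ^ 'n::finite) set \<Rightarrow> (real ^ 'n \<Rightarrow> real) \<Rightarrow> (real ^ 'n \<Rightarrow> real) \<Rightarrow> bool" where
  "eq_quasi_everywhere p \<Omega> f g \<longleftrightarrow> capacity p \<Omega> {x \<in> \<Omega>. f x \<noteq> g x} = 0"

definition quasicontinuous :: "real \<Rightarrow> (real ^ 'n::finite) set \<Rightarrow> (real ^ 'n \<Rightarrow> real) \<Rightarrow> bool" where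
  "quasicontinuous p \<Omega> f \<longleftrightarrow>
     (\<forall>\<epsilon>>0. \<exists>U. open U \<and> U \<subseteq> \<Omega> \<and> capacity p \<Omega> U < ennreal \<epsilon> \<and> continuous_on (\<Omega> - U) f)"

text \<open>An element of the homogeneous Sobolev space on \<open>\<Omega>'\<close>, as a class up to sets of \<open>p\<close>-capacity
  zero, is given by its quasicontinuous representatives, any two of which agree quasi-everywhere.
  The composition being defined quasi-everywhere means that the class of \<open>f \<circ> \<phi>\<close> up to capacity
  zero in \<open>\<Omega>\<close> does not depend on the chosen representative \<open>f\<close>.\<close>

definition bounded_composition_operator ::
    "real \<Rightarrow> (real ^ 'n::finite) set \<Rightarrow> (real ^ 'n) set \<Rightarrow> (real ^ 'n \<Rightarrow> real ^ 'n) \<Rightarrow> bool" where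
  "bounded_composition_operator p \<Omega> \<Omega>' \<phi> \<longleftrightarrow>
     (\<exists>K::real. \<forall>f. f \<in> L1p p \<Omega>' \<longrightarrow> quasicontinuous p \<Omega>' f \<longrightarrow>
        (\<forall>g. eq_quasi_everywhere p \<Omega>' f g \<longrightarrow> eq_quasi_everywhere p \<Omega> (f \<circ> \<phi>) (g \<circ> \<phi>)) \<and>
        f \<circ> \<phi> \<in> L1p p \<Omega> \<and>
        L1p_seminorm p \<Omega> (f \<circ> \<phi>) \<le> K * L1p_seminorm p \<Omega>' f)"

text \<open>For \<open>\<phi>\<close> continuous on the (compact) sphere the supremum is attained.\<close>

definition L_dist :: "(real ^ 'n::finite \<Rightarrow> real ^ 'n) \<Rightarrow> real ^ 'n \<Rightarrow> real \<Rightarrow> real" where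
  "L_dist \<phi> x0 r = (SUP y \<in> sphere x0 r. dist (\<phi> x0) (\<phi> y))"

end

theory Submission
  imports Defs
begin

text \<open>
  Why the bound holds. Fix \<open>x0\<close> and a small \<open>r\<close>, let \<open>L\<close> be the maximal distortion on the sphere of radius
  \<open>r\<close>, attained at \<open>y0\<close>, let \<open>e\<close> be the unit vector pointing from \<open>\<phi> x0\<close> to \<open>\<phi> y0\<close>, and put
  \<open>w x = (\<phi> x - \<phi> x0) \<bullet> e\<close>. The rays issuing from \<open>\<phi> x0\<close> in direction \<open>- e\<close> and from \<open>\<phi> y0\<close> in
  direction \<open>e\<close> have to leave the image of a slightly larger ball, so their preimages are two continua
  whose diameters are comparable to \<open>r\<close> (\<open>preimage_of_ray_continuum\<close>), with \<open>w \<le> 0\<close> on the first and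
  \<open>w \<ge> L\<close> on the second. Write \<open>n\<close> for the dimension. As \<open>p > n - 1\<close>, continua are visible to
  \<open>p\<close>-energy, and such a \<open>w\<close> should have energy at least \<open>const * L\<^sup>p * r\<^sup>n\<^sup>-\<^sup>p\<close>. As
  \<open>w\<close> is the composition of \<open>\<phi>\<close> with a function of gradient one, the composition operator should bound the
  same energy from above by a multiple of the measure of \<open>\<phi> ` ball x0 (\<kappa> * r)\<close>. Comparing the two is
  the theorem. Making both estimates precise needs three devices.

  Localization. The operator is bounded globally only, and cutting off \<open>u y = (y - \<phi> x0) \<bullet> e\<close> directly
  produces a gradient that cannot be controlled. Instead \<open>\<epsilon> * sin (u / \<epsilon>)\<close> is cut off: its gradient is no
  larger than that of \<open>u\<close>, while its values are so small that the gradient of the cutoff contributes at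
  most one (\<open>oscillating_test_function_exists\<close>). Nothing is lost: along any path, \<open>w\<close> cannot move by
  \<open>pi * \<epsilon>\<close> from one extremum of the sine to the next unless \<open>sin (w / \<epsilon>)\<close> moves by two, so increments of \<open>w\<close>
  are controlled by the variation of the sine (\<open>abs_increment_le_cost_of_sine\<close>).

  Regularization. The composition has only a weak gradient \<open>g\<close>; it is mollified. The single
  estimate on \<open>g\<close> that is used is \<open>norm g \<le> c + c powr (1 - p) * norm g powr p\<close>, which is stable under averaging
  and holds for every \<open>c > 0\<close>. As \<open>c\<close> may depend on the point at which it is applied, this
  replaces Hoelder's inequality (\<open>mollification\<close>).

  The lower bound. Let \<open>S\<close> be a cube around \<open>x0\<close> whose side is at most the extent of a continuum in some
  coordinate direction \<open>i\<close>. Each \<open>z \<in> S\<close> is joined by a segment to a point of the continuum whose \<open>i\<close>-th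
  coordinate differs from that of \<open>z\<close> by a constant. Contracting \<open>S\<close> along these segments
  by the factor \<open>\<tau>\<close> leaves the \<open>i\<close>-th coordinate rigid, so the Jacobian is \<open>\<tau> ^ (n - 1)\<close> rather than
  \<open>\<tau> ^ n\<close> (\<open>nn_integral_staircase_contraction\<close>). The gradients along the segments, averaged over \<open>S\<close>, are then
  bounded through the integral of \<open>\<tau> powr (- (n - 1) / p)\<close> over the unit interval, which is finite
  exactly when \<open>p > n - 1\<close> (\<open>averaged_segment_energy\<close>). Doing this for both continua from the same \<open>z\<close> connects
  them (\<open>oscillation_energy_bound\<close>).
\<close>

section \<open>Smooth bumps supported in boxes\<close>

lemma partial_deriv_eq:
  "(f has_derivative f') (at x) \<Longrightarrow> partial_deriv i f x = f' (axis i 1)"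
  unfolding partial_deriv_def by (metis frechet_derivative_at)

lemma differentiable_has_derivative_partial:
  fixes f :: "real ^ 'n::finite \<Rightarrow> real"
  assumes "f differentiable at x"
  shows "(f has_derivative (\<lambda>h. \<Sum>i\<in>UNIV. h $ i * partial_deriv i f x)) (at x)"
proof -
  from assms have D: "(f has_derivative frechet_derivative f (at x)) (at x)"
    by (simp add: frechet_derivative_works)
  then have lin: "linear (frechet_derivative f (at x))"
    by (rule has_derivative_linear)
  have "frechet_derivative f (at x) h = (\<Sum>i\<in>UNIV. h $ i * partial_deriv i f x)" for h
  proof -
    have "h = (\<Sum>i\<in>UNIV. h $ i *\<^sub>R axis i 1)"
      using basis_expansion[of h] by (simp add: scalar_mult_eq_scaleR)
    then have "frechet_derivative f (at x) h
        = frechet_derivative f (at x) (\<Sum>i\<in>UNIV. h $ i *\<^sub>R axis i 1)" by simp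
    also have "\<dots> = (\<Sum>i\<in>UNIV. h $ i * frechet_derivative f (at x) (axis i 1))"
      using lin by (simp add: linear_sum linear_scale)
    finally show ?thesis by (simp add: partial_deriv_def)
  qed
  then have "frechet_derivative f (at x) = (\<lambda>h. \<Sum>i\<in>UNIV. h $ i * partial_deriv i f x)" by blast
  then show ?thesis using D by simp
qed

lemma Ck_const: "Ck k (\<lambda>x::real ^ 'n::finite. c)"
proof (induction k arbitrary: c)
  case (Suc k)
  have "partial_deriv i (\<lambda>x::real ^ 'n. c) = (\<lambda>x. 0)" for i
    by (rule ext, subst partial_deriv_eq[of _ "\<lambda>_. 0"]) auto
  then show ?case using Suc by simp
qed simp

lemma Ck_Suc_imp: "Ck (Suc k) f \<Longrightarrow> Ck k f"
proof (induction k arbitrary: f)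
  case 0
  then show ?case
    by (auto intro!: continuous_at_imp_continuous_on simp: differentiable_imp_continuous_within)
next
  case (Suc k)
  then show ?case by simp
qed

lemma Ck_add: "Ck k f \<Longrightarrow> Ck k g \<Longrightarrow> Ck k (\<lambda>x. f x + g x)"
proof (induction k arbitrary: f g)
  case 0
  then show ?case by (simp add: continuous_on_add)
next
  case (Suc k)
  have "partial_deriv i (\<lambda>x. f x + g x) = (\<lambda>x. partial_deriv i f x + partial_deriv i g x)" for i
  proof
    fix x
    from Suc.prems have "(f has_derivative frechet_derivative f (at x)) (at x)"
      "(g has_derivative frechet_derivative g (at x)) (at x)"
      by (auto simp: frechet_derivative_works[symmetric])
    from has_derivative_add[OF this]
    show "partial_deriv i (\<lambda>x. f x + g x) x = partial_deriv i f x + partial_deriv i g x"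
      by (simp add: partial_deriv_eq) (simp add: partial_deriv_def)
  qed
  then show ?case using Suc by (simp add: differentiable_add)
qed

lemma Ck_mult: "Ck k f \<Longrightarrow> Ck k g \<Longrightarrow> Ck k (\<lambda>x. f x * g x)"
proof (induction k arbitrary: f g)
  case 0
  then show ?case by (simp add: continuous_on_mult)
next
  case (Suc k)
  have "partial_deriv i (\<lambda>x. f x * g x)
      = (\<lambda>x. f x * partial_deriv i g x + partial_deriv i f x * g x)" for i
  proof
    fix x
    from Suc.prems have "(f has_derivative frechet_derivative f (at x)) (at x)"
      "(g has_derivative frechet_derivative g (at x)) (at x)"
      by (auto simp: frechet_derivative_works[symmetric])
    from has_derivative_mult[OF this]
    show "partial_deriv i (\<lambda>x. f x * g x) x = f x * partial_deriv i g x + partial_deriv i f x * g x"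
      by (simp add: partial_deriv_eq) (simp add: partial_deriv_def)
  qed
  moreover have "Ck k f" "Ck k g" using Suc.prems Ck_Suc_imp by blast+
  ultimately show ?case using Suc by (simp add: Ck_add)
qed

lemma Ck_prod: "finite I \<Longrightarrow> (\<And>i. i \<in> I \<Longrightarrow> Ck k (f i)) \<Longrightarrow> Ck k (\<lambda>x. \<Prod>i\<in>I. f i x)"
  by (induction I rule: finite_induct) (auto intro: Ck_const Ck_mult)

text \<open>
  These functions, extended by zero to the negative half-line, are closed under differentiation, which
  turns smoothness into a plain induction. The case \<open>P = 1\<close> is the classical flat function \<open>exp (- 1 / t)\<close>.
\<close>

definition flat :: "real poly \<Rightarrow> real \<Rightarrow> real" where
  "flat P t = (if t > 0 then poly P (1 / t) * exp (- (1 / t)) else 0)"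

lemma poly_times_exp_neg_tendsto_0: "((\<lambda>x. poly P x * exp (- x)) \<longlongrightarrow> 0) at_top"
  for P :: "real poly"
proof -
  have "((\<lambda>x. \<Sum>i\<le>degree P. coeff P i * (x ^ i / exp x)) \<longlongrightarrow> (\<Sum>i\<le>degree P. coeff P i * 0)) at_top"
    by (intro tendsto_intros tendsto_power_div_exp_0)
  moreover have "(\<lambda>x. \<Sum>i\<le>degree P. coeff P i * (x ^ i / exp x)) = (\<lambda>x. poly P x * exp (- x))"
    by (rule ext) (simp add: poly_altdef sum_distrib_right exp_minus divide_inverse mult.assoc)
  ultimately show ?thesis by simp
qed

text \<open>
  With \<open>x = 1 / t\<close> this is the fact that \<open>exp x\<close> outgrows every polynomial.
\<close>

lemma flat_tendsto_0: "(flat P \<longlongrightarrow> 0) (at 0)"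
proof -
  have "((\<lambda>t. poly P (inverse t) * exp (- inverse t)) \<longlongrightarrow> 0) (at_right 0)"
    by (rule filterlim_compose[OF poly_times_exp_neg_tendsto_0 filterlim_inverse_at_top_right])
  then have "(flat P \<longlongrightarrow> 0) (at_right 0)"
    by (rule Lim_transform_eventually)
      (auto simp: flat_def eventually_at_right_field inverse_eq_divide intro!: exI[of _ 1])
  moreover have "(flat P \<longlongrightarrow> 0) (at_left 0)"
    by (rule tendsto_eventually) (auto simp: flat_def eventually_at_left_field intro!: exI[of _ "-1"])
  ultimately show ?thesis by (simp add: filterlim_split_at)
qed

text \<open>
  Away from the origin this is the product rule, with the factor \<open>1 / t\<^sup>2\<close> absorbed into the polynomial
  as \<open>monom 1 2\<close>. At the origin the difference quotient is again a flat function, hence tends to zero.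
\<close>

lemma flat_has_derivative:
  "(flat P has_real_derivative flat (monom 1 2 * (P - pderiv P)) t) (at t)"
proof -
  consider "t > 0" | "t < 0" | "t = 0" by linarith
  then show ?thesis
  proof cases
    case 1
    have "((\<lambda>t. poly P (1 / t) * exp (- (1 / t))) has_real_derivative
        flat (monom 1 2 * (P - pderiv P)) t) (at t)"
      using 1 by (auto intro!: derivative_eq_intros DERIV_chain2[OF poly_DERIV]
          simp: flat_def poly_monom field_simps power2_eq_square)
    then show ?thesis
      by (rule DERIV_cong_ev[THEN iffD1, rotated 3])
        (use 1 in \<open>auto simp: flat_def intro!: eventually_mono[OF eventually_gt_at_top]
           eventually_nhds_in_open[THEN eventually_mono, of "{0<..}"]\<close>)
  next
    case 2
    have "((\<lambda>t. 0) has_real_derivative flat (monom 1 2 * (P - pderiv P)) t) (at t)"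
      using 2 by (auto simp: flat_def)
    then show ?thesis
      by (rule DERIV_cong_ev[THEN iffD1, rotated 3])
        (use 2 in \<open>auto simp: flat_def
           intro!: eventually_nhds_in_open[THEN eventually_mono, of "{..<0}"]\<close>)
  next
    case 3
    have "(flat (monom 1 1 * P) \<longlongrightarrow> 0) (at 0)" by (rule flat_tendsto_0)
    moreover have "flat (monom 1 1 * P) = (\<lambda>h. (flat P (0 + h) - flat P 0) / h)"
      by (auto simp: flat_def poly_monom fun_eq_iff)
    ultimately show ?thesis using 3 by (simp add: DERIV_def flat_def)
  qed
qed

lemma flat_coordinate_has_derivative:
  "((\<lambda>x::real ^ 'n::finite. flat P (\<alpha> * x $ i + c)) has_derivative
     (\<lambda>h. flat (monom 1 2 * (P - pderiv P)) (\<alpha> * x $ i + c) * (\<alpha> * h $ i))) (at x)"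
proof -
  have 1: "((\<lambda>x::real ^ 'n. \<alpha> * x $ i + c) has_derivative (\<lambda>h. \<alpha> * h $ i)) (at x)"
    by (auto intro!: derivative_eq_intros bounded_linear.has_derivative[OF bounded_linear_vec_nth])
  from has_derivative_compose[OF 1 flat_has_derivative[unfolded has_field_derivative_def]]
  show ?thesis by (simp add: mult.commute)
qed

lemma Ck_flat_coordinate: "Ck k (\<lambda>x::real ^ 'n::finite. flat P (\<alpha> * x $ i + c))"
proof (induction k arbitrary: P)
  case 0
  show ?case
    by (auto intro!: continuous_at_imp_continuous_on
        has_derivative_continuous[OF flat_coordinate_has_derivative])
next
  case (Suc k)
  have "partial_deriv j (\<lambda>x::real ^ 'n. flat P (\<alpha> * x $ i + c)) =
     (\<lambda>x. flat (monom 1 2 * (P - pderiv P)) (\<alpha> * x $ i + c) * (\<alpha> * axis j 1 $ i))" for j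
    by (rule ext) (subst partial_deriv_eq[OF flat_coordinate_has_derivative], rule refl)
  moreover have "(\<lambda>x::real ^ 'n. flat P (\<alpha> * x $ i + c)) differentiable (at x)" for x
    using flat_coordinate_has_derivative unfolding differentiable_def by fast
  ultimately show ?case
    using Ck_mult[OF Suc.IH Ck_const] by simp
qed

text \<open>
  For large \<open>\<alpha>\<close> this approximates the indicator of \<open>box a b\<close> from below; for fixed \<open>\<alpha>\<close> and a cube centred at the
  origin it serves, up to normalization, as mollifier.
\<close>

definition box_bump :: "real \<Rightarrow> real ^ 'n::finite \<Rightarrow> real ^ 'n \<Rightarrow> real ^ 'n \<Rightarrow> real" where
  "box_bump \<alpha> a b x = (\<Prod>i\<in>UNIV. flat 1 (\<alpha> * (x $ i - a $ i)) * flat 1 (\<alpha> * (b $ i - x $ i)))"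

lemma Ck_box_bump: "Ck k (box_bump \<alpha> a b)"
proof -
  have "flat 1 (\<alpha> * (x $ i - a $ i)) = flat 1 (\<alpha> * x $ i + - \<alpha> * a $ i)"
    "flat 1 (\<alpha> * (b $ i - x $ i)) = flat 1 (- \<alpha> * x $ i + \<alpha> * b $ i)" for x and i
    by (simp_all add: algebra_simps)
  then have "box_bump \<alpha> a b = (\<lambda>x. \<Prod>i\<in>UNIV. flat 1 (\<alpha> * x $ i + - \<alpha> * a $ i)
       * flat 1 (- \<alpha> * x $ i + \<alpha> * b $ i))"
    unfolding box_bump_def by (intro ext) simp
  then show ?thesis by (simp only:) (intro Ck_prod Ck_mult Ck_flat_coordinate finite)
qed

lemma box_bump_nonneg: "0 \<le> box_bump \<alpha> a b x"
  unfolding box_bump_def flat_def by (intro prod_nonneg) auto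

lemma box_bump_le_1: "box_bump \<alpha> a b x \<le> 1"
  unfolding box_bump_def flat_def by (intro prod_le_1) (auto intro!: mult_le_one)

lemma box_bump_pos: "\<alpha> > 0 \<Longrightarrow> x \<in> box a b \<Longrightarrow> 0 < box_bump \<alpha> a b x"
  unfolding box_bump_def flat_def by (intro prod_pos) (auto simp: mem_box_cart)

lemma box_bump_eq_0: "\<alpha> > 0 \<Longrightarrow> x \<notin> box a b \<Longrightarrow> box_bump \<alpha> a b x = 0"
  unfolding box_bump_def flat_def
  by (simp add: mem_box_cart not_less zero_less_mult_iff) (metis not_less)

lemma test_function_box_bump:
  assumes "\<alpha> > 0" "cbox a b \<subseteq> \<Omega>" shows "test_function \<Omega> (box_bump \<alpha> a b)"
proof -
  have "box_bump \<alpha> a b x = 0" if "x \<notin> cbox a b" for x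
    using that box_subset_cbox[of a b] by (intro box_bump_eq_0[OF assms(1)]) auto
  then show ?thesis
    unfolding test_function_def compactly_supported_in_def
    using assms Ck_box_bump by (intro conjI allI impI exI[of _ "cbox a b"]) auto
qed

lemma box_bump_tendsto:
  "(\<lambda>k. box_bump (real (Suc k)) a b x) \<longlonglongrightarrow> indicator (box a b) x"
proof (cases "x \<in> box a b")
  case True
  have 1: "(\<lambda>k. flat 1 (real (Suc k) * t)) \<longlonglongrightarrow> 1" if "t > 0" for t
  proof -
    \<comment> \<open>\<open>flat 1 (\<alpha> * t) = exp (- 1 / (\<alpha> * t))\<close> tends to one as \<open>\<alpha>\<close> grows\<close>
    have "(\<lambda>k. exp (- (inverse (real (Suc k)) * (1 / t)))) \<longlonglongrightarrow> exp (- (0 * (1 / t)))"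
      by (intro tendsto_intros LIMSEQ_inverse_real_of_nat)
    moreover have "exp (- (inverse (real (Suc k)) * (1 / t))) = flat 1 (real (Suc k) * t)" for k
      using that by (simp add: flat_def field_simps del: of_nat_Suc)
    ultimately show ?thesis by simp
  qed
  have "(\<lambda>k. box_bump (real (Suc k)) a b x) \<longlonglongrightarrow> (\<Prod>i\<in>(UNIV::'a set). 1 * 1)"
    unfolding box_bump_def using True by (intro tendsto_intros 1) (auto simp: mem_box_cart)
  then show ?thesis using True by simp
next
  case False
  then show ?thesis by (simp add: box_bump_eq_0)
qed

lemma test_function_differentiable: "test_function \<Omega> \<eta> \<Longrightarrow> \<eta> differentiable at x"
  unfolding test_function_def by (metis Ck.simps(2))

lemma test_function_continuous: "test_function \<Omega> \<eta> \<Longrightarrow> continuous_on UNIV \<eta>"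
  unfolding test_function_def by (metis Ck.simps(1))

lemma test_function_continuous_partial:
  "test_function \<Omega> \<eta> \<Longrightarrow> continuous_on UNIV (partial_deriv i \<eta>)"
  unfolding test_function_def by (metis Ck.simps)

lemma partial_deriv_eq_0_outside:
  assumes "closed C" "\<And>y. y \<notin> C \<Longrightarrow> \<eta> y = 0" "x \<notin> C"
  shows "partial_deriv i \<eta> x = 0"
proof -
  have "open (- C)" using assms by auto
  have "((\<lambda>_. 0) has_derivative (\<lambda>_. 0)) (at x)" by simp
  then have "(\<eta> has_derivative (\<lambda>_. 0)) (at x)"
    by (rule has_derivative_transform_within_open[OF _ \<open>open (- C)\<close>]) (use assms in auto)
  then show ?thesis by (simp add: partial_deriv_eq)
qed

section \<open>Uniqueness of weak gradients\<close>

text \<open>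
  The positive and the negative part of \<open>f\<close> define measures that agree on all boxes. Boxes are stable under
  intersection and generate the Borel sets, so the measures and hence their densities agree.
\<close>

lemma AE_eq_0_if_box_integrals_eq_0:
  fixes f :: "'a::euclidean_space \<Rightarrow> real"
  assumes f: "integrable lborel f"
    and zero: "\<And>l u. (LINT x|lborel. indicator (box l u) x * f x) = 0"
  shows "AE x in lborel. f x = 0"
proof -
  have [measurable]: "f \<in> borel_measurable lborel" using f by auto
  let ?p = "density lborel (\<lambda>x. ennreal (f x))" and ?n = "density lborel (\<lambda>x. ennreal (- f x))"
  have int: "integrable lborel (\<lambda>x. indicator (box l u) x * f x)" for l u
    using integrable_mult_indicator[OF _ f, of "box l u"] by simp
  have fin: "(\<integral>\<^sup>+x. ennreal (g x * indicator (box l u) x) \<partial>lborel) < \<infinity>" if "g = f \<or> g = (\<lambda>x. - f x)" for g l u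
    using int[of l u] that
    by (auto simp: real_integrable_def mult.commute less_top top.not_eq_extremum)
  have eq: "emeasure ?p (box l u) = emeasure ?n (box l u)" for l u
  proof -
    have p: "emeasure ?p (box l u) = (\<integral>\<^sup>+x. ennreal (indicator (box l u) x * f x) \<partial>lborel)"
      by (subst emeasure_density) (auto intro!: nn_integral_cong split: split_indicator)
    have n: "emeasure ?n (box l u) = (\<integral>\<^sup>+x. ennreal (- (indicator (box l u) x * f x)) \<partial>lborel)"
      by (subst emeasure_density) (auto intro!: nn_integral_cong split: split_indicator)
    have "enn2real (emeasure ?p (box l u)) = enn2real (emeasure ?n (box l u))"
      using zero[of l u] real_lebesgue_integral_def[OF int[of l u]] unfolding p n by simp
    moreover have "emeasure ?p (box l u) < top" "emeasure ?n (box l u) < top"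
      using int[of l u] unfolding p n real_integrable_def by (auto simp: less_top)
    ultimately show ?thesis
      by (metis ennreal_enn2real)
  qed
  have fin': "emeasure ?p (box l u) \<noteq> \<infinity>" for l u
  proof -
    have "emeasure ?p (box l u) = (\<integral>\<^sup>+x. ennreal (f x * indicator (box l u) x) \<partial>lborel)"
      by (subst emeasure_density) (auto intro!: nn_integral_cong split: split_indicator)
    then show ?thesis using fin[of f l u] by simp
  qed
  have "?p = ?n"
  proof (rule measure_eqI_generator_eq)
    let ?E = "range (\<lambda>(a, b). box a b::'a set)"
    show "Int_stable ?E"
      by (auto simp: Int_stable_def box_Int_box)
    show "?E \<subseteq> Pow UNIV" "sets ?p = sigma_sets UNIV ?E" "sets ?n = sigma_sets UNIV ?E"
      by (simp_all add: borel_eq_box)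
    let ?A = "\<lambda>n::nat. box (- (real n *\<^sub>R One)) (real n *\<^sub>R One) :: 'a set"
    show "range ?A \<subseteq> ?E" "(\<Union>i. ?A i) = UNIV"
      unfolding UN_box_eq_UNIV by auto
    show "emeasure ?p (?A i) \<noteq> \<infinity>" for i by (rule fin')
    show "emeasure ?p X = emeasure ?n X" if "X \<in> ?E" for X
      using that eq by auto
  qed
  then have "AE x in lborel. ennreal (f x) = ennreal (- f x)"
    by (intro sigma_finite_measure.density_unique[OF sigma_finite_lborel]) auto
  then show ?thesis
  proof (rule AE_mp, intro AE_I2 impI)
    fix x assume "ennreal (f x) = ennreal (- f x)"
    then show "f x = 0"
      using ennreal_eq_0_iff[of "f x"] ennreal_eq_0_iff[of "- f x"] by (cases "f x \<le> 0") auto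
  qed
qed

text \<open>
  Reduction to a Borel measurable representative.
\<close>

lemma AE_eq_0_if_lebesgue_box_integrals_eq_0:
  fixes f :: "'a::euclidean_space \<Rightarrow> real"
  assumes f: "integrable lebesgue f"
    and zero: "\<And>l u. (LINT x|lebesgue. indicator (box l u) x * f x) = 0"
  shows "AE x in lebesgue. f x = 0"
proof -
  have "f \<in> borel_measurable lebesgue" using f by auto
  from completion_ex_borel_measurable_real[OF this]
  obtain f' where [measurable]: "f' \<in> borel_measurable lborel" and ae: "AE x in lborel. f x = f' x"
    by blast
  have ae': "AE x in lebesgue. f x = f' x"
    using ae by (rule AE_completion)
  have m: "f' \<in> borel_measurable lebesgue" by (simp add: measurable_completion)
  have "integrable lebesgue f'"
    using f ae' m by (subst integrable_cong_AE[symmetric, of f]) auto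
  then have 1: "integrable lborel f'" by (simp add: integrable_completion)
  have "(LINT x|lborel. indicator (box l u) x * f' x) = 0" for l u
  proof -
    have "(LINT x|lborel. indicator (box l u) x * f' x) = (LINT x|lebesgue. indicator (box l u) x * f' x)"
      by (subst integral_completion) auto
    also have "\<dots> = (LINT x|lebesgue. indicator (box l u) x * f x)"
    proof (rule integral_cong_AE)
      show "(\<lambda>x. indicator (box l u) x * f' x) \<in> borel_measurable lebesgue"
        by (intro borel_measurable_times m borel_measurable_indicator) auto
      show "(\<lambda>x. indicator (box l u) x * f x) \<in> borel_measurable lebesgue"
        using f by (intro borel_measurable_times borel_measurable_indicator) auto
      show "AE x in lebesgue. indicator (box l u) x * f' x = indicator (box l u) x * f x"
        using ae' by (rule AE_mp) auto
    qed
    finally show ?thesis using zero by simp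
  qed
  from AE_eq_0_if_box_integrals_eq_0[OF 1 this] have "AE x in lebesgue. f' x = 0"
    by (rule AE_completion)
  with ae' show ?thesis by (auto elim: AE_mp)
qed

text \<open>
  The bumps increase to the indicator of the open box and stay below one, so dominated convergence applies.
\<close>

lemma box_integral_eq_0_if_orthogonal_to_test_functions:
  fixes d :: "real ^ 'n::finite \<Rightarrow> real"
  assumes sub: "cbox a b \<subseteq> \<Omega>" and d: "d absolutely_integrable_on cbox a b"
    and orth: "\<And>\<eta>. test_function \<Omega> \<eta> \<Longrightarrow> (LINT x:\<Omega>|lebesgue. d x * \<eta> x) = 0"
  shows "(LINT x|lebesgue. indicator (box a b) x * d x) = 0"
proof -
  let ?g = "\<lambda>x. indicator (cbox a b) x * d x"
  have g: "integrable lebesgue ?g"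
    using d by (simp add: set_integrable_def)
  let ?s = "\<lambda>k x. ?g x * box_bump (real (Suc k)) a b x"
  have meas: "box_bump \<alpha> a b \<in> borel_measurable lebesgue" for \<alpha>
    using Ck_box_bump[of 0 \<alpha> a b]
    by (auto intro!: measurable_completion borel_measurable_continuous_onI)
  have "(\<lambda>k. LINT x|lebesgue. ?s k x) \<longlonglongrightarrow> (LINT x|lebesgue. ?g x * indicator (box a b) x)"
  proof (rule integral_dominated_convergence[where w = "\<lambda>x. norm (?g x)"])
    show "integrable lebesgue (\<lambda>x. norm (?g x))" using g by (rule integrable_norm)
    show "AE x in lebesgue. (\<lambda>k. ?s k x) \<longlonglongrightarrow> ?g x * indicator (box a b) x"
      by (intro AE_I2 tendsto_intros box_bump_tendsto)
    show "AE x in lebesgue. norm (?s k x) \<le> norm (?g x)" for k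
      by (intro AE_I2) (auto simp: abs_mult box_bump_nonneg box_bump_le_1 intro!: mult_left_le)
  qed (use g in \<open>auto intro!: borel_measurable_times[OF borel_measurable_integrable[OF g]] meas borel_measurable_indicator simp del: of_nat_Suc\<close>)
  moreover have "(LINT x|lebesgue. ?s k x) = 0" for k
  proof -
    have eq: "?s k = (\<lambda>x. indicator \<Omega> x *\<^sub>R (d x * box_bump (real (Suc k)) a b x))"
      using sub box_bump_eq_0[of "real (Suc k)" _ a b] box_subset_cbox[of a b]
      by (intro ext) (auto split: split_indicator simp del: of_nat_Suc)
    show ?thesis
      using orth[OF test_function_box_bump[OF _ sub, of "real (Suc k)"]] unfolding eq
      by (simp add: set_lebesgue_integral_def del: of_nat_Suc)
  qed
  ultimately have "(LINT x|lebesgue. ?g x * indicator (box a b) x) = 0"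
    by (simp add: LIMSEQ_const_iff del: of_nat_Suc)
  moreover have "(\<lambda>x. ?g x * indicator (box a b) x) = (\<lambda>x. indicator (box a b) x * d x)"
    using box_subset_cbox[of a b] by (intro ext) (auto split: split_indicator)
  ultimately show ?thesis by metis
qed

text \<open>
  The fundamental lemma of the calculus of variations. Open sets are countable unions of boxes, which
  reduces it to a single box with closure in \<open>\<Omega>\<close>.
\<close>

lemma AE_eq_0_if_orthogonal_to_test_functions:
  fixes d :: "real ^ 'n::finite \<Rightarrow> real"
  assumes "open \<Omega>" and d: "locally_integrable_on d \<Omega>"
    and orth: "\<And>\<eta>. test_function \<Omega> \<eta> \<Longrightarrow> (LINT x:\<Omega>|lebesgue. d x * \<eta> x) = 0"
  shows "AE x in lebesgue. x \<in> \<Omega> \<longrightarrow> d x = 0"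
proof -
  have box: "AE x in lebesgue. x \<in> box a b \<longrightarrow> d x = 0" if sub: "cbox a b \<subseteq> \<Omega>" for a b
  proof -
    have ai: "d absolutely_integrable_on cbox l u" if "cbox l u \<subseteq> \<Omega>" for l u
      using d that compact_cbox unfolding locally_integrable_on_def by blast
    let ?f = "\<lambda>x. indicator (box a b) x * d x"
    have "d absolutely_integrable_on box a b"
      using ai[OF sub] by (rule set_integrable_subset) (auto simp: box_subset_cbox)
    then have "integrable lebesgue ?f" by (simp add: set_integrable_def)
    moreover have "(LINT x|lebesgue. indicator (box l u) x * ?f x) = 0" for l u
    proof (cases "box l u \<inter> box a b = {}")
      case True
      then have "indicator (box l u) x * ?f x = 0" for x by (auto split: split_indicator)
      then have "(\<lambda>x. indicator (box l u) x * ?f x) = (\<lambda>_. 0)" by blast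
      then show ?thesis by simp
    next
      case False
      obtain l' u' where eq: "box l u \<inter> box a b = box l' u'" by (simp add: box_Int_box)
      have "cbox l' u' = closure (box l' u')" using False eq by (simp add: closure_box)
      also have "\<dots> \<subseteq> cbox a b"
        using eq box_subset_cbox[of a b] by (intro closure_minimal) auto
      finally have s: "cbox l' u' \<subseteq> \<Omega>" using sub by auto
      have eq': "(\<lambda>x. indicator (box l u) x * ?f x) = (\<lambda>x. indicator (box l' u') x * d x)"
        unfolding eq[symmetric] by (auto split: split_indicator)
      show ?thesis
        using box_integral_eq_0_if_orthogonal_to_test_functions[OF s ai[OF s] orth] unfolding eq' .
    qed
    ultimately have "AE x in lebesgue. ?f x = 0"
      by (rule AE_eq_0_if_lebesgue_box_integrals_eq_0)
    then show ?thesis by (rule AE_mp) (auto split: split_indicator)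
  qed
  obtain \<D> where D: "countable \<D>" "\<D> \<subseteq> Pow \<Omega>"
      "\<And>X. X \<in> \<D> \<Longrightarrow> \<exists>a b. X = cbox a b" "\<Union>\<D> = \<Omega>"
    using open_countable_Union_open_cbox[OF \<open>open \<Omega>\<close>] by metis
  have "AE x in lebesgue. x \<in> X \<longrightarrow> d x = 0" if "X \<in> \<D>" for X
  proof -
    obtain a b where X: "X = cbox a b" using D(3) \<open>X \<in> \<D>\<close> by blast
    then have "cbox a b \<subseteq> \<Omega>" using D(2) \<open>X \<in> \<D>\<close> by blast
    moreover have "AE x in lebesgue. x \<notin> cbox a b - box a b"
      using negligible_frontier_interval[of a b] by (intro AE_not_in) (simp add: negligible_iff_null_sets)
    ultimately show ?thesis
      using box[of a b] X by (auto elim: AE_mp)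
  qed
  then have "AE x in lebesgue. \<forall>X\<in>\<D>. x \<in> X \<longrightarrow> d x = 0"
    using D(1) by (intro AE_ball_countable[THEN iffD2]) auto
  then show ?thesis by (rule AE_mp) (use D(4) in \<open>auto intro!: AE_I2\<close>)
qed

lemma locally_integrable_on_component:
  assumes "locally_integrable_on g \<Omega>"
  shows "locally_integrable_on (\<lambda>x. g x $ i :: real) \<Omega>"
  unfolding locally_integrable_on_def
proof (intro allI impI)
  fix C :: "(real ^ 'a) set" assume "compact C" "C \<subseteq> \<Omega>"
  then have "g absolutely_integrable_on C" using assms unfolding locally_integrable_on_def by blast
  then show "(\<lambda>x. g x $ i) absolutely_integrable_on C"
    using absolutely_integrable_component[of C g "axis i (1::real)"] by (simp add: inner_axis)
qed

lemma integrable_scaleR_compact_support: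
  fixes f :: "real ^ 'n::finite \<Rightarrow> 'b::euclidean_space"
  assumes f: "locally_integrable_on f \<Omega>"
    and C: "compact C" "C \<subseteq> \<Omega>" "\<And>x. x \<notin> C \<Longrightarrow> h x = 0"
    and h: "continuous_on UNIV h"
  shows "integrable lebesgue (\<lambda>x. indicator \<Omega> x *\<^sub>R (h x *\<^sub>R f x))"
proof -
  have "f absolutely_integrable_on C" using f C unfolding locally_integrable_on_def by blast
  then have 1: "integrable lebesgue (\<lambda>x. indicator C x *\<^sub>R f x)" by (simp add: set_integrable_def)
  have hm: "h \<in> borel_measurable lebesgue"
    using h by (auto intro!: measurable_completion borel_measurable_continuous_onI)
  have "bounded (h ` C)"
    using h C by (intro compact_imp_bounded compact_continuous_image) (auto intro: continuous_on_subset)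
  then obtain B where B: "\<And>x. x \<in> C \<Longrightarrow> \<bar>h x\<bar> \<le> B" by (auto simp: bounded_iff)
  have "integrable lebesgue (\<lambda>x. h x *\<^sub>R (indicator C x *\<^sub>R f x))"
  proof (rule Bochner_Integration.integrable_bound)
    show "integrable lebesgue (\<lambda>x. B *\<^sub>R (indicator C x *\<^sub>R f x))" using 1 by (rule integrable_scaleR_right)
    show "(\<lambda>x. h x *\<^sub>R (indicator C x *\<^sub>R f x)) \<in> borel_measurable lebesgue"
      by (rule borel_measurable_scaleR[OF hm borel_measurable_integrable[OF 1]])
    show "AE x in lebesgue. norm (h x *\<^sub>R (indicator C x *\<^sub>R f x)) \<le> norm (B *\<^sub>R (indicator C x *\<^sub>R f x))"
      using B by (intro AE_I2) (auto split: split_indicator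
          intro!: mult_right_mono intro: order_trans[OF _ abs_ge_self])
  qed
  moreover have "(\<lambda>x. h x *\<^sub>R (indicator C x *\<^sub>R f x)) = (\<lambda>x. indicator \<Omega> x *\<^sub>R (h x *\<^sub>R f x))"
    using C by (intro ext) (auto split: split_indicator)
  ultimately show ?thesis by metis
qed

text \<open>
  Since \<open>weak_gradient\<close> is an arbitrary choice, this is what allows the seminorm to be computed from any
  weak gradient that happens to be known.
\<close>

lemma weak_gradient_unique:
  assumes "open \<Omega>" "is_weak_gradient \<Omega> f g" "is_weak_gradient \<Omega> f h"
  shows "AE x in lebesgue. x \<in> \<Omega> \<longrightarrow> g x = h x"
proof -
  have "AE x in lebesgue. x \<in> \<Omega> \<longrightarrow> g x $ i - h x $ i = 0" for i
  proof (rule AE_eq_0_if_orthogonal_to_test_functions[OF \<open>open \<Omega>\<close>])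
    have g: "locally_integrable_on (\<lambda>x. g x $ i) \<Omega>" and h: "locally_integrable_on (\<lambda>x. h x $ i) \<Omega>"
      using assms by (auto simp: is_weak_gradient_def intro: locally_integrable_on_component)
    then show "locally_integrable_on (\<lambda>x. g x $ i - h x $ i) \<Omega>"
      unfolding locally_integrable_on_def by (auto intro: set_integral_diff)
    fix \<eta> :: "real ^ 'a \<Rightarrow> real" assume eta: "test_function \<Omega> \<eta>"
    then obtain C where C: "compact C" "C \<subseteq> \<Omega>" "\<And>x. x \<notin> C \<Longrightarrow> \<eta> x = 0"
      unfolding test_function_def compactly_supported_in_def by blast
    note i = integrable_scaleR_compact_support[OF _ C test_function_continuous[OF eta]]
    have "(LINT x:\<Omega>|lebesgue. (g x $ i - h x $ i) * \<eta> x)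
        = (LINT x:\<Omega>|lebesgue. g x $ i * \<eta> x) - (LINT x:\<Omega>|lebesgue. h x $ i * \<eta> x)"
      using i[OF g] i[OF h] unfolding set_lebesgue_integral_def
      by (subst Bochner_Integration.integral_diff[symmetric]) (auto simp: algebra_simps)
    also have "\<dots> = 0"
    proof -
      have "(LINT x:\<Omega>|lebesgue. f x * partial_deriv i \<eta> x) = - (LINT x:\<Omega>|lebesgue. g x $ i * \<eta> x)"
        "(LINT x:\<Omega>|lebesgue. f x * partial_deriv i \<eta> x) = - (LINT x:\<Omega>|lebesgue. h x $ i * \<eta> x)"
        using assms(2,3) eta unfolding is_weak_gradient_def by blast+
      then show ?thesis by linarith
    qed
    finally show "(LINT x:\<Omega>|lebesgue. (g x $ i - h x $ i) * \<eta> x) = 0" .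
  qed
  then have "AE x in lebesgue. \<forall>i\<in>UNIV. x \<in> \<Omega> \<longrightarrow> g x $ i - h x $ i = 0"
    by (intro AE_ball_countable[THEN iffD2]) auto
  then show ?thesis by (rule AE_mp) (auto simp: vec_eq_iff)
qed

section \<open>Functions with continuous gradient\<close>

lemma integral_translate:
  fixes h :: "'a::euclidean_space \<Rightarrow> real"
  assumes [measurable]: "h \<in> borel_measurable borel"
  shows "(LINT x|lborel. h (x + a)) = (LINT x|lborel. h x)"
proof -
  have "(LINT x|lborel. h x) = (LINT x|distr lborel borel ((+) a). h x)"
    by (simp add: lborel_distr_plus)
  also have "\<dots> = (LINT x|lborel. h (a + x))" by (subst integral_distr) auto
  finally show ?thesis by (simp add: add.commute)
qed

lemma integrable_continuous_compact_support:
  fixes h :: "'a::euclidean_space \<Rightarrow> 'b::{banach, second_countable_topology}"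
  assumes "continuous_on UNIV h" "compact C" "\<And>x. x \<notin> C \<Longrightarrow> h x = 0"
  shows "integrable lborel h"
proof -
  have "integrable lborel (\<lambda>x. indicator C x *\<^sub>R h x)"
    using assms by (intro borel_integrable_compact) (auto intro: continuous_on_subset)
  moreover have "(\<lambda>x. indicator C x *\<^sub>R h x) = h"
    using assms(3) by (intro ext) (auto split: split_indicator)
  ultimately show ?thesis by simp
qed

text \<open>
  Integration by parts without boundary terms. Translations preserve the integral of \<open>h\<close>, so all difference
  quotients of \<open>h\<close> have integral zero; by the mean value theorem they are dominated by a multiple of the
  indicator of a ball.
\<close>

lemma integral_directional_derivative_eq_0:
  fixes h d :: "'a::euclidean_space \<Rightarrow> real"
  assumes der: "\<And>x. ((\<lambda>t. h (x + t *\<^sub>R e)) has_real_derivative d x) (at 0)"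
    and d: "continuous_on UNIV d" and h: "continuous_on UNIV h"
    and C: "compact C" and h0: "\<And>x. x \<notin> C \<Longrightarrow> h x = 0" and d0: "\<And>x. x \<notin> C \<Longrightarrow> d x = 0"
  shows "(LINT x|lborel. d x) = 0"
proof -
  have [measurable]: "h \<in> borel_measurable borel" "d \<in> borel_measurable borel"
    using d h by (auto intro: borel_measurable_continuous_onI)
  obtain R where R: "C \<subseteq> cball 0 R"
    using compact_imp_bounded[OF C] by (auto simp: bounded_iff subset_iff)
  have "bounded (d ` C)"
    using d C by (intro compact_imp_bounded compact_continuous_image) (auto intro: continuous_on_subset)
  then obtain B0 where B0: "\<And>x. x \<in> C \<Longrightarrow> \<bar>d x\<bar> \<le> B0" by (auto simp: bounded_iff)
  define B where "B = max B0 0"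
  have B: "\<bar>d x\<bar> \<le> B" for x using B0[of x] d0[of x] unfolding B_def by (cases "x \<in> C") auto
  have der': "((\<lambda>t. h (x + t *\<^sub>R e)) has_real_derivative d (x + t *\<^sub>R e)) (at t)" for x t
  proof -
    have "((\<lambda>s. h (x + t *\<^sub>R e + (s - t) *\<^sub>R e)) has_real_derivative d (x + t *\<^sub>R e) * 1) (at t)"
      by (rule DERIV_chain2[where g = "\<lambda>s. s - t" and f = "\<lambda>s. h (x + t *\<^sub>R e + s *\<^sub>R e)"])
         (use der[of "x + t *\<^sub>R e"] in \<open>auto intro!: derivative_eq_intros\<close>)
    then show ?thesis by (simp add: algebra_simps)
  qed
  define t where "t k = inverse (real (Suc k))" for k
  have t: "0 < t k" "t k \<le> 1" for k by (auto simp: t_def inverse_le_1_iff)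
  have t0: "t \<longlonglongrightarrow> 0" unfolding t_def by (rule LIMSEQ_inverse_real_of_nat)
  let ?s = "\<lambda>k x. (h (x + t k *\<^sub>R e) - h x) / t k"
  let ?K = "cball 0 (R + norm e) :: 'a set"
  have "(\<lambda>k. LINT x|lborel. ?s k x) \<longlonglongrightarrow> (LINT x|lborel. d x)"
  proof (rule integral_dominated_convergence[where w = "\<lambda>x. B * indicator ?K x"])
    show "integrable lborel (\<lambda>x. B * indicator ?K x)"
      by (intro integrable_mult_right) (auto intro!: integrable_real_indicator emeasure_bounded_finite[unfolded infinity_ennreal_def])
    show "AE x in lborel. (\<lambda>k. ?s k x) \<longlonglongrightarrow> d x"
    proof (rule AE_I2)
      fix x
      have "((\<lambda>s. (h (x + (0 + s) *\<^sub>R e) - h (x + 0 *\<^sub>R e)) / s) \<longlongrightarrow> d x) (at 0)"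
        using der[of x] by (simp add: DERIV_def)
      then have "((\<lambda>s. (h (x + s *\<^sub>R e) - h x) / s) \<longlongrightarrow> d x) (at 0)" by simp
      then show "(\<lambda>k. ?s k x) \<longlonglongrightarrow> d x"
        by (rule filterlim_compose) (use t t0 in \<open>auto simp: filterlim_at less_imp_neq[symmetric] intro!: always_eventually\<close>)
    qed
    show "AE x in lborel. norm (?s k x) \<le> B * indicator ?K x" for k
    proof (rule AE_I2)
      fix x
      show "norm (?s k x) \<le> B * indicator ?K x"
      proof (cases "x \<in> ?K")
        case True
        obtain z where "h (x + t k *\<^sub>R e) - h (x + 0 *\<^sub>R e) = (t k - 0) * d (x + z *\<^sub>R e)"
          using MVT2[of 0 "t k" "\<lambda>s. h (x + s *\<^sub>R e)" "\<lambda>s. d (x + s *\<^sub>R e)"] der' t by blast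
        then show ?thesis using True B t[of k] by simp
      next
        case False
        have "norm (t k *\<^sub>R e) \<le> norm e" using t[of k] by (simp add: mult_left_le_one_le)
        moreover have "norm x \<le> norm (x + t k *\<^sub>R e) + norm (t k *\<^sub>R e)"
          using norm_triangle_ineq4[of "x + t k *\<^sub>R e" "t k *\<^sub>R e"] by simp
        ultimately have "x \<notin> cball 0 R" "x + t k *\<^sub>R e \<notin> cball 0 R"
          using False norm_ge_zero[of e] by (auto simp: mem_cball_0 simp del: norm_ge_zero mem_cball)
        then have "x \<notin> C" "x + t k *\<^sub>R e \<notin> C" using R by blast+
        then show ?thesis using False h0 by simp
      qed
    qed
  qed auto
  moreover have "(\<lambda>k. LINT x|lborel. ?s k x) = (\<lambda>_. 0)"
  proof
    fix k
    have i: "integrable lborel h" by (rule integrable_continuous_compact_support[OF h C h0])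
    have "integrable (distr lborel borel ((+) (t k *\<^sub>R e))) h" using i by (simp add: lborel_distr_plus)
    then have "integrable lborel (\<lambda>x. h (x + t k *\<^sub>R e))"
      by (subst (asm) integrable_distr_eq) (auto simp: add.commute)
    then show "(LINT x|lborel. ?s k x) = 0" using i integral_translate[of h "t k *\<^sub>R e"] by simp
  qed
  ultimately show ?thesis by (simp add: LIMSEQ_const_iff)
qed

lemma locally_integrable_on_continuous:
  assumes "continuous_on UNIV f" shows "locally_integrable_on f \<Omega>"
  unfolding locally_integrable_on_def set_integrable_def
proof (intro allI impI)
  fix C :: "(real ^ 'a) set" assume "compact C"
  then have "integrable lborel (\<lambda>x. indicator C x *\<^sub>R f x)"
    using assms by (intro borel_integrable_compact) (auto intro: continuous_on_subset)
  then show "integrable lebesgue (\<lambda>x. indicator C x *\<^sub>R f x)" 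
    using borel_measurable_integrable integrable_completion by blast
qed

text \<open>
  The preceding lemma applied to the product of \<open>f\<close> with a test function.
\<close>

lemma is_weak_gradient_continuous_derivative:
  fixes f :: "real ^ 'n::finite \<Rightarrow> real"
  assumes der: "\<And>x. (f has_derivative (\<lambda>h. Df x \<bullet> h)) (at x)" and cont: "continuous_on UNIV Df"
  shows "is_weak_gradient \<Omega> f Df"
  unfolding is_weak_gradient_def
proof (intro conjI allI impI)
  have f: "continuous_on UNIV f"
    using der by (auto intro!: continuous_at_imp_continuous_on has_derivative_continuous)
  then show "locally_integrable_on f \<Omega>" by (rule locally_integrable_on_continuous)
  show "locally_integrable_on Df \<Omega>" using cont by (rule locally_integrable_on_continuous)
  fix \<eta> :: "real ^ 'n \<Rightarrow> real" and i assume eta: "test_function \<Omega> \<eta>"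
  then obtain C where C: "compact C" "C \<subseteq> \<Omega>" and eta0: "\<And>x. x \<notin> C \<Longrightarrow> \<eta> x = 0"
    unfolding test_function_def compactly_supported_in_def by blast
  have deta0: "partial_deriv i \<eta> x = 0" if "x \<notin> C" for x
    using partial_deriv_eq_0_outside[OF compact_imp_closed[OF C(1)] eta0 that] .
  note ceta = test_function_continuous[OF eta] test_function_continuous_partial[OF eta, of i]
  have cDfi: "continuous_on UNIV (\<lambda>x. Df x $ i)" using cont by (rule continuous_on_component)
  have i1: "integrable lborel (\<lambda>x. f x * partial_deriv i \<eta> x)"
    by (rule integrable_continuous_compact_support[OF _ C(1)])
       (use f ceta deta0 in \<open>auto intro!: continuous_intros\<close>)
  have i2: "integrable lborel (\<lambda>x. Df x $ i * \<eta> x)"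
    by (rule integrable_continuous_compact_support[OF _ C(1)])
       (use cDfi ceta eta0 in \<open>auto intro!: continuous_intros\<close>)
  have "(LINT x|lborel. f x * partial_deriv i \<eta> x + Df x $ i * \<eta> x) = 0"
  proof (rule integral_directional_derivative_eq_0[of "\<lambda>x. f x * \<eta> x" "axis i 1" _ C])
    show "((\<lambda>t. f (x + t *\<^sub>R axis i 1) * \<eta> (x + t *\<^sub>R axis i 1)) has_real_derivative
        f x * partial_deriv i \<eta> x + Df x $ i * \<eta> x) (at 0)" for x
    proof -
      have "((\<lambda>t. x + t *\<^sub>R axis i 1) has_derivative (\<lambda>t. t *\<^sub>R axis i 1)) (at (0::real))"
        by (auto intro!: derivative_eq_intros)
      note chain = has_derivative_compose[OF this]
      have "((\<lambda>t. f (x + t *\<^sub>R axis i 1)) has_real_derivative Df x $ i) (at 0)"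
        using chain[of f "\<lambda>h. Df x \<bullet> h"] der[of x]
        by (simp add: has_field_derivative_def inner_axis mult_commute_abs)
      moreover have "((\<lambda>t. \<eta> (x + t *\<^sub>R axis i 1)) has_real_derivative partial_deriv i \<eta> x) (at 0)"
      proof -
        have D: "(\<eta> has_derivative (\<lambda>h. \<Sum>j\<in>UNIV. h $ j * partial_deriv j \<eta> x)) (at x)"
          by (rule differentiable_has_derivative_partial[OF test_function_differentiable[OF eta]])
        have s: "(\<Sum>j\<in>UNIV. (t *\<^sub>R axis i 1) $ j * partial_deriv j \<eta> x) = t * partial_deriv i \<eta> x" for t :: real
          by (simp add: axis_def if_distrib[of "\<lambda>a. _ * a"] if_distrib[of "\<lambda>a. a * _"] cong: if_cong)
        show ?thesis using chain[of \<eta>, simplified, OF D] unfolding s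
          by (simp add: has_field_derivative_def mult_commute_abs)
      qed
      ultimately show ?thesis by (auto intro!: derivative_eq_intros)
    qed
    show "continuous_on UNIV (\<lambda>x. f x * partial_deriv i \<eta> x + Df x $ i * \<eta> x)"
      using f cDfi ceta by (intro continuous_on_add continuous_on_mult)
    show "continuous_on UNIV (\<lambda>x. f x * \<eta> x)"
      using f ceta by (intro continuous_intros)
  qed (use C eta0 deta0 in auto)
  then have z: "(LINT x|lborel. f x * partial_deriv i \<eta> x) = - (LINT x|lborel. Df x $ i * \<eta> x)"
    using i1 i2 by simp
  have "(\<lambda>x. indicator \<Omega> x *\<^sub>R (f x * partial_deriv i \<eta> x)) = (\<lambda>x. f x * partial_deriv i \<eta> x)"
    "(\<lambda>x. indicator \<Omega> x *\<^sub>R (Df x $ i * \<eta> x)) = (\<lambda>x. Df x $ i * \<eta> x)"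
    using C(2) eta0 deta0 by (intro ext; auto split: split_indicator)+
  then show "(LINT x:\<Omega>|lebesgue. f x * partial_deriv i \<eta> x) = - (LINT x:\<Omega>|lebesgue. Df x $ i * \<eta> x)"
    unfolding set_lebesgue_integral_def using z i1 i2 by (simp add: integral_completion)
qed

text \<open>
  The upper estimate of the energy of the test functions to which the composition operator is applied.
\<close>

lemma continuous_gradient_in_L1p:
  fixes f :: "real ^ 'n::finite \<Rightarrow> real"
  assumes "open \<Omega>" "0 < p"
    and der: "\<And>x. (f has_derivative (\<lambda>h. Df x \<bullet> h)) (at x)" and cont: "continuous_on UNIV Df"
    and K: "compact K" "\<And>x. x \<notin> K \<Longrightarrow> Df x = 0" and M: "\<And>x. norm (Df x) \<le> M"
  shows "f \<in> L1p p \<Omega>" and "L1p_seminorm p \<Omega> f powr p \<le> M powr p * measure lebesgue K"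
proof -
  have wg: "is_weak_gradient \<Omega> f Df" using der cont by (rule is_weak_gradient_continuous_derivative)
  then have wg': "is_weak_gradient \<Omega> f (weak_gradient \<Omega> f)"
    unfolding weak_gradient_def by (rule someI[of "is_weak_gradient \<Omega> f"])
  have ae: "AE x in lebesgue. x \<in> \<Omega> \<longrightarrow> Df x = weak_gradient \<Omega> f x"
    by (rule weak_gradient_unique[OF \<open>open \<Omega>\<close> wg wg'])
  have "M \<ge> 0" using M[of 0] norm_ge_zero order_trans by blast
  let ?h = "\<lambda>x. norm (Df x) powr p"
  have ch: "continuous_on UNIV ?h"
    using cont \<open>0 < p\<close> by (intro continuous_on_powr' continuous_intros) auto
  have "integrable lborel ?h"
    by (rule integrable_continuous_compact_support[OF ch K(1)]) (use K(2) in simp)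
  then have h: "integrable lebesgue ?h" by (simp add: integrable_completion)
  then have hO: "integrable lebesgue (\<lambda>x. indicator \<Omega> x *\<^sub>R ?h x)"
    using \<open>open \<Omega>\<close> by (intro integrable_mult_indicator) auto
  have ae': "AE x in lebesgue. indicator \<Omega> x *\<^sub>R ?h x = indicator \<Omega> x *\<^sub>R norm (weak_gradient \<Omega> f x) powr p"
    using ae by (rule AE_mp) (auto split: split_indicator)
  have meas: "(\<lambda>x. indicator \<Omega> x *\<^sub>R norm (weak_gradient \<Omega> f x) powr p) \<in> borel_measurable lebesgue"
    using borel_measurable_integrable[OF hO] ae' by (rule borel_measurable_AE)
  have i: "integrable lebesgue (\<lambda>x. indicator \<Omega> x *\<^sub>R norm (weak_gradient \<Omega> f x) powr p)"
    using integrable_cong_AE[OF borel_measurable_integrable[OF hO] meas ae'] hO by blast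
  then show "f \<in> L1p p \<Omega>"
    unfolding L1p_def set_integrable_def using wg by blast
  have "(LINT x|lebesgue. indicator \<Omega> x *\<^sub>R norm (weak_gradient \<Omega> f x) powr p)
      = (LINT x|lebesgue. indicator \<Omega> x *\<^sub>R ?h x)"
    using integral_cong_AE[OF borel_measurable_integrable[OF hO] meas ae'] by simp
  also have "\<dots> \<le> (LINT x|lebesgue. M powr p * indicator K x)"
  proof (rule integral_mono[OF hO])
    show "integrable lebesgue (\<lambda>x. M powr p * indicator K x)"
    proof -
      have "integrable lborel (indicator K :: _ \<Rightarrow> real)"
        using K(1) by (intro integrable_real_indicator emeasure_bounded_finite)
          (auto simp: compact_imp_bounded borel_compact)
      then have "integrable lebesgue (indicator K :: _ \<Rightarrow> real)"
        using borel_measurable_integrable integrable_completion by blast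
      then show ?thesis by simp
    qed
    show "indicator \<Omega> x *\<^sub>R ?h x \<le> M powr p * indicator K x" for x
      using K(2)[of x] M[of x] \<open>0 < p\<close> by (auto split: split_indicator intro!: powr_mono2)
  qed
  also have "\<dots> = M powr p * measure lebesgue K" using K(1) by (simp add: lmeasurable_compact fmeasurableD)
  finally have le: "(LINT x:\<Omega>|lebesgue. norm (weak_gradient \<Omega> f x) powr p) \<le> M powr p * measure lebesgue K"
    by (simp add: set_lebesgue_integral_def)
  moreover have "0 \<le> (LINT x:\<Omega>|lebesgue. norm (weak_gradient \<Omega> f x) powr p)"
    unfolding set_lebesgue_integral_def by (intro Bochner_Integration.integral_nonneg) auto
  ultimately show "L1p_seminorm p \<Omega> f powr p \<le> M powr p * measure lebesgue K"
    using \<open>0 < p\<close> unfolding L1p_seminorm_def by (simp add: powr_powr)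
qed

text \<open>
  The zero function is admissible for the empty set. That its seminorm vanishes uses the uniqueness of
  weak gradients.
\<close>

lemma capacity_empty:
  fixes \<Omega> :: "(real ^ 'n::finite) set"
  assumes "open \<Omega>" "0 < p" shows "capacity p \<Omega> {} = 0"
proof -
  have z: "(\<lambda>_. 0) \<in> L1p p \<Omega>" "L1p_seminorm p \<Omega> (\<lambda>_. 0) powr p \<le> 0 powr p * measure lebesgue ({} :: (real ^ 'n) set)"
    by (rule continuous_gradient_in_L1p[where Df = "\<lambda>_. 0"]; use assms in auto)+
  have "capacity_compact p \<Omega> {} \<le> ennreal (L1p_seminorm p \<Omega> (\<lambda>_. 0) powr p)"
    unfolding capacity_compact_def
    by (rule INF_lower) (use z in \<open>auto simp: compactly_supported_in_def intro!: exI[of _ "{}"]\<close>)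
  also have "\<dots> = 0" using z(2) by (simp add: ennreal_eq_0_iff)
  finally have "capacity_open p \<Omega> {} = 0" unfolding capacity_open_def by (auto simp: SUP_eq_const)
  moreover have "capacity p \<Omega> {} \<le> capacity_open p \<Omega> {}"
    unfolding capacity_def by (rule INF_lower) auto
  ultimately show ?thesis by simp
qed

text \<open>
  Takes the exceptional set to be empty. It makes the composition operator applicable to continuous functions.
\<close>

lemma continuous_imp_quasicontinuous:
  assumes "open \<Omega>" "0 < p" "continuous_on \<Omega> f" shows "quasicontinuous p \<Omega> f"
  unfolding quasicontinuous_def
proof (intro allI impI)
  fix e :: real assume "0 < e"
  then show "\<exists>U. open U \<and> U \<subseteq> \<Omega> \<and> capacity p \<Omega> U < ennreal e \<and> continuous_on (\<Omega> - U) f"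
    by (intro exI[of _ "{}"]) (simp add: capacity_empty assms)
qed

section \<open>Cutoffs and oscillating test functions\<close>

lemma max_0_square_has_derivative:
  "((\<lambda>t::real. (max 0 t)\<^sup>2) has_real_derivative 2 * max 0 t) (at t)"
proof -
  consider "t > 0" | "t < 0" | "t = 0" by linarith
  then show ?thesis
  proof cases
    case 1
    have "((\<lambda>t. t\<^sup>2) has_real_derivative 2 * max 0 t) (at t)"
      using 1 by (auto intro!: derivative_eq_intros)
    then show ?thesis
      by (rule DERIV_cong_ev[THEN iffD1, rotated 3])
        (use 1 in \<open>auto intro!: eventually_nhds_in_open[THEN eventually_mono, of "{0<..}"]\<close>)
  next
    case 2
    have "((\<lambda>t. 0) has_real_derivative 2 * max 0 t) (at t)"
      using 2 by auto
    then show ?thesis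
      by (rule DERIV_cong_ev[THEN iffD1, rotated 3])
        (use 2 in \<open>auto intro!: eventually_nhds_in_open[THEN eventually_mono, of "{..<0}"]\<close>)
  next
    case 3
    have "((\<lambda>h::real. (max 0 h)\<^sup>2 / h) \<longlongrightarrow> 0) (at 0)"
    proof (rule tendsto_rabs_zero_cancel, rule tendsto_sandwich[where f = "\<lambda>_. 0" and h = "\<lambda>h. \<bar>h\<bar>"])
      show "\<forall>\<^sub>F h in at 0. \<bar>(max 0 h)\<^sup>2 / h\<bar> \<le> \<bar>h::real\<bar>"
        by (intro always_eventually allI) (auto simp: max_def power2_eq_square)
    qed (auto intro!: tendsto_eq_intros)
    then show ?thesis using 3 by (simp add: DERIV_def)
  qed
qed

text \<open>
  Cover \<open>K\<close> by finitely many balls whose closures lie in \<open>A\<close>. The sum \<open>q\<close> of the functions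
  \<open>(max 0 (r\<^sup>2 - norm (y - x)\<^sup>2))\<^sup>2\<close> is continuously differentiable, vanishes outside the balls and is at least some
  \<open>m > 0\<close> on \<open>K\<close>; then \<open>1 - (max 0 (1 - q / m))\<^sup>2\<close> is a cutoff. The square of \<open>max 0\<close> is the simplest truncation
  with a continuous derivative.
\<close>

lemma C1_cutoff_exists:
  fixes K A :: "'a::euclidean_space set"
  assumes K: "compact K" "K \<subseteq> A" and A: "open A"
  obtains \<eta> D\<eta> C where "\<And>x. (\<eta> has_derivative (\<lambda>h. D\<eta> x \<bullet> h)) (at x)" "continuous_on UNIV D\<eta>"
    "\<And>x. 0 \<le> \<eta> x \<and> \<eta> x \<le> (1::real)" "\<And>x. x \<in> K \<Longrightarrow> \<eta> x = 1"
    "compact C" "C \<subseteq> A" "\<And>x. x \<notin> C \<Longrightarrow> \<eta> x = 0 \<and> D\<eta> x = 0"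
proof -
  have "\<exists>r. \<forall>x\<in>K. 0 < r x \<and> cball x (r x) \<subseteq> A"
    using A K(2) open_contains_cball[of A] by (intro bchoice) blast
  then obtain r where r: "\<And>x. x \<in> K \<Longrightarrow> 0 < r x" "\<And>x. x \<in> K \<Longrightarrow> cball x (r x) \<subseteq> A" by blast
  have "K \<subseteq> (\<Union>x\<in>K. ball x (r x))" using r(1) by auto
  then obtain T where T: "T \<subseteq> K" "finite T" "K \<subseteq> (\<Union>x\<in>T. ball x (r x))"
    using compactE_image[OF K(1), of K "\<lambda>x. ball x (r x)"] by (metis open_ball)
  define s where "s x y = (r x)\<^sup>2 - (y - x) \<bullet> (y - x)" for x y
  define q where "q y = (\<Sum>x\<in>T. (max 0 (s x y))\<^sup>2)" for y
  define Dq where "Dq y = (\<Sum>x\<in>T. (2 * max 0 (s x y)) *\<^sub>R (- 2 *\<^sub>R (y - x)))" for y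
  define C where "C = (\<Union>x\<in>T. cball x (r x))"
  have rT: "0 < r x" if "x \<in> T" for x using r(1) T(1) that by blast
  have s_le: "s x y \<le> 0" if "x \<in> T" "y \<notin> cball x (r x)" for x y
  proof -
    have "r x \<le> norm (y - x)" using that by (auto simp: dist_norm norm_minus_commute)
    then have "(r x)\<^sup>2 \<le> (norm (y - x))\<^sup>2" using rT[OF that(1)] by (intro power_mono) auto
    then show ?thesis by (simp add: s_def power2_norm_eq_inner)
  qed
  have s_pos: "0 < s x y" if "y \<in> ball x (r x)" for x y
  proof -
    have "(norm (y - x))\<^sup>2 < (r x)\<^sup>2" using that by (intro power_strict_mono) (auto simp: dist_norm norm_minus_commute)
    then show ?thesis by (simp add: s_def power2_norm_eq_inner)
  qed
  have q0: "q y = 0" and Dq0: "Dq y = 0" if "y \<notin> C" for y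
    using that s_le unfolding q_def Dq_def C_def by (auto intro!: sum.neutral simp: max_absorb1)
  have qpos: "0 < q y" if "y \<in> K" for y
  proof -
    from T(3) \<open>y \<in> K\<close> obtain x where x: "x \<in> T" "y \<in> ball x (r x)" by blast
    have "0 < (max 0 (s x y))\<^sup>2" using s_pos[OF x(2)] by simp
    also have "\<dots> \<le> q y" unfolding q_def using x(1) T(2) by (intro member_le_sum) auto
    finally show ?thesis .
  qed
  have Dq: "(q has_derivative (\<lambda>h. Dq y \<bullet> h)) (at y)" for y
  proof -
    have 1: "(s x has_derivative (\<lambda>h. - 2 *\<^sub>R (y - x) \<bullet> h)) (at y)" for x
      unfolding s_def by (auto intro!: derivative_eq_intros simp: inner_commute algebra_simps)
    have "((\<lambda>y. (max 0 (s x y))\<^sup>2) has_derivative (\<lambda>h. (2 * max 0 (s x y)) * (- 2 *\<^sub>R (y - x) \<bullet> h))) (at y)" for x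
      using has_derivative_compose[OF 1 max_0_square_has_derivative[unfolded has_field_derivative_def]] .
    then have "(q has_derivative (\<lambda>h. \<Sum>x\<in>T. (2 * max 0 (s x y)) * (- 2 *\<^sub>R (y - x) \<bullet> h))) (at y)"
      unfolding q_def by (intro has_derivative_sum)
    then show ?thesis unfolding Dq_def by (simp add: inner_sum_left mult.assoc)
  qed
  have cq: "continuous_on UNIV q" using Dq by (auto intro!: continuous_at_imp_continuous_on has_derivative_continuous)
  have cDq: "continuous_on UNIV Dq" unfolding Dq_def s_def by (intro continuous_intros)
  have "\<exists>m>0. \<forall>y\<in>K. m \<le> q y"
  proof (cases "K = {}")
    case False
    then obtain z where "z \<in> K" "\<forall>y\<in>K. q z \<le> q y"
      using continuous_attains_inf[OF K(1) False] cq continuous_on_subset by blast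
    then show ?thesis using qpos by blast
  qed (auto intro!: exI[of _ 1])
  then obtain m where m: "0 < m" "\<And>y. y \<in> K \<Longrightarrow> m \<le> q y" by blast
  define \<eta> where "\<eta> y = 1 - (max 0 (1 - q y / m))\<^sup>2" for y
  define D\<eta> where "D\<eta> y = (2 * max 0 (1 - q y / m) / m) *\<^sub>R Dq y" for y
  have qn: "0 \<le> q y" for y unfolding q_def by (intro sum_nonneg) auto
  show thesis
  proof (rule that[of \<eta> D\<eta> C])
    show "(\<eta> has_derivative (\<lambda>h. D\<eta> y \<bullet> h)) (at y)" for y
    proof -
      have 1: "((\<lambda>y. 1 - q y / m) has_derivative (\<lambda>h. - (Dq y \<bullet> h) / m)) (at y)"
        using m(1) Dq by (auto intro!: derivative_eq_intros)
      show ?thesis unfolding \<eta>_def D\<eta>_def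
        by (rule has_derivative_eq_rhs[OF has_derivative_diff[OF has_derivative_const
            has_derivative_compose[OF 1 max_0_square_has_derivative[unfolded has_field_derivative_def]]]])
           auto
    qed
    show "continuous_on UNIV D\<eta>" unfolding D\<eta>_def using m(1) by (intro continuous_intros cq cDq) auto
    show "0 \<le> \<eta> y \<and> \<eta> y \<le> 1" for y
    proof -
      have "0 \<le> max 0 (1 - q y / m)" "max 0 (1 - q y / m) \<le> 1" using qn[of y] m(1) by auto
      then show ?thesis unfolding \<eta>_def by (simp add: power_le_one)
    qed
    show "\<eta> y = 1" if "y \<in> K" for y using m(2)[OF that] m(1) by (simp add: \<eta>_def max_absorb1)
    show "compact C" unfolding C_def using T(2) by (intro compact_UN) auto
    show "C \<subseteq> A" unfolding C_def using r(2) T(1) by blast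
    show "\<eta> y = 0 \<and> D\<eta> y = 0" if "y \<notin> C" for y
      using q0[OF that] Dq0[OF that] by (simp add: \<eta>_def D\<eta>_def)
  qed
qed

text \<open>
  The product of \<open>\<epsilon> * sin (u / \<epsilon>)\<close>, for the linear function \<open>u x = (x - q) \<bullet> e\<close>, with a cutoff \<open>\<eta>\<close>. The first term
  of the gradient is bounded by the gradient of \<open>u\<close>, that is by one; the second is at most \<open>\<epsilon>\<close> times the
  maximal gradient of \<open>\<eta>\<close>, hence also bounded by one once \<open>\<epsilon>\<close> is small. Neither bound depends on the
  width of the collar between \<open>K\<close> and the complement of \<open>A\<close>.
\<close>

lemma oscillating_test_function_exists:
  fixes K A :: "'a::euclidean_space set"
  assumes K: "compact K" "K \<subseteq> A" and A: "open A" and e: "norm e = 1"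
  obtains \<epsilon>0 C where "0 < \<epsilon>0" "compact C" "C \<subseteq> A"
    "\<And>\<epsilon>. 0 < \<epsilon> \<Longrightarrow> \<epsilon> \<le> \<epsilon>0 \<Longrightarrow> \<exists>f Df. (\<forall>x. (f has_derivative (\<lambda>h. Df x \<bullet> h)) (at x)) \<and>
       continuous_on UNIV Df \<and> (\<forall>x. norm (Df x) \<le> 2) \<and> (\<forall>x. x \<notin> C \<longrightarrow> f x = 0 \<and> Df x = 0) \<and>
       (\<forall>x\<in>K. f x = \<epsilon> * sin (((x - q) \<bullet> e) / \<epsilon>))"
proof -
  obtain \<eta> D\<eta> C where \<eta>: "\<And>x. (\<eta> has_derivative (\<lambda>h. D\<eta> x \<bullet> h)) (at x)" "continuous_on UNIV D\<eta>"
    "\<And>x. 0 \<le> \<eta> x \<and> \<eta> x \<le> (1::real)" "\<And>x. x \<in> K \<Longrightarrow> \<eta> x = 1"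
    and C: "compact C" "C \<subseteq> A" "\<And>x. x \<notin> C \<Longrightarrow> \<eta> x = 0 \<and> D\<eta> x = 0"
    by (rule C1_cutoff_exists[OF K A], rule that) assumption+
  have "bounded (D\<eta> ` C)"
    using \<eta>(2) C by (intro compact_imp_bounded compact_continuous_image) (auto intro: continuous_on_subset)
  then obtain B0 where B0: "\<And>x. x \<in> C \<Longrightarrow> norm (D\<eta> x) \<le> B0" by (auto simp: bounded_iff)
  define B where "B = max B0 1"
  have B: "norm (D\<eta> x) \<le> B" "B > 0" for x using B0[of x] C(3)[of x] unfolding B_def by (cases "x \<in> C"; auto)+
  have c\<eta>: "continuous_on UNIV \<eta>" using \<eta>(1) by (auto intro!: continuous_at_imp_continuous_on has_derivative_continuous)
  show thesis
  proof (rule that[of "1 / B" C])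
    fix \<epsilon> :: real assume eps: "0 < \<epsilon>" "\<epsilon> \<le> 1 / B"
    define u where "u x = ((x - q) \<bullet> e) / \<epsilon>" for x
    define f where "f x = \<epsilon> * sin (u x) * \<eta> x" for x
    define Df where "Df x = (cos (u x) * \<eta> x) *\<^sub>R e + (\<epsilon> * sin (u x)) *\<^sub>R D\<eta> x" for x
    have u: "(u has_derivative (\<lambda>h. (h \<bullet> e) / \<epsilon>)) (at x)" for x
      unfolding u_def using eps by (auto intro!: derivative_eq_intros)
    have cu: "continuous_on UNIV u" unfolding u_def using eps by (intro continuous_intros) auto
    have "(f has_derivative (\<lambda>h. Df x \<bullet> h)) (at x)" for x
      unfolding f_def Df_def
      by (rule has_derivative_eq_rhs[OF has_derivative_mult[OF has_derivative_mult_right[OF has_derivative_sin[OF u]] \<eta>(1)]])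
         (use eps in \<open>auto simp: fun_eq_iff inner_add_left inner_commute algebra_simps\<close>)
    moreover have "continuous_on UNIV Df" unfolding Df_def by (intro continuous_intros cu c\<eta> \<eta>(2))
    moreover have "norm (Df x) \<le> 2" for x
    proof -
      have "\<bar>cos (u x) * \<eta> x\<bar> \<le> 1"
        using \<eta>(3)[of x] abs_cos_le_one[of "u x"] by (simp add: abs_mult mult_le_one)
      moreover have "\<bar>\<epsilon> * sin (u x)\<bar> * norm (D\<eta> x) \<le> (\<epsilon> * 1) * B"
        using B(1)[of x] B(2) eps abs_sin_le_one[of "u x"]
        by (intro mult_mono) (auto simp: abs_mult)
      moreover have "\<epsilon> * B \<le> 1" using eps B(2) by (simp add: field_simps)
      ultimately have "norm ((cos (u x) * \<eta> x) *\<^sub>R e) + norm ((\<epsilon> * sin (u x)) *\<^sub>R D\<eta> x) \<le> 2"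
        using e by simp
      then show ?thesis unfolding Df_def by (rule order_trans[OF norm_triangle_ineq])
    qed
    moreover have "f x = 0 \<and> Df x = 0" if "x \<notin> C" for x using C(3)[OF that] by (simp add: f_def Df_def)
    moreover have "f x = \<epsilon> * sin (((x - q) \<bullet> e) / \<epsilon>)" if "x \<in> K" for x
      using \<eta>(4)[OF that] by (simp add: f_def u_def)
    ultimately show "\<exists>f Df. (\<forall>x. (f has_derivative (\<lambda>h. Df x \<bullet> h)) (at x)) \<and>
       continuous_on UNIV Df \<and> (\<forall>x. norm (Df x) \<le> 2) \<and> (\<forall>x. x \<notin> C \<longrightarrow> f x = 0 \<and> Df x = 0) \<and>
       (\<forall>x\<in>K. f x = \<epsilon> * sin (((x - q) \<bullet> e) / \<epsilon>))" by blast
  qed (use B(2) C in auto)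
qed

section \<open>Variation of the sine, and continua\<close>

text \<open>
  The levels \<open>pi * \<epsilon> * (k + 1 / 2)\<close> are those at which \<open>sin (\<omega> / \<epsilon>)\<close> takes the values one and minus one alternately.
  Between two consecutive levels the sine term moves by \<open>2 * \<epsilon>\<close>, hence its approximation \<open>V\<close> by at least \<open>\<epsilon>\<close>. Here
  \<open>I\<close> is any upper bound for the variation of \<open>V\<close>; below it is the integral of the gradient along a segment.
\<close>

lemma oscillation_levels_cost:
  fixes \<omega> V I :: "real \<Rightarrow> real" and k :: int
  assumes eps: "0 < \<epsilon>" and cont: "continuous_on {0..1} \<omega>"
    and VI: "\<And>s t. 0 \<le> s \<Longrightarrow> s \<le> t \<Longrightarrow> t \<le> 1 \<Longrightarrow> \<bar>V t - V s\<bar> \<le> I t - I s"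
    and close: "\<And>t. 0 \<le> t \<Longrightarrow> t \<le> 1 \<Longrightarrow> \<bar>V t - \<epsilon> * sin (\<omega> t / \<epsilon>)\<bar> \<le> \<epsilon> / 2"
    and s: "0 \<le> s" "s \<le> 1" "\<omega> s = pi * \<epsilon> * (real_of_int k + 1 / 2)"
    and top: "pi * \<epsilon> * (real_of_int (k + int m) + 1 / 2) \<le> \<omega> 1"
  shows "real m * \<epsilon> \<le> I 1 - I s"
  using s top
proof (induction m arbitrary: s k)
  case 0
  then show ?case using VI[of s 1] by linarith
next
  case (Suc m)
  let ?l = "\<lambda>k. pi * \<epsilon> * (real_of_int k + 1 / 2)"
  have mono: "?l i \<le> ?l j" if "i \<le> j" for i j :: int
    using eps that by (intro mult_left_mono) auto
  have "?l (k + 1) \<le> \<omega> 1" by (rule order_trans[OF mono Suc.prems(4)]) simp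
  moreover have "\<omega> s \<le> ?l (k + 1)" using mono[of k "k + 1"] Suc.prems by simp
  moreover have "continuous_on {s..1} \<omega>" using cont Suc.prems by (auto intro: continuous_on_subset)
  ultimately obtain t where t: "s \<le> t" "t \<le> 1" "\<omega> t = ?l (k + 1)"
    using IVT'[of \<omega> s "?l (k + 1)" 1] Suc.prems by auto
  have "real m * \<epsilon> \<le> I 1 - I t"
    using Suc.prems t by (intro Suc.IH[of t "k + 1"]) (auto simp: algebra_simps)
  moreover have "\<epsilon> \<le> I t - I s"
  proof -
    have sn: "sin (?l j / \<epsilon>) = (if even j then 1 else - 1)" for j :: int
    proof -
      have "?l j / \<epsilon> = pi * real_of_int j + pi / 2" using eps by (simp add: field_simps)
      then show ?thesis by (simp add: sin_add)
    qed
    have "\<epsilon> \<le> \<bar>V t - V s\<bar>"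
    proof (cases "even k")
      case True
      then have "sin (\<omega> s / \<epsilon>) = 1" "sin (\<omega> t / \<epsilon>) = - 1"
        unfolding t Suc.prems sn by auto
      then have "\<bar>V s - \<epsilon> * 1\<bar> \<le> \<epsilon> / 2" "\<bar>V t - \<epsilon> * - 1\<bar> \<le> \<epsilon> / 2"
        using close[of s] close[of t] Suc.prems(1,2) t(1,2) by force+
      then show ?thesis by linarith
    next
      case False
      then have "sin (\<omega> s / \<epsilon>) = - 1" "sin (\<omega> t / \<epsilon>) = 1"
        unfolding t Suc.prems sn by auto
      then have "\<bar>V s - \<epsilon> * - 1\<bar> \<le> \<epsilon> / 2" "\<bar>V t - \<epsilon> * 1\<bar> \<le> \<epsilon> / 2"
        using close[of s] close[of t] Suc.prems(1,2) t(1,2) by force+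
      then show ?thesis by linarith
    qed
    then show ?thesis using VI[of s t] Suc.prems t by linarith
  qed
  ultimately show ?case by (simp add: algebra_simps)
qed

text \<open>
  Apart from two incomplete steps, at the beginning and at the end, the increment of \<open>\<omega>\<close> consists of full steps
  of length \<open>pi * \<epsilon>\<close>, each of which costs at least \<open>\<epsilon>\<close>.
\<close>

lemma increment_le_cost_of_sine:
  fixes \<omega> V I :: "real \<Rightarrow> real"
  assumes eps: "0 < \<epsilon>" and cont: "continuous_on {0..1} \<omega>"
    and VI: "\<And>s t. 0 \<le> s \<Longrightarrow> s \<le> t \<Longrightarrow> t \<le> 1 \<Longrightarrow> \<bar>V t - V s\<bar> \<le> I t - I s"
    and close: "\<And>t. 0 \<le> t \<Longrightarrow> t \<le> 1 \<Longrightarrow> \<bar>V t - \<epsilon> * sin (\<omega> t / \<epsilon>)\<bar> \<le> \<epsilon> / 2"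
  shows "\<omega> 1 - \<omega> 0 \<le> pi * (I 1 - I 0) + 2 * pi * \<epsilon>"
proof (cases "\<omega> 1 - \<omega> 0 \<le> 2 * pi * \<epsilon>")
  case True
  have "0 \<le> I 1 - I 0" using VI[of 0 1] by linarith
  then have "0 \<le> pi * (I 1 - I 0)" by simp
  then show ?thesis using True by linarith
next
  case False
  have pe: "0 < pi * \<epsilon>" using eps by simp
  \<comment> \<open>the first level above \<open>\<omega> 0\<close>, and below the number of further levels up to \<open>\<omega> 1\<close>\<close>
  define k where "k = \<lceil>\<omega> 0 / (pi * \<epsilon>) - 1 / 2\<rceil>"
  define l where "l j = pi * \<epsilon> * (real_of_int j + 1 / 2)" for j :: int
  have "\<omega> 0 / (pi * \<epsilon>) - 1 / 2 \<le> real_of_int k" "real_of_int k < \<omega> 0 / (pi * \<epsilon>) - 1 / 2 + 1"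
    unfolding k_def by linarith+
  then have "pi * \<epsilon> * (\<omega> 0 / (pi * \<epsilon>)) \<le> l k" "l k < pi * \<epsilon> * (\<omega> 0 / (pi * \<epsilon>) + 1)"
    unfolding l_def by (intro mult_left_mono mult_strict_left_mono; use pe in linarith)+
  then have k: "\<omega> 0 \<le> l k" "l k < \<omega> 0 + pi * \<epsilon>"
    using pe eps by (simp_all add: distrib_left)
  define m where "m = nat \<lfloor>(\<omega> 1 - l k) / (pi * \<epsilon>)\<rfloor>"
  have "0 \<le> (\<omega> 1 - l k) / (pi * \<epsilon>)" using False k pe by (intro divide_nonneg_pos) auto
  then have "real m \<le> (\<omega> 1 - l k) / (pi * \<epsilon>)" "(\<omega> 1 - l k) / (pi * \<epsilon>) < real m + 1"
    unfolding m_def by linarith+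
  then have m: "l k + pi * \<epsilon> * real m \<le> \<omega> 1" "\<omega> 1 < l k + pi * \<epsilon> * real m + pi * \<epsilon>"
    using pe by (simp_all add: field_simps)
  have "0 \<le> pi * \<epsilon> * real m" using pe by simp
  then have "l k \<le> \<omega> 1" using m by linarith
  then obtain s where s: "0 \<le> s" "s \<le> 1" "\<omega> s = l k"
    using IVT'[of \<omega> 0 "l k" 1] cont k by auto
  have "real m * \<epsilon> \<le> I 1 - I s"
    using m by (intro oscillation_levels_cost[OF eps cont VI close s(1,2) s(3)[unfolded l_def]])
       (auto simp: l_def algebra_simps)
  also have "\<dots> \<le> I 1 - I 0" using VI[of 0 s] s by linarith
  finally have "pi * (real m * \<epsilon>) \<le> pi * (I 1 - I 0)" by (intro mult_left_mono) auto
  then show ?thesis using m k by (simp add: algebra_simps)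
qed

lemma abs_increment_le_cost_of_sine:
  fixes \<omega> V I :: "real \<Rightarrow> real"
  assumes eps: "0 < \<epsilon>" and cont: "continuous_on {0..1} \<omega>"
    and VI: "\<And>s t. 0 \<le> s \<Longrightarrow> s \<le> t \<Longrightarrow> t \<le> 1 \<Longrightarrow> \<bar>V t - V s\<bar> \<le> I t - I s"
    and close: "\<And>t. 0 \<le> t \<Longrightarrow> t \<le> 1 \<Longrightarrow> \<bar>V t - \<epsilon> * sin (\<omega> t / \<epsilon>)\<bar> \<le> \<epsilon> / 2"
  shows "\<bar>\<omega> 1 - \<omega> 0\<bar> \<le> pi * (I 1 - I 0) + 2 * pi * \<epsilon>"
proof -
  have "\<omega> 1 - \<omega> 0 \<le> pi * (I 1 - I 0) + 2 * pi * \<epsilon>"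
    by (rule increment_le_cost_of_sine[OF eps cont VI close])
  moreover have "- \<omega> 1 - - \<omega> 0 \<le> pi * (I 1 - I 0) + 2 * pi * \<epsilon>"
  proof (rule increment_le_cost_of_sine[of \<epsilon> "\<lambda>t. - \<omega> t" "\<lambda>t. - V t"])
    show "\<bar>- V t - - V s\<bar> \<le> I t - I s" if "0 \<le> s" "s \<le> t" "t \<le> 1" for s t
      using VI[OF that] by linarith
    show "\<bar>- V t - \<epsilon> * sin (- \<omega> t / \<epsilon>)\<bar> \<le> \<epsilon> / 2" if "0 \<le> t" "t \<le> 1" for t
      using close[OF that] by (simp add: abs_minus_commute)
  qed (use eps cont in \<open>auto intro: continuous_on_minus\<close>)
  ultimately show ?thesis by linarith
qed

text \<open>
  The image of the ball is open and bounded, so the ray from \<open>\<phi> x\<close> has a first exit point, which lies on the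
  frontier of the image and hence on the image of the sphere. The preimage of the initial segment of the
  ray up to this point is the continuum.
\<close>

lemma preimage_of_ray_continuum:
  fixes \<phi> :: "'a::euclidean_space \<Rightarrow> 'a"
  assumes hom: "homeomorphism \<Omega> \<Omega>' \<phi> \<psi>" and \<Omega>': "open \<Omega>'"
    and R: "cball x0 R \<subseteq> \<Omega>" and x: "x \<in> ball x0 R" and e: "e \<noteq> 0"
  obtains F y where "compact F" "connected F" "F \<subseteq> cball x0 R" "x \<in> F" "y \<in> F" "dist x0 y = R"
    "\<And>z. z \<in> F \<Longrightarrow> \<exists>s\<ge>0. \<phi> z = \<phi> x + s *\<^sub>R e"
proof -
  have c\<phi>: "continuous_on \<Omega> \<phi>" and c\<psi>: "continuous_on \<Omega>' \<psi>"
    and inv: "\<And>z. z \<in> \<Omega> \<Longrightarrow> \<psi> (\<phi> z) = z" "\<And>z. z \<in> \<Omega>' \<Longrightarrow> \<phi> (\<psi> z) = z"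
    and im: "\<phi> ` \<Omega> = \<Omega>'"
    using hom unfolding homeomorphism_def by blast+
  have bs: "ball x0 R \<subseteq> cball x0 R" by (rule ball_subset_cball)
  then have bO: "ball x0 R \<subseteq> \<Omega>" using R by blast
  let ?V = "\<phi> ` ball x0 R"
  have "openin (top_of_set \<Omega>') ?V"
    using bO by (intro homeomorphism_imp_open_map[OF hom] open_subset) auto
  then have oV: "open ?V" using \<Omega>' by (metis openin_open_eq)
  have comp: "compact (\<phi> ` cball x0 R)"
    using c\<phi> R by (intro compact_continuous_image) (auto intro: continuous_on_subset)
  have Vc: "?V \<subseteq> \<phi> ` cball x0 R" using bs by blast
  then have bV: "bounded ?V" using comp by (meson bounded_subset compact_imp_bounded)
  have "\<phi> x \<in> interior ?V" using x oV by (simp add: interior_open)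
  then obtain d where d: "0 < d" "\<phi> x + d *\<^sub>R e \<in> frontier ?V"
      "\<And>s. 0 \<le> s \<Longrightarrow> s < d \<Longrightarrow> \<phi> x + s *\<^sub>R e \<in> interior ?V"
    using ray_to_frontier[OF bV _ e] by metis
  have clV: "closure ?V \<subseteq> \<phi> ` cball x0 R"
    using Vc comp by (intro closure_minimal compact_imp_closed) auto
  have seg: "\<phi> x + s *\<^sub>R e \<in> \<phi> ` cball x0 R" if "0 \<le> s" "s \<le> d" for s
  proof (cases "s = d")
    case True
    then show ?thesis using d(2) clV by (auto simp: frontier_def)
  next
    case False
    then have "\<phi> x + s *\<^sub>R e \<in> interior ?V" using d(3) that by simp
    then show ?thesis using Vc interior_subset by blast
  qed
  define F where "F = (\<lambda>s. \<psi> (\<phi> x + s *\<^sub>R e)) ` {0..d}"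
  have cO': "\<phi> ` cball x0 R \<subseteq> \<Omega>'" using R im by blast
  have cont: "continuous_on {0..d} (\<lambda>s. \<psi> (\<phi> x + s *\<^sub>R e))"
    using seg cO' by (intro continuous_on_compose2[OF c\<psi>] continuous_intros) auto
  obtain y where y: "y \<in> cball x0 R" "\<phi> x + d *\<^sub>R e = \<phi> y" using seg[of d] d(1) by auto
  have "\<phi> y \<notin> ?V" using d(2) y(2) oV by (auto simp: frontier_def interior_open)
  then have "y \<notin> ball x0 R" by blast
  then have dy: "dist x0 y = R" using y(1) by simp
  show thesis
  proof (rule that[of F y])
    show "compact F" unfolding F_def using cont by (intro compact_continuous_image) auto
    show "connected F" unfolding F_def using cont by (intro connected_continuous_image) auto
    show "F \<subseteq> cball x0 R"
    proof
      fix z assume "z \<in> F"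
      then obtain s where s: "0 \<le> s" "s \<le> d" "z = \<psi> (\<phi> x + s *\<^sub>R e)" unfolding F_def by auto
      from seg[OF s(1,2)] obtain u where u: "u \<in> cball x0 R" "\<phi> x + s *\<^sub>R e = \<phi> u" by blast
      then have "z = u" using s inv(1) R by auto
      then show "z \<in> cball x0 R" using u by simp
    qed
    have "\<psi> (\<phi> x + 0 *\<^sub>R e) = x" using inv(1) x bO by auto
    then show "x \<in> F" unfolding F_def using d(1) by (metis atLeastAtMost_iff imageI less_eq_real_def order_refl)
    have "\<psi> (\<phi> x + d *\<^sub>R e) = y" using inv(1) y R by auto
    then show "y \<in> F" unfolding F_def using d(1) by (metis atLeastAtMost_iff imageI less_eq_real_def order_refl)
    show "\<exists>s\<ge>0. \<phi> z = \<phi> x + s *\<^sub>R e" if "z \<in> F" for z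
    proof -
      obtain s where s: "0 \<le> s" "s \<le> d" "z = \<psi> (\<phi> x + s *\<^sub>R e)" using \<open>z \<in> F\<close> unfolding F_def by auto
      then show ?thesis using inv(2) seg[OF s(1,2)] cO' by blast
    qed
  qed (rule dy)
qed

lemma exists_coordinate_ge:
  fixes x :: "real ^ 'n::finite"
  shows "\<exists>i. norm x / real CARD('n) \<le> \<bar>x $ i\<bar>"
proof (rule ccontr)
  assume "\<not> ?thesis"
  then have "(\<Sum>i\<in>UNIV. \<bar>x $ i\<bar>) < (\<Sum>i\<in>(UNIV::'n set). norm x / real CARD('n))"
    by (intro sum_strict_mono) (auto simp: not_le)
  then show False using norm_le_l1_cart[of x] by simp
qed

text \<open>
  A connected set that extends by \<open>h\<close> in the direction \<open>i\<close> meets every hyperplane in between. A measurable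
  choice of one point for each hyperplane would not give an affine map, so points are chosen for finitely many
  hyperplanes only and are moved along the \<open>i\<close>-axis in between. For a fine grid this stays in any
  given neighbourhood \<open>U\<close> of the continuum.
\<close>

lemma continuum_staircase_selection:
  fixes F U :: "(real ^ 'n::finite) set"
  assumes F: "compact F" "connected F" "F \<subseteq> U" and U: "open U"
    and ab: "a \<in> F" "b \<in> F" "a $ i + h \<le> b $ i" and h: "0 < h"
  obtains N X where "0 < (N::nat)" "\<And>k. k < N \<Longrightarrow> X k $ i = a $ i + h * real k / real N"
    "\<And>k s. k < N \<Longrightarrow> 0 \<le> s \<Longrightarrow> s \<le> h / real N \<Longrightarrow> X k + s *\<^sub>R axis i 1 \<in> U"
proof -
  obtain r where r: "0 < r" "(\<Union>x\<in>F. cball x r) \<subseteq> U"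
    using compact_subset_open_imp_cball_epsilon_subset[OF F(1) U F(3)] by metis
  obtain N :: nat where N: "0 < N" "h / r < real N"
    using reals_Archimedean2[of "max 0 (h / r)"] by auto
  have hN: "h / real N \<le> r" using N r(1) by (simp add: field_simps)
  have "\<exists>x\<in>F. x $ i = a $ i + h * real k / real N" if "k < N" for k
  proof (rule connected_ivt_component_cart[OF F(2) ab(1,2)])
    show "a $ i \<le> a $ i + h * real k / real N" using h by simp
    have "h * real k / real N \<le> h" using that h by (simp add: field_simps)
    then show "a $ i + h * real k / real N \<le> b $ i" using ab(3) by linarith
  qed
  then obtain X where X: "\<And>k. k < N \<Longrightarrow> X k \<in> F \<and> X k $ i = a $ i + h * real k / real N" by metis
  show thesis
  proof (rule that[OF N(1), of X])
    fix k s assume "k < N" "0 \<le> s" "s \<le> h / real N"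
    then have "X k + s *\<^sub>R axis i 1 \<in> cball (X k) r" using hN by (simp add: dist_norm)
    then show "X k + s *\<^sub>R axis i 1 \<in> U" using r(2) X[OF \<open>k < N\<close>] by blast
  qed (use X in blast)
qed

section \<open>Mollification\<close>

lemma box_bump_shift:
  "box_bump 1 (x - vec \<delta>) (x + vec \<delta>) y = box_bump 1 (- vec \<delta>) (vec \<delta>) (y - x)"
  unfolding box_bump_def by (intro prod.cong) (auto simp: algebra_simps)

lemma box_bump_even: "box_bump 1 (- vec \<delta>) (vec \<delta>) (- z) = box_bump 1 (- vec \<delta>) (vec \<delta>) z"
  unfolding box_bump_def by (intro prod.cong) (auto simp: algebra_simps)

lemma box_bump_support_norm:
  fixes z :: "real ^ 'n::finite"
  assumes "box_bump 1 (- vec \<delta>) (vec \<delta>) z \<noteq> 0"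
  shows "norm z \<le> real CARD('n) * \<delta>"
proof -
  have "z \<in> box (- vec \<delta>) (vec \<delta>)" using assms box_bump_eq_0[of 1 z "- vec \<delta>" "vec \<delta>"] by auto
  then have "\<bar>z $ i\<bar> \<le> \<delta>" for i by (auto simp: mem_box_cart abs_le_iff less_imp_le minus_le_iff)
  then have "(\<Sum>i\<in>UNIV. \<bar>z $ i\<bar>) \<le> (\<Sum>i\<in>(UNIV::'n set). \<delta>)" by (intro sum_mono)
  then show ?thesis using norm_le_l1_cart[of z] by simp
qed

lemma box_bump_continuous: "continuous_on UNIV (box_bump \<alpha> a b)"
  using Ck_box_bump[of 0] by simp

lemma box_bump_integrable: "0 < \<alpha> \<Longrightarrow> integrable lborel (box_bump \<alpha> a b)"
  by (rule integrable_continuous_compact_support[OF box_bump_continuous compact_cbox[of a b]])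
     (use box_bump_eq_0 box_subset_cbox in blast)

text \<open>
  Needed to normalize the mollifier.
\<close>

lemma box_bump_integral_pos:
  assumes "0 < \<alpha>" "box a b \<noteq> {}"
  shows "0 < (LINT x|lborel. box_bump \<alpha> a b x)"
proof -
  have "(LINT x|lborel. box_bump \<alpha> a b x) \<noteq> 0"
  proof
    assume "(LINT x|lborel. box_bump \<alpha> a b x) = 0"
    then have "AE x in lborel. box_bump \<alpha> a b x = 0"
      using integral_nonneg_eq_0_iff_AE[OF box_bump_integrable[OF assms(1)] AE_I2[OF box_bump_nonneg]]
      by blast
    then have "AE x in lborel. x \<notin> box a b"
      by (rule AE_mp) (use box_bump_pos[OF assms(1)] in \<open>force intro!: AE_I2\<close>)
    then have "box a b \<in> null_sets lborel" by (simp add: AE_iff_null_sets[symmetric])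
    then have "negligible (box a b)"
      using null_sets_completionI negligible_iff_null_sets by blast
    then show False using assms(2) open_not_negligible[OF open_box] by blast
  qed
  moreover have "0 \<le> (LINT x|lborel. box_bump \<alpha> a b x)"
    using box_bump_nonneg by (intro Bochner_Integration.integral_nonneg) auto
  ultimately show ?thesis by linarith
qed

lemma continuous_compact_support_uniform:
  fixes v :: "'a::euclidean_space \<Rightarrow> real"
  assumes v: "continuous_on UNIV v" and K: "compact K" "\<And>x. x \<notin> K \<Longrightarrow> v x = 0" and "0 < \<beta>"
  obtains d where "0 < d" "\<And>x y. norm (y - x) \<le> d \<Longrightarrow> \<bar>v y - v x\<bar> \<le> \<beta>"
proof -
  obtain R where R: "K \<subseteq> cball 0 R"
    using compact_imp_bounded[OF K(1)] by (auto simp: bounded_iff subset_iff)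
  have "uniformly_continuous_on (cball 0 (R + 1)) v"
    using v by (intro compact_uniformly_continuous) (auto intro: continuous_on_subset)
  then obtain d where d: "0 < d"
      "\<And>x y. x \<in> cball 0 (R + 1) \<Longrightarrow> y \<in> cball 0 (R + 1) \<Longrightarrow> dist y x < d \<Longrightarrow> dist (v y) (v x) < \<beta>"
    using \<open>0 < \<beta>\<close> unfolding uniformly_continuous_on_def by meson
  show thesis
  proof (rule that[of "min (d / 2) 1"])
    show "0 < min (d / 2) 1" using d(1) by simp
    fix x y :: 'a assume xy: "norm (y - x) \<le> min (d / 2) 1"
    show "\<bar>v y - v x\<bar> \<le> \<beta>"
    proof (cases "x \<in> cball 0 (R + 1) \<and> y \<in> cball 0 (R + 1)")
      case True
      then show ?thesis using d xy by (fastforce simp: dist_norm dist_real_def)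
    next
      case False
      moreover have "norm y \<le> norm x + norm (y - x)" "norm x \<le> norm y + norm (y - x)"
        using norm_triangle_sub[of y x] norm_triangle_sub[of x y] by (simp_all add: norm_minus_commute)
      ultimately have "x \<notin> cball 0 R" "y \<notin> cball 0 R" using xy by (auto simp: mem_cball_0 simp del: mem_cball)
      then have "v x = 0" "v y = 0" using R K(2) by blast+
      then show ?thesis using \<open>0 < \<beta>\<close> by simp
    qed
  qed
qed

text \<open>
  The linearization of the power that takes the place of Hoelder's inequality.
\<close>

lemma le_const_plus_powr:
  fixes t c p :: real
  assumes "0 \<le> t" "0 < c" "1 \<le> p"
  shows "t \<le> c + c powr (1 - p) * t powr p"
proof (cases "t \<le> c")
  case True
  then show ?thesis by (smt (verit, best) mult_nonneg_nonneg powr_ge_zero)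
next
  case False
  then have "c powr (p - 1) \<le> t powr (p - 1)" using assms by (intro powr_mono2) auto
  then have "c powr (1 - p) * c powr (p - 1) * t \<le> c powr (1 - p) * t powr (p - 1) * t"
    using assms by (intro mult_right_mono mult_left_mono) auto
  moreover have "c powr (1 - p) * c powr (p - 1) = 1" using assms by (simp add: powr_add[symmetric])
  moreover have "t powr (p - 1) * t = t powr p" using False assms by (simp add: powr_mult_base[symmetric] powr_diff)
  ultimately show ?thesis using assms by (simp add: mult.assoc)
qed


text \<open>
  Here \<open>v\<close> is the extension of \<open>w\<close> by zero, \<open>V\<close> its convolution with a normalized bump of small support, and
  \<open>H\<close> the convolution of \<open>norm g powr p\<close>, set to zero outside \<open>\<Omega>\<close>, with the same kernel. At points of \<open>C\<close> the translated
  kernel is a test function, so the derivative can be moved onto \<open>w\<close>: the gradient of \<open>V\<close> is the convolution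
  of \<open>g\<close>. The pointwise bound for \<open>norm g\<close> by \<open>c\<close> and \<open>norm g powr p\<close> then survives the averaging, and Tonelli's theorem gives
  the bound for the integral of \<open>H\<close>.
\<close>

lemma mollification:
  fixes \<Omega> :: "(real ^ 'n::finite) set" and v w :: "real ^ 'n \<Rightarrow> real" and g :: "real ^ 'n \<Rightarrow> real ^ 'n"
  assumes \<Omega>: "open \<Omega>" and wg: "is_weak_gradient \<Omega> w g" and vw: "\<And>x. x \<in> \<Omega> \<Longrightarrow> w x = v x"
    and v: "continuous_on UNIV v" and K: "compact K" "K \<subseteq> \<Omega>" "\<And>x. x \<notin> K \<Longrightarrow> v x = 0"
    and p: "1 \<le> p" and gp: "(\<lambda>x. norm (g x) powr p) absolutely_integrable_on \<Omega>"
    and C: "compact C" "C \<subseteq> \<Omega>" and \<beta>: "0 < \<beta>"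
  obtains V D H where "\<And>x. (V has_derivative (\<lambda>h. D x \<bullet> h)) (at x)" "continuous_on UNIV D"
    "\<And>x. \<bar>V x - v x\<bar> \<le> \<beta>"
    "H \<in> borel_measurable borel"
    "(\<integral>\<^sup>+x. H x \<partial>lborel) \<le> ennreal (LINT x:\<Omega>|lebesgue. norm (g x) powr p)"
    "\<And>x c. x \<in> C \<Longrightarrow> 0 < c \<Longrightarrow> ennreal (norm (D x)) \<le> ennreal c + ennreal (c powr (1 - p)) * H x"
proof -
  obtain d1 where d1: "0 < d1" "\<And>x y. norm (y - x) \<le> d1 \<Longrightarrow> \<bar>v y - v x\<bar> \<le> \<beta>"
    using continuous_compact_support_uniform[OF v K(1) K(3) \<beta>] by metis
  obtain d2 where d2: "0 < d2" "(\<Union>x\<in>C. cball x d2) \<subseteq> \<Omega>"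
    using compact_subset_open_imp_cball_epsilon_subset[OF C(1) \<Omega> C(2)] by metis
  define \<delta> where "\<delta> = min d1 d2 / real CARD('n)"
  have \<delta>: "0 < \<delta>" "real CARD('n) * \<delta> \<le> d1" "real CARD('n) * \<delta> \<le> d2"
    using d1(1) d2(1) by (auto simp: \<delta>_def)
  define \<rho> where "\<rho> = box_bump 1 (- vec \<delta>) (vec \<delta> :: real ^ 'n)"
  define Z where "Z = (LINT x|lborel. \<rho> x)"
  define D\<rho> where "D\<rho> z = (\<chi> i. partial_deriv i \<rho> z)" for z
  have box_ne: "box (- vec \<delta>) (vec \<delta> :: real ^ 'n) \<noteq> {}"
  proof -
    have "(0 :: real ^ 'n) \<in> box (- vec \<delta>) (vec \<delta>)" using \<delta>(1) by (simp add: mem_box_cart)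
    then show ?thesis by blast
  qed
  have Z: "0 < Z" unfolding Z_def \<rho>_def by (rule box_bump_integral_pos[OF _ box_ne]) simp
  have \<rho>0: "0 \<le> \<rho> z" for z unfolding \<rho>_def by (rule box_bump_nonneg)
  have \<rho>supp: "norm z \<le> real CARD('n) * \<delta>" if "\<rho> z \<noteq> 0" for z
    using box_bump_support_norm that unfolding \<rho>_def by blast
  have \<rho>test: "test_function UNIV \<rho>" unfolding \<rho>_def by (rule test_function_box_bump) auto
  have c\<rho>: "continuous_on UNIV \<rho>" and cD\<rho>: "continuous_on UNIV D\<rho>"
    unfolding D\<rho>_def using test_function_continuous[OF \<rho>test] test_function_continuous_partial[OF \<rho>test]
    by (auto intro: continuous_on_vec_lambda)
  have \<rho>der: "(\<rho> has_derivative (\<lambda>h. D\<rho> z \<bullet> h)) (at z)" for z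
    using differentiable_has_derivative_partial[OF test_function_differentiable[OF \<rho>test], of z]
    by (simp add: D\<rho>_def inner_vec_def mult.commute)
  have \<rho>int: "integrable lborel \<rho>" unfolding \<rho>_def by (rule box_bump_integrable) simp
  have c\<rho>': "continuous_on UNIV (\<lambda>y. \<rho> (y - x))" for x
    by (rule continuous_on_compose2[OF c\<rho>]) (auto intro!: continuous_intros)
  have cD\<rho>': "continuous_on UNIV (\<lambda>y. D\<rho> (y - x))" for x
    by (rule continuous_on_compose2[OF cD\<rho>]) (auto intro!: continuous_intros)
  have \<rho>shift: "(LINT y|lborel. \<rho> (y - x)) = Z" for x
    using integral_translate[of \<rho> "- x"] c\<rho> unfolding Z_def by (simp add: borel_measurable_continuous_onI)
  have \<rho>shift_int: "integrable lborel (\<lambda>y. \<rho> (y - x))" for x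
  proof -
    have "integrable (distr lborel borel ((+) (- x))) \<rho>" using \<rho>int by (simp only: lborel_distr_plus)
    then show ?thesis by (subst (asm) integrable_distr_eq) (auto simp: borel_measurable_continuous_onI[OF c\<rho>])
  qed
  obtain a b where ab: "K \<subseteq> cbox a b" using bounded_subset_cbox_symmetric compact_imp_bounded[OF K(1)] by metis
  define V where "V x = integral (cbox a b) (\<lambda>y. v y * \<rho> (y - x)) / Z" for x
  define D where "D x = (1 / Z) *\<^sub>R integral (cbox a b) (\<lambda>y. v y *\<^sub>R - D\<rho> (y - x))" for x
  have LINT_eq: "integral (cbox a b) h = (LINT y|lborel. h y)" and LINT_ex: "integrable lborel h"
    if "continuous_on UNIV h" "\<And>y. y \<notin> K \<Longrightarrow> h y = 0" for h :: "real ^ 'n \<Rightarrow> 'b::euclidean_space"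
  proof -
    show i: "integrable lborel h" by (rule integrable_continuous_compact_support[OF that(1) K(1) that(2)])
    then have "(h has_integral (LINT y|lborel. h y)) UNIV" by (rule has_integral_integral_lborel)
    moreover have "(\<lambda>y. if y \<in> cbox a b then h y else 0) = h" using that(2) ab by (intro ext) auto
    ultimately have "(h has_integral (LINT y|lborel. h y)) (cbox a b)"
      using has_integral_restrict_UNIV[of "cbox a b" h] by simp
    then show "integral (cbox a b) h = (LINT y|lborel. h y)" by (rule integral_unique)
  qed
  have P_int: "integrable lebesgue (\<lambda>x. indicator \<Omega> x *\<^sub>R norm (g x) powr p)"
    using gp by (simp add: set_integrable_def)
  \<comment> \<open>Tonelli's theorem is available for Borel functions, hence the passage from \<open>?P\<close> to a Borel representative \<open>P'\<close>\<close>
  let ?P = "\<lambda>x. ennreal (indicator \<Omega> x *\<^sub>R norm (g x) powr p)"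
  have "?P \<in> borel_measurable lebesgue"
    using borel_measurable_integrable[OF P_int] by (rule measurable_compose) simp
  then obtain P' where P'[measurable]: "P' \<in> borel_measurable lborel" and P'ae: "AE x in lborel. ?P x = P' x"
    using completion_ex_borel_measurable by blast
  have [measurable]: "\<rho> \<in> borel_measurable borel" using c\<rho> by (rule borel_measurable_continuous_onI)
  define H where "H x = (\<integral>\<^sup>+y. P' y * ennreal (\<rho> (y - x) / Z) \<partial>lborel)" for x
  have one: "(\<integral>\<^sup>+y. ennreal (\<rho> (y - x) / Z) \<partial>lborel) = 1" for x
    using \<rho>shift_int[of x] \<rho>shift[of x] Z \<rho>0
    by (subst nn_integral_eq_integral) auto
  show thesis
  proof (rule that[of V D H])
    show "(V has_derivative (\<lambda>h. D x \<bullet> h)) (at x)" for x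
    proof -
      let ?fx = "\<lambda>x y. blinfun_inner_right (v y *\<^sub>R - D\<rho> (y - x))"
      have "((\<lambda>x. integral (cbox a b) (\<lambda>y. v y * \<rho> (y - x))) has_derivative
          blinfun_apply (integral (cbox a b) (?fx x))) (at x within UNIV)"
      proof (rule leibniz_rule)
        fix x y :: "real ^ 'n"
        have "((\<lambda>x. y - x) has_derivative (\<lambda>h. - h)) (at x)" by (auto intro!: derivative_eq_intros)
        from has_derivative_compose[OF this \<rho>der]
        show "((\<lambda>x. v y * \<rho> (y - x)) has_derivative blinfun_apply (?fx x y)) (at x within UNIV)"
          by (auto intro!: derivative_eq_intros simp: inner_commute)
      next
        show "(\<lambda>y. v y * \<rho> (y - x)) integrable_on cbox a b" for x
          by (intro integrable_continuous continuous_on_mult) (auto intro: continuous_on_subset[OF v] continuous_on_subset[OF c\<rho>'])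
        show "continuous_on (UNIV \<times> cbox a b) (\<lambda>(x, y). ?fx x y)"
          unfolding split_beta
          by (intro bounded_linear.continuous_on[OF bounded_linear_blinfun_inner_right] continuous_on_scaleR continuous_on_minus
              continuous_on_compose2[OF v] continuous_on_compose2[OF cD\<rho>] continuous_intros) auto
      qed auto
      moreover have "integral (cbox a b) (?fx x) = blinfun_inner_right (integral (cbox a b) (\<lambda>y. v y *\<^sub>R - D\<rho> (y - x)))"
      proof -
        have "(\<lambda>y. v y *\<^sub>R - D\<rho> (y - x)) integrable_on cbox a b"
          by (intro integrable_continuous continuous_on_scaleR continuous_on_minus
              continuous_on_subset[OF v] continuous_on_subset[OF cD\<rho>']) auto
        from integral_linear[OF this bounded_linear_blinfun_inner_right] show ?thesis
          by (simp only: o_def)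
      qed
      ultimately have "((\<lambda>x. integral (cbox a b) (\<lambda>y. v y * \<rho> (y - x))) has_derivative
          (\<lambda>h. integral (cbox a b) (\<lambda>y. v y *\<^sub>R - D\<rho> (y - x)) \<bullet> h)) (at x)"
        by (simp only: blinfun_inner_right.rep_eq)
      from has_derivative_mult_right[OF this, of "1 / Z"] show ?thesis
        unfolding V_def D_def by simp
    qed
    show "continuous_on UNIV D"
      unfolding D_def
      by (intro continuous_intros integral_continuous_on_param)
         (auto simp: split_beta intro!: continuous_on_scaleR continuous_on_minus continuous_on_compose2[OF v]
            continuous_on_compose2[OF cD\<rho>] continuous_intros)
    show "\<bar>V x - v x\<bar> \<le> \<beta>" for x
    proof -
      have vi: "integrable lborel (\<lambda>y. v y * \<rho> (y - x))"
        and veq: "integral (cbox a b) (\<lambda>y. v y * \<rho> (y - x)) = (LINT y|lborel. v y * \<rho> (y - x))"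
        using K(3) by (intro LINT_ex LINT_eq continuous_on_mult v c\<rho>'; simp)+
      have "(V x - v x) * Z = (LINT y|lborel. (v y - v x) * \<rho> (y - x))"
        unfolding V_def veq using Z vi \<rho>shift_int[of x] \<rho>shift[of x] by (simp add: left_diff_distrib)
      also have "\<bar>\<dots>\<bar> \<le> (LINT y|lborel. \<beta> * \<rho> (y - x))"
      proof -
        have "integrable lborel (\<lambda>y. (v y - v x) * \<rho> (y - x))"
          using vi \<rho>shift_int[of x] by (simp add: left_diff_distrib)
        moreover have "\<bar>(v y - v x) * \<rho> (y - x)\<bar> \<le> \<beta> * \<rho> (y - x)" for y
          using d1(2)[of y x] \<rho>supp[of "y - x"] \<delta>(2) \<rho>0[of "y - x"]
          by (cases "\<rho> (y - x) = 0") (auto simp: abs_mult intro!: mult_right_mono)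
        ultimately show ?thesis
          using \<rho>shift_int[of x] by (intro order_trans[OF integral_abs_bound] integral_mono) auto
      qed
      also have "\<dots> = \<beta> * Z" using \<rho>shift[of x] by simp
      finally have "\<bar>V x - v x\<bar> * Z \<le> \<beta> * Z" using Z by (simp add: abs_mult)
      then show ?thesis using Z by simp
    qed
    show "H \<in> borel_measurable borel" unfolding H_def by measurable
    show "(\<integral>\<^sup>+x. H x \<partial>lborel) \<le> ennreal (LINT x:\<Omega>|lebesgue. norm (g x) powr p)"
    proof -
      have "(\<integral>\<^sup>+x. H x \<partial>lborel) = (\<integral>\<^sup>+y. (\<integral>\<^sup>+x. P' y * ennreal (\<rho> (y - x) / Z) \<partial>lborel) \<partial>lborel)"
        unfolding H_def by (rule lborel_pair.Fubini') measurable
      also have "\<dots> = (\<integral>\<^sup>+y. P' y \<partial>lborel)"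
      proof (rule nn_integral_cong)
        fix y
        have "\<rho> (y - x) = \<rho> (x - y)" for x
          using box_bump_even[of \<delta> "x - y"] unfolding \<rho>_def by simp
        then show "(\<integral>\<^sup>+x. P' y * ennreal (\<rho> (y - x) / Z) \<partial>lborel) = P' y"
          using one[of y] by (simp add: nn_integral_cmult)
      qed
      also have "\<dots> = (\<integral>\<^sup>+y. ?P y \<partial>lebesgue)"
        using AE_completion[OF P'ae]
        by (subst nn_integral_completion[symmetric]) (auto intro!: nn_integral_cong_AE elim!: AE_mp)
      also have "\<dots> = ennreal (LINT x:\<Omega>|lebesgue. norm (g x) powr p)"
        unfolding set_lebesgue_integral_def by (rule nn_integral_eq_integral[OF P_int]) auto
      finally show ?thesis by simp
    qed
    fix x and c :: real assume x: "x \<in> C" and c: "0 < c"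
    define \<eta> where "\<eta> y = \<rho> (y - x)" for y
    have cb: "cbox (x - vec \<delta>) (x + vec \<delta>) \<subseteq> \<Omega>"
    proof
      fix y assume y: "y \<in> cbox (x - vec \<delta>) (x + vec \<delta>)"
      have "\<bar>(y - x) $ i\<bar> \<le> \<delta>" for i
        using y by (auto simp: mem_box_cart abs_le_iff diff_le_eq le_diff_eq add.commute)
      then have "(\<Sum>i\<in>UNIV. \<bar>(y - x) $ i\<bar>) \<le> (\<Sum>i\<in>(UNIV::'n set). \<delta>)" by (intro sum_mono)
      then have "norm (y - x) \<le> d2" using norm_le_l1_cart[of "y - x"] \<delta>(3) by simp
      then have "y \<in> cball x d2" by (simp add: dist_norm norm_minus_commute)
      then show "y \<in> \<Omega>" using d2(2) x by blast
    qed
    have \<eta>_eq: "\<eta> = box_bump 1 (x - vec \<delta>) (x + vec \<delta>)"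
      unfolding \<eta>_def \<rho>_def by (intro ext) (simp only: box_bump_shift)
    have \<eta>test: "test_function \<Omega> \<eta>" unfolding \<eta>_eq using cb by (intro test_function_box_bump) auto
    have \<eta>0: "\<eta> y = 0" if "y \<notin> cbox (x - vec \<delta>) (x + vec \<delta>)" for y
      unfolding \<eta>_eq using that box_subset_cbox by (intro box_bump_eq_0) auto
    have \<eta>der: "partial_deriv i \<eta> y = D\<rho> (y - x) $ i" for i y
    proof -
      have "((\<lambda>y. y - x) has_derivative (\<lambda>h. h)) (at y)" by (auto intro!: derivative_eq_intros)
      from partial_deriv_eq[OF has_derivative_compose[OF this \<rho>der]]
      show ?thesis unfolding \<eta>_def[abs_def] by (simp add: inner_axis)
    qed
    have \<eta>g: "integrable lebesgue (\<lambda>y. indicator \<Omega> y *\<^sub>R (\<eta> y *\<^sub>R g y))"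
      using wg \<eta>0 cb test_function_continuous[OF \<eta>test] unfolding is_weak_gradient_def
      by (intro integrable_scaleR_compact_support[OF _ compact_cbox[of "x - vec \<delta>" "x + vec \<delta>"]]) auto
    \<comment> \<open>the defining identity of the weak gradient, tested with the translated kernel \<open>\<eta>\<close>\<close>
    have D_eq: "D x = (LINT y|lebesgue. (1 / Z) *\<^sub>R (indicator \<Omega> y *\<^sub>R (\<eta> y *\<^sub>R g y)))"
    proof -
      have "D x $ i = (LINT y|lebesgue. (1 / Z) *\<^sub>R (indicator \<Omega> y *\<^sub>R (\<eta> y *\<^sub>R g y))) $ i" for i
      proof -
        have i1: "integrable lborel (\<lambda>y. v y *\<^sub>R - D\<rho> (y - x))"
          and e1: "integral (cbox a b) (\<lambda>y. v y *\<^sub>R - D\<rho> (y - x)) = (LINT y|lborel. v y *\<^sub>R - D\<rho> (y - x))"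
          using K(3) by (intro LINT_ex LINT_eq continuous_on_scaleR continuous_on_minus v cD\<rho>'; simp)+
        have i1': "integrable lborel (\<lambda>y. v y * partial_deriv i \<eta> y)"
          using integrable_bounded_linear[OF bounded_linear_vec_nth[of i] i1] by (simp add: \<eta>der)
        have "D x $ i = (1 / Z) * (LINT y|lborel. (v y *\<^sub>R - D\<rho> (y - x)) $ i)"
          unfolding D_def e1 integral_bounded_linear[OF bounded_linear_vec_nth i1]
          by (simp only: vector_scaleR_component real_scaleR_def)
        also have "(LINT y|lborel. (v y *\<^sub>R - D\<rho> (y - x)) $ i) = - (LINT y|lborel. v y * partial_deriv i \<eta> y)"
          by (simp add: \<eta>der)
        also have "(LINT y|lborel. v y * partial_deriv i \<eta> y) = (LINT y|lebesgue. v y * partial_deriv i \<eta> y)"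
          using i1' by (simp add: integral_completion)
        also have "(\<lambda>y. v y * partial_deriv i \<eta> y) = (\<lambda>y. indicator \<Omega> y *\<^sub>R (w y * partial_deriv i \<eta> y))"
          using vw K by (intro ext) (auto split: split_indicator)
        also have "(LINT y|lebesgue. indicator \<Omega> y *\<^sub>R (w y * partial_deriv i \<eta> y))
            = - (LINT y:\<Omega>|lebesgue. g y $ i * \<eta> y)"
          using wg \<eta>test unfolding is_weak_gradient_def set_lebesgue_integral_def by blast
        also have "(LINT y:\<Omega>|lebesgue. g y $ i * \<eta> y) = (LINT y|lebesgue. indicator \<Omega> y *\<^sub>R (\<eta> y *\<^sub>R g y)) $ i"
          unfolding set_lebesgue_integral_def
          by (subst integral_bounded_linear[OF bounded_linear_vec_nth \<eta>g, symmetric]) (simp add: mult.commute mult.left_commute)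
        finally show ?thesis
          by (simp only: integral_scaleR_right vector_scaleR_component real_scaleR_def minus_minus)
      qed
      then show ?thesis by (intro vec_eq_iff[THEN iffD2] allI)
    qed
    have "ennreal (norm (D x)) \<le> (\<integral>\<^sup>+y. ennreal (norm ((1 / Z) *\<^sub>R (indicator \<Omega> y *\<^sub>R (\<eta> y *\<^sub>R g y)))) \<partial>lebesgue)"
      unfolding D_eq using \<eta>g by (intro integral_norm_bound_ennreal integrable_scaleR_right)
    also have "\<dots> \<le> (\<integral>\<^sup>+y. ennreal c * ennreal (\<eta> y / Z) + ennreal (c powr (1 - p)) * (?P y * ennreal (\<eta> y / Z)) \<partial>lebesgue)"
    proof (rule nn_integral_mono)
      fix y
      have \<eta>n: "0 \<le> \<eta> y / Z" using \<rho>0 Z unfolding \<eta>_def by simp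
      have "norm ((1 / Z) *\<^sub>R (indicator \<Omega> y *\<^sub>R (\<eta> y *\<^sub>R g y))) = (\<eta> y / Z) * (indicator \<Omega> y * norm (g y))"
        using \<rho>0[of "y - x"] Z unfolding \<eta>_def by (simp split: split_indicator)
      also have "\<dots> \<le> (\<eta> y / Z) * (c + c powr (1 - p) * (indicator \<Omega> y *\<^sub>R norm (g y) powr p))"
        using le_const_plus_powr[of "norm (g y)" c p] c p \<eta>n
        by (intro mult_left_mono) (auto split: split_indicator)
      also have "\<dots> = c * (\<eta> y / Z) + c powr (1 - p) * ((indicator \<Omega> y *\<^sub>R norm (g y) powr p) * (\<eta> y / Z))"
        by (simp add: algebra_simps)
      finally have "ennreal (norm ((1 / Z) *\<^sub>R (indicator \<Omega> y *\<^sub>R (\<eta> y *\<^sub>R g y)))) \<le>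
          ennreal (c * (\<eta> y / Z) + c powr (1 - p) * ((indicator \<Omega> y *\<^sub>R norm (g y) powr p) * (\<eta> y / Z)))"
        by (rule ennreal_leI)
      also have "\<dots> = ennreal c * ennreal (\<eta> y / Z) + ennreal (c powr (1 - p)) * (?P y * ennreal (\<eta> y / Z))"
        using c \<eta>n by (simp add: ennreal_plus ennreal_mult' ennreal_mult'' del: times_divide_eq_right)
      finally show "ennreal (norm ((1 / Z) *\<^sub>R (indicator \<Omega> y *\<^sub>R (\<eta> y *\<^sub>R g y)))) \<le>
          ennreal c * ennreal (\<eta> y / Z) + ennreal (c powr (1 - p)) * (?P y * ennreal (\<eta> y / Z))" .
    qed
    also have "\<dots> = (\<integral>\<^sup>+y. ennreal c * ennreal (\<eta> y / Z) + ennreal (c powr (1 - p)) * (P' y * ennreal (\<eta> y / Z)) \<partial>lebesgue)"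
      using AE_completion[OF P'ae] by (intro nn_integral_cong_AE) (auto elim!: AE_mp)
    also have "\<dots> = (\<integral>\<^sup>+y. ennreal c * ennreal (\<eta> y / Z) + ennreal (c powr (1 - p)) * (P' y * ennreal (\<eta> y / Z)) \<partial>lborel)"
      by (rule nn_integral_completion)
    also have "\<dots> = ennreal c * (\<integral>\<^sup>+y. ennreal (\<eta> y / Z) \<partial>lborel) + ennreal (c powr (1 - p)) * (\<integral>\<^sup>+y. P' y * ennreal (\<eta> y / Z) \<partial>lborel)"
      unfolding \<eta>_def by (simp add: nn_integral_add nn_integral_cmult)
    also have "\<dots> = ennreal c + ennreal (c powr (1 - p)) * H x"
      unfolding H_def \<eta>_def one by simp
    finally show "ennreal (norm (D x)) \<le> ennreal c + ennreal (c powr (1 - p)) * H x" .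
  qed
qed

section \<open>Contraction towards a continuum\<close>

text \<open>
  Dilation by \<open>\<tau>\<close> in all coordinates but the \<open>i\<close>-th, followed by a translation.
\<close>

lemma nn_integral_partial_dilation:
  fixes H :: "real ^ 'n::finite \<Rightarrow> ennreal"
  assumes [measurable]: "H \<in> borel_measurable borel" and \<tau>: "0 < \<tau>"
  shows "ennreal (\<tau> ^ (CARD('n) - 1)) *
     (\<integral>\<^sup>+z. H (b + (\<tau> *\<^sub>R z + ((1 - \<tau>) * z $ i) *\<^sub>R axis i 1)) \<partial>lborel) = (\<integral>\<^sup>+z. H z \<partial>lborel)"
proof -
  define c where "c j = (if j = axis i (1::real) then 1 else \<tau>)" for j :: "real ^ 'n"
  have ax: "axis i (1::real) \<in> (Basis :: (real ^ 'n) set)" by (simp add: axis_in_Basis_iff)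
  have T: "(\<Sum>j\<in>Basis. (c j * (z \<bullet> j)) *\<^sub>R j) = \<tau> *\<^sub>R z + ((1 - \<tau>) * z $ i) *\<^sub>R axis i 1" for z
  proof -
    have "(\<Sum>j\<in>Basis. (c j * (z \<bullet> j)) *\<^sub>R j)
        = (\<Sum>j\<in>Basis. \<tau> *\<^sub>R ((z \<bullet> j) *\<^sub>R j) + (if j = axis i 1 then ((1 - \<tau>) * (z \<bullet> j)) *\<^sub>R j else 0))"
      by (intro sum.cong) (auto simp: c_def algebra_simps)
    also have "\<dots> = \<tau> *\<^sub>R z + ((1 - \<tau>) * (z \<bullet> axis i 1)) *\<^sub>R axis i 1"
      using ax by (simp only: sum.distrib scaleR_sum_right[symmetric] euclidean_representation) (simp add: sum.delta)
    finally show ?thesis by (simp add: inner_axis)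
  qed
  have prod: "(\<Prod>j\<in>Basis. \<bar>c j\<bar>) = \<tau> ^ (CARD('n) - 1)"
  proof -
    have "(\<Prod>j\<in>Basis. \<bar>c j\<bar>) = \<bar>c (axis i 1)\<bar> * (\<Prod>j\<in>Basis - {axis i 1}. \<bar>c j\<bar>)"
      using ax by (intro prod.remove) auto
    also have "\<dots> = (\<Prod>j\<in>(Basis - {axis i (1::real)} :: (real ^ 'n) set). \<tau>)"
      using \<tau> by (simp add: c_def)
    also have "\<dots> = \<tau> ^ (CARD('n) - 1)" using ax by (simp add: card_Diff_singleton DIM_cart)
    finally show ?thesis .
  qed
  have "(lborel :: (real ^ 'n) measure) = density (distr lborel borel (\<lambda>x. b + (\<Sum>j\<in>Basis. (c j * (x \<bullet> j)) *\<^sub>R j)))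
      (\<lambda>_. (\<Prod>j\<in>Basis. \<bar>c j\<bar>))"
    by (rule lborel_affine_euclidean) (use \<tau> in \<open>auto simp: c_def\<close>)
  then have eq: "(lborel :: (real ^ 'n) measure) = density (distr lborel borel (\<lambda>z. b + (\<tau> *\<^sub>R z + ((1 - \<tau>) * z $ i) *\<^sub>R axis i 1)))
      (\<lambda>_. ennreal (\<tau> ^ (CARD('n) - 1)))"
    unfolding T prod .
  have m[measurable]: "(\<lambda>z::real ^ 'n. b + (\<tau> *\<^sub>R z + ((1 - \<tau>) * z $ i) *\<^sub>R axis i 1)) \<in> borel_measurable borel"
    by (intro borel_measurable_continuous_onI continuous_intros)
  have "(\<integral>\<^sup>+z. H z \<partial>lborel) = (\<integral>\<^sup>+z. H z \<partial>density (distr lborel borel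
      (\<lambda>z. b + (\<tau> *\<^sub>R z + ((1 - \<tau>) * z $ i) *\<^sub>R axis i 1))) (\<lambda>_. ennreal (\<tau> ^ (CARD('n) - 1))))"
    using eq by simp
  also have "\<dots> = ennreal (\<tau> ^ (CARD('n) - 1)) *
     (\<integral>\<^sup>+z. H (b + (\<tau> *\<^sub>R z + ((1 - \<tau>) * z $ i) *\<^sub>R axis i 1)) \<partial>lborel)"
    by (simp add: nn_integral_density nn_integral_distr nn_integral_cmult)
  finally show ?thesis by simp
qed

text \<open>
  The number of the step, among \<open>N\<close> steps of length \<open>h / N\<close> starting at \<open>lo\<close>, that contains \<open>s\<close>.
\<close>

definition stair_index :: "real \<Rightarrow> real \<Rightarrow> nat \<Rightarrow> real \<Rightarrow> nat" where
  "stair_index lo h N s = nat \<lfloor>(s - lo) * real N / h\<rfloor>"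

text \<open>
  Moves within each step parallel to the \<open>i\<close>-axis at unit speed, and jumps to the next point \<open>X k\<close> between
  steps. If the \<open>X k\<close> lie on consecutive hyperplanes, the \<open>i\<close>-th coordinate of the result is that of \<open>z\<close> plus a constant.
\<close>

definition staircase :: "(nat \<Rightarrow> real ^ 'n::finite) \<Rightarrow> 'n \<Rightarrow> real \<Rightarrow> real \<Rightarrow> nat \<Rightarrow> real ^ 'n \<Rightarrow> real ^ 'n" where
  "staircase X i lo h N z =
     (let k = stair_index lo h N (z $ i) in X k + (z $ i - lo - h * real k / real N) *\<^sub>R axis i 1)"

lemma stair_index_bounds:
  assumes "0 < h" "0 < N" "lo \<le> s" "s < lo + h"
  shows "stair_index lo h N s < N" "h * real (stair_index lo h N s) / real N \<le> s - lo"
    "s - lo \<le> h * real (stair_index lo h N s) / real N + h / real N"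
proof -
  let ?q = "(s - lo) * real N / h"
  have "(s - lo) * real N < h * real N" using assms by (intro mult_strict_right_mono) auto
  then have q: "0 \<le> ?q" "?q < real N" using assms by (auto simp: pos_divide_less_eq mult.commute)
  then have k: "real (stair_index lo h N s) \<le> ?q" "?q < real (stair_index lo h N s) + 1"
    unfolding stair_index_def by linarith+
  then have "real (stair_index lo h N s) < real N" using q by linarith
  then show "stair_index lo h N s < N" by simp
  show "h * real (stair_index lo h N s) / real N \<le> s - lo"
    "s - lo \<le> h * real (stair_index lo h N s) / real N + h / real N"
    using k assms by (auto simp: field_simps)
qed

lemma stair_index_measurable [measurable]: "stair_index lo h N \<in> borel \<rightarrow>\<^sub>M count_space UNIV"
  unfolding stair_index_def by measurable

lemma borel_measurable_component [measurable]: "(\<lambda>z::real ^ 'n::finite. z $ i) \<in> borel_measurable borel"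
  by (intro borel_measurable_continuous_onI continuous_intros)

lemma staircase_measurable [measurable]: "staircase X i lo h N \<in> borel_measurable borel"
proof -
  have [measurable]: "X \<in> count_space UNIV \<rightarrow>\<^sub>M borel" by simp
  show ?thesis unfolding staircase_def Let_def by measurable
qed

text \<open>
  On each slab of \<open>S\<close> that belongs to one step, the contraction towards the staircase is a partial dilation
  \<open>\<Phi> k\<close>. It moves the \<open>i\<close>-th coordinate by the amount \<open>(1 - \<tau>) * (a - lo)\<close>, which is the same for all slabs, so the images of
  different slabs lie in disjoint strips \<open>T k\<close>. Summing over the slabs therefore counts no point twice, and the
  number of steps does not enter the estimate.
\<close>

lemma nn_integral_staircase_contraction:
  fixes H :: "real ^ 'n::finite \<Rightarrow> ennreal"
  assumes H[measurable]: "H \<in> borel_measurable borel" and \<tau>: "0 < \<tau>" and h: "0 < h" and N: "0 < N"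
    and X: "\<And>k. k < N \<Longrightarrow> X k $ i = a + h * real k / real N"
    and S[measurable]: "S \<in> sets borel" "\<And>z. z \<in> S \<Longrightarrow> lo \<le> z $ i \<and> z $ i < lo + h"
  shows "ennreal (\<tau> ^ (CARD('n) - 1)) *
     (\<integral>\<^sup>+z. indicator S z * H (staircase X i lo h N z + \<tau> *\<^sub>R (z - staircase X i lo h N z)) \<partial>lborel)
     \<le> (\<integral>\<^sup>+z. H z \<partial>lborel)"
proof -
  define \<Phi> where "\<Phi> k z = (1 - \<tau>) *\<^sub>R (X k - (lo + h * real k / real N) *\<^sub>R axis i 1)
      + (\<tau> *\<^sub>R z + ((1 - \<tau>) * z $ i) *\<^sub>R axis i 1)" for k z
  \<comment> \<open>the strips are disjoint by definition, as each point has one index after the common shift is undone\<close>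
  define T where "T k = {y :: real ^ 'n. stair_index lo h N (y $ i - (1 - \<tau>) * (a - lo)) = k}" for k
  have T[measurable]: "T k \<in> sets borel" for k
  proof -
    have "(\<lambda>y::real ^ 'n. stair_index lo h N (y $ i - (1 - \<tau>) * (a - lo))) \<in> borel \<rightarrow>\<^sub>M count_space UNIV"
      by measurable
    from measurable_sets[OF this, of "{k}"] show ?thesis unfolding T_def by (simp add: vimage_def)
  qed
  have \<Phi>m[measurable]: "\<Phi> k \<in> borel_measurable borel" for k
    unfolding \<Phi>_def by (intro borel_measurable_continuous_onI continuous_intros)
  have le: "indicator S z * H (staircase X i lo h N z + \<tau> *\<^sub>R (z - staircase X i lo h N z))
      \<le> (\<Sum>k<N. indicator (T k) (\<Phi> k z) * H (\<Phi> k z))" for z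
  proof (cases "z \<in> S")
    case True
    define k where "k = stair_index lo h N (z $ i)"
    have k: "k < N" using stair_index_bounds(1)[OF h N] S(2)[OF True] unfolding k_def by blast
    have eq: "staircase X i lo h N z + \<tau> *\<^sub>R (z - staircase X i lo h N z) = \<Phi> k z"
    proof -
      have "x + (s - lo - q) *\<^sub>R e + \<tau> *\<^sub>R (z - (x + (s - lo - q) *\<^sub>R e))
          = (1 - \<tau>) *\<^sub>R (x - (lo + q) *\<^sub>R e) + (\<tau> *\<^sub>R z + ((1 - \<tau>) * s) *\<^sub>R e)" for s q and x e :: "real ^ 'n"
        by (simp add: algebra_simps)
      then show ?thesis unfolding staircase_def Let_def k_def[symmetric] \<Phi>_def .
    qed
    have "\<Phi> k z $ i = (1 - \<tau>) * (a - lo) + z $ i"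
    proof -
      define q where "q = h * real k / real N"
      have "X k $ i = a + q" using X[OF k] by (simp add: q_def)
      then show ?thesis unfolding \<Phi>_def q_def[symmetric] by (simp add: algebra_simps)
    qed
    then have "\<Phi> k z \<in> T k" unfolding T_def k_def by simp
    then have "indicator S z * H (staircase X i lo h N z + \<tau> *\<^sub>R (z - staircase X i lo h N z))
       = indicator (T k) (\<Phi> k z) * H (\<Phi> k z)" unfolding eq using True by simp
    also have "\<dots> \<le> (\<Sum>k<N. indicator (T k) (\<Phi> k z) * H (\<Phi> k z))"
      using k by (intro member_le_sum) auto
    finally show ?thesis .
  qed simp
  have "(\<integral>\<^sup>+z. indicator S z * H (staircase X i lo h N z + \<tau> *\<^sub>R (z - staircase X i lo h N z)) \<partial>lborel)
      \<le> (\<integral>\<^sup>+z. (\<Sum>k<N. indicator (T k) (\<Phi> k z) * H (\<Phi> k z)) \<partial>lborel)"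
    by (intro nn_integral_mono le)
  also have "\<dots> = (\<Sum>k<N. \<integral>\<^sup>+z. indicator (T k) (\<Phi> k z) * H (\<Phi> k z) \<partial>lborel)"
    by (rule nn_integral_sum) measurable
  finally have "ennreal (\<tau> ^ (CARD('n) - 1)) *
     (\<integral>\<^sup>+z. indicator S z * H (staircase X i lo h N z + \<tau> *\<^sub>R (z - staircase X i lo h N z)) \<partial>lborel)
     \<le> ennreal (\<tau> ^ (CARD('n) - 1)) * (\<Sum>k<N. \<integral>\<^sup>+z. indicator (T k) (\<Phi> k z) * H (\<Phi> k z) \<partial>lborel)"
    by (intro mult_left_mono) auto
  also have "\<dots> = (\<Sum>k<N. ennreal (\<tau> ^ (CARD('n) - 1)) * (\<integral>\<^sup>+z. indicator (T k) (\<Phi> k z) * H (\<Phi> k z) \<partial>lborel))"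
    by (rule sum_distrib_left)
  also have "\<dots> = (\<Sum>k<N. \<integral>\<^sup>+z. indicator (T k) z * H z \<partial>lborel)"
    unfolding \<Phi>_def by (intro sum.cong refl nn_integral_partial_dilation[of "\<lambda>y. indicator (T k) y * H y" for k] \<tau>) measurable
  also have "\<dots> = (\<integral>\<^sup>+z. (\<Sum>k<N. indicator (T k) z * H z) \<partial>lborel)"
    by (rule nn_integral_sum[symmetric]) measurable
  also have "\<dots> \<le> (\<integral>\<^sup>+z. H z \<partial>lborel)"
  proof (rule nn_integral_mono)
    fix z
    have "(\<Sum>k<N. indicator (T k) z * H z)
        = (\<Sum>k<N. if k = stair_index lo h N (z $ i - (1 - \<tau>) * (a - lo)) then H z else 0)"
      by (intro sum.cong) (auto simp: T_def)
    also have "\<dots> \<le> H z" by (simp add: sum.delta)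
    finally show "(\<Sum>k<N. indicator (T k) z * H z) \<le> H z" .
  qed
  finally show ?thesis .
qed

text \<open>
  The variation of \<open>V\<close> along a segment is at most the integral of the norm of its gradient, and \<open>V\<close> is close enough to
  the sine of \<open>w\<close> for this to control the increment of \<open>w\<close>.
\<close>

lemma increment_le_segment_energy:
  fixes w V :: "'a::euclidean_space \<Rightarrow> real"
  assumes B: "convex B" "x \<in> B" "z \<in> B" and eps: "0 < \<epsilon>"
    and V: "\<And>x. (V has_derivative (\<lambda>h. D x \<bullet> h)) (at x)" and D: "continuous_on UNIV D"
    and w: "continuous_on B w" and close: "\<And>y. y \<in> B \<Longrightarrow> \<bar>V y - \<epsilon> * sin (w y / \<epsilon>)\<bar> \<le> \<epsilon> / 2"
  shows "\<bar>w z - w x\<bar> \<le> pi * (norm (z - x) * integral {0..1} (\<lambda>t. norm (D (x + t *\<^sub>R (z - x))))) + 2 * pi * \<epsilon>"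
proof -
  define \<gamma> where "\<gamma> t = x + t *\<^sub>R (z - x)" for t
  have \<gamma>B: "\<gamma> t \<in> B" if "0 \<le> t" "t \<le> 1" for t
  proof -
    have "(1 - t) *\<^sub>R x + t *\<^sub>R z \<in> B" using B that by (intro convexD) auto
    then show ?thesis unfolding \<gamma>_def by (simp add: algebra_simps)
  qed
  have c\<gamma>: "continuous_on T \<gamma>" for T unfolding \<gamma>_def by (intro continuous_intros)
  let ?n = "\<lambda>t. norm (D (\<gamma> t)) * norm (z - x)"
  have cn: "continuous_on T ?n" for T
    by (intro continuous_intros continuous_on_compose2[OF D c\<gamma>]) auto
  have int: "?n integrable_on {s..t}" for s t by (intro integrable_continuous_real cn)
  let ?I = "\<lambda>t. integral {0..t} ?n"
  have VI: "\<bar>V (\<gamma> t) - V (\<gamma> s)\<bar> \<le> ?I t - ?I s" if st: "0 \<le> s" "s \<le> t" "t \<le> 1" for s t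
  proof -
    have der: "((\<lambda>t. V (\<gamma> t)) has_vector_derivative D (\<gamma> u) \<bullet> (z - x)) (at u within {s..t})" for u
    proof -
      have "(\<gamma> has_derivative (\<lambda>h. h *\<^sub>R (z - x))) (at u within {s..t})"
        unfolding \<gamma>_def by (auto intro!: derivative_eq_intros)
      from has_derivative_compose[OF this V] show ?thesis by (simp add: has_vector_derivative_def)
    qed
    have hi: "((\<lambda>u. D (\<gamma> u) \<bullet> (z - x)) has_integral V (\<gamma> t) - V (\<gamma> s)) {s..t}"
      by (rule fundamental_theorem_of_calculus[OF st(2) der])
    have "norm (integral {s..t} (\<lambda>u. D (\<gamma> u) \<bullet> (z - x))) \<le> integral {s..t} ?n"
      using hi int by (intro integral_norm_bound_integral) (auto simp: Cauchy_Schwarz_ineq2)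
    moreover have "?I s + integral {s..t} ?n = ?I t"
      using st by (intro Henstock_Kurzweil_Integration.integral_combine int) auto
    ultimately show ?thesis using integral_unique[OF hi] by simp
  qed
  have "\<bar>w (\<gamma> 1) - w (\<gamma> 0)\<bar> \<le> pi * (?I 1 - ?I 0) + 2 * pi * \<epsilon>"
    using abs_increment_le_cost_of_sine[of \<epsilon> "\<lambda>t. w (\<gamma> t)" "\<lambda>t. V (\<gamma> t)" ?I]
      eps VI close \<gamma>B continuous_on_compose2[OF w c\<gamma>] by (auto simp: image_subset_iff)
  then show ?thesis by (simp add: \<gamma>_def mult.commute)
qed

section \<open>Energy needed to separate two continua\<close>

lemma nn_integral_powr_unit_interval:
  assumes "\<alpha> < 1"
  shows "(\<integral>\<^sup>+t. indicator {0<..<1} t * ennreal (t powr - \<alpha>) \<partial>lborel) = ennreal (1 / (1 - \<alpha>))"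
proof -
  have "((\<lambda>t. t powr - \<alpha>) has_integral (1 powr (- \<alpha> + 1) / (- \<alpha> + 1))) {0..1}"
    using assms by (intro has_integral_powr_from_0) auto
  then have "((\<lambda>t. t powr - \<alpha>) has_integral (1 / (1 - \<alpha>))) {0<..<1}"
    by (simp add: has_integral_Icc_iff_Ioo)
  from nn_integral_has_integral_lebesgue[OF _ this] show ?thesis
    by (simp add: ennreal_mult' ennreal_indicator)
qed

text \<open>
  The free constant is chosen as \<open>c = c0 * \<tau> powr - \<alpha>\<close> with \<open>\<alpha> = (n - 1) / p\<close> for the dimension \<open>n\<close>. This value balances the
  two terms: after the Jacobian \<open>\<tau> ^ (n - 1)\<close> of the contraction has been divided out, both are multiples of
  \<open>\<tau> powr - \<alpha>\<close>, which is integrable because \<open>p > n - 1\<close>.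
\<close>

lemma averaged_segment_energy:
  fixes H :: "real ^ 'n::finite \<Rightarrow> ennreal" and D :: "real ^ 'n \<Rightarrow> real ^ 'n" and p c0 :: real
  defines "\<alpha> \<equiv> real (CARD('n) - 1) / p"
  assumes H[measurable]: "H \<in> borel_measurable borel" and D: "continuous_on UNIV D"
    and sel[measurable]: "sel \<in> borel_measurable borel"
    and S[measurable]: "S \<in> sets borel"
    and contraction: "\<And>\<tau>. 0 < \<tau> \<Longrightarrow> \<tau> < 1 \<Longrightarrow> ennreal (\<tau> ^ (CARD('n) - 1)) *
      (\<integral>\<^sup>+z. indicator S z * H (sel z + \<tau> *\<^sub>R (z - sel z)) \<partial>lborel) \<le> (\<integral>\<^sup>+z. H z \<partial>lborel)"
    and DH: "\<And>z \<tau> c. z \<in> S \<Longrightarrow> 0 < \<tau> \<Longrightarrow> \<tau> < 1 \<Longrightarrow> 0 < c \<Longrightarrow>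
      ennreal (norm (D (sel z + \<tau> *\<^sub>R (z - sel z))))
        \<le> ennreal c + ennreal (c powr (1 - p)) * H (sel z + \<tau> *\<^sub>R (z - sel z))"
    and p: "0 < p" "real (CARD('n) - 1) < p" and c0: "0 < c0"
  shows "(\<integral>\<^sup>+z. indicator S z * (\<integral>\<^sup>+\<tau>. indicator {0<..<1} \<tau> * ennreal (norm (D (sel z + \<tau> *\<^sub>R (z - sel z)))) \<partial>lborel) \<partial>lborel)
    \<le> ennreal (1 / (1 - \<alpha>)) * (ennreal c0 * emeasure lborel S + ennreal (c0 powr (1 - p)) * (\<integral>\<^sup>+z. H z \<partial>lborel))"
proof -
  have \<alpha>: "\<alpha> < 1" "\<alpha> * p = real (CARD('n) - 1)"
    unfolding \<alpha>_def using p by (simp_all only: pos_divide_less_eq mult_1 nonzero_divide_eq_eq[symmetric]) auto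
  have [measurable]: "D \<in> borel_measurable borel" using D by (rule borel_measurable_continuous_onI)
  define y where "y z \<tau> = sel z + \<tau> *\<^sub>R (z - sel z)" for z \<tau>
  let ?A = "\<lambda>\<tau>. ennreal (c0 * \<tau> powr - \<alpha>)" and ?B = "\<lambda>\<tau>. ennreal ((c0 * \<tau> powr - \<alpha>) powr (1 - p))"
  let ?IH = "\<integral>\<^sup>+z. H z \<partial>lborel"
  \<comment> \<open>\<open>\<alpha> * p = n - 1\<close> makes the second coefficient produce exactly the Jacobian\<close>
  have B: "?B \<tau> = ennreal (c0 powr (1 - p)) * ennreal (\<tau> powr - \<alpha>) * ennreal (\<tau> ^ (CARD('n) - 1))" if "0 < \<tau>" for \<tau>
  proof -
    have "(c0 * \<tau> powr - \<alpha>) powr (1 - p) = c0 powr (1 - p) * \<tau> powr (- \<alpha> * (1 - p))"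
      using c0 by (simp add: powr_mult powr_powr)
    also have "- \<alpha> * (1 - p) = - \<alpha> + real (CARD('n) - 1)"
      using \<alpha>(2) by (simp add: algebra_simps)
    also have "\<tau> powr (- \<alpha> + real (CARD('n) - 1)) = \<tau> powr - \<alpha> * \<tau> ^ (CARD('n) - 1)"
      using that by (simp only: powr_add powr_realpow)
    finally show ?thesis using that c0 by (simp add: ennreal_mult' mult.assoc)
  qed
  have "(\<integral>\<^sup>+z. indicator S z * (\<integral>\<^sup>+\<tau>. indicator {0<..<1} \<tau> * ennreal (norm (D (y z \<tau>))) \<partial>lborel) \<partial>lborel)
      \<le> (\<integral>\<^sup>+z. (\<integral>\<^sup>+\<tau>. indicator S z * (indicator {0<..<1} \<tau> * (?A \<tau> + ?B \<tau> * H (y z \<tau>))) \<partial>lborel) \<partial>lborel)"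
  proof (rule nn_integral_mono)
    fix z
    have "indicator S z * (\<integral>\<^sup>+\<tau>. indicator {0<..<1} \<tau> * ennreal (norm (D (y z \<tau>))) \<partial>lborel)
       = (\<integral>\<^sup>+\<tau>. indicator S z * (indicator {0<..<1} \<tau> * ennreal (norm (D (y z \<tau>)))) \<partial>lborel)"
      unfolding y_def by (rule nn_integral_cmult[symmetric]) measurable
    also have "\<dots> \<le> (\<integral>\<^sup>+\<tau>. indicator S z * (indicator {0<..<1} \<tau> * (?A \<tau> + ?B \<tau> * H (y z \<tau>))) \<partial>lborel)"
      using DH[of z] c0 unfolding y_def by (intro nn_integral_mono) (auto split: split_indicator)
    finally show "indicator S z * (\<integral>\<^sup>+\<tau>. indicator {0<..<1} \<tau> * ennreal (norm (D (y z \<tau>))) \<partial>lborel)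
       \<le> (\<integral>\<^sup>+\<tau>. indicator S z * (indicator {0<..<1} \<tau> * (?A \<tau> + ?B \<tau> * H (y z \<tau>))) \<partial>lborel)" .
  qed
  also have "\<dots> = (\<integral>\<^sup>+\<tau>. (\<integral>\<^sup>+z. indicator S z * (indicator {0<..<1} \<tau> * (?A \<tau> + ?B \<tau> * H (y z \<tau>))) \<partial>lborel) \<partial>lborel)"
    unfolding y_def by (rule lborel_pair.Fubini') measurable
  also have "\<dots> \<le> (\<integral>\<^sup>+\<tau>. indicator {0<..<1} \<tau> * ennreal (\<tau> powr - \<alpha>) *
      (ennreal c0 * emeasure lborel S + ennreal (c0 powr (1 - p)) * ?IH) \<partial>lborel)"
  proof (rule nn_integral_mono)
    fix \<tau> :: real
    show "(\<integral>\<^sup>+z. indicator S z * (indicator {0<..<1} \<tau> * (?A \<tau> + ?B \<tau> * H (y z \<tau>))) \<partial>lborel)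
      \<le> indicator {0<..<1} \<tau> * ennreal (\<tau> powr - \<alpha>) *
        (ennreal c0 * emeasure lborel S + ennreal (c0 powr (1 - p)) * ?IH)"
    proof (cases "\<tau> \<in> {0<..<1}")
      case True
      then have \<tau>: "0 < \<tau>" "\<tau> < 1" by auto
      have "(\<integral>\<^sup>+z. indicator S z * (indicator {0<..<1} \<tau> * (?A \<tau> + ?B \<tau> * H (y z \<tau>))) \<partial>lborel)
          = (\<integral>\<^sup>+z. ?A \<tau> * indicator S z + ?B \<tau> * (indicator S z * H (y z \<tau>)) \<partial>lborel)"
        using True by (intro nn_integral_cong) (auto split: split_indicator)
      also have "\<dots> = ?A \<tau> * emeasure lborel S + ?B \<tau> * (\<integral>\<^sup>+z. indicator S z * H (y z \<tau>) \<partial>lborel)"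
        unfolding y_def by (subst nn_integral_add) (simp_all add: nn_integral_cmult)
      also have "?B \<tau> * (\<integral>\<^sup>+z. indicator S z * H (y z \<tau>) \<partial>lborel)
          = ennreal (c0 powr (1 - p)) * ennreal (\<tau> powr - \<alpha>) *
            (ennreal (\<tau> ^ (CARD('n) - 1)) * (\<integral>\<^sup>+z. indicator S z * H (y z \<tau>) \<partial>lborel))"
        unfolding B[OF \<tau>(1)] by (simp add: mult.assoc)
      also have "\<dots> \<le> ennreal (c0 powr (1 - p)) * ennreal (\<tau> powr - \<alpha>) * ?IH"
        using contraction[OF \<tau>] unfolding y_def by (intro mult_left_mono) auto
      finally show ?thesis using True c0
        by (simp add: ennreal_mult' distrib_left mult.assoc mult.left_commute mult.commute add_mono)
    qed simp
  qed
  also have "\<dots> = (\<integral>\<^sup>+\<tau>. indicator {0<..<1} \<tau> * ennreal (\<tau> powr - \<alpha>) \<partial>lborel) *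
      (ennreal c0 * emeasure lborel S + ennreal (c0 powr (1 - p)) * ?IH)"
    by (rule nn_integral_multc) measurable
  also have "\<dots> = ennreal (1 / (1 - \<alpha>)) * (ennreal c0 * emeasure lborel S + ennreal (c0 powr (1 - p)) * ?IH)"
    by (simp only: nn_integral_powr_unit_interval[OF \<alpha>(1)])
  finally show ?thesis unfolding y_def .
qed

text \<open>
  A function \<open>w\<close> that differs by almost \<open>L\<close> between two continua has energy at least of order \<open>(L / d) powr p\<close> times the
  volume of \<open>S\<close>. The points \<open>sel True z\<close> and \<open>sel False z\<close> lie close to the two continua, and both are joined to the
  same \<open>z\<close>, so that one of the two segments carries a definite part of the increment. The function \<open>w\<close> enters only
  through the approximation \<open>V\<close> of \<open>\<epsilon> * sin (w / \<epsilon>)\<close>, whose gradient is what \<open>H\<close> controls.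
\<close>

lemma oscillation_energy_bound:
  fixes H :: "real ^ 'n::finite \<Rightarrow> ennreal" and D :: "real ^ 'n \<Rightarrow> real ^ 'n" and p d L G m :: real
  defines "\<alpha> \<equiv> real (CARD('n) - 1) / p"
  assumes H: "H \<in> borel_measurable borel" "(\<integral>\<^sup>+z. H z \<partial>lborel) \<le> ennreal G"
    and V: "\<And>x. (V has_derivative (\<lambda>h. D x \<bullet> h)) (at x)" and D: "continuous_on UNIV D"
    and S: "S \<in> sets borel" "S \<subseteq> B" "emeasure lborel S = ennreal m" "0 \<le> m"
    and B: "convex B" "\<And>x z. x \<in> B \<Longrightarrow> z \<in> B \<Longrightarrow> norm (z - x) \<le> d"
    and DH: "\<And>x c. x \<in> B \<Longrightarrow> 0 < c \<Longrightarrow> ennreal (norm (D x)) \<le> ennreal c + ennreal (c powr (1 - p)) * H x"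
    and w: "continuous_on B w" and close: "\<And>y. y \<in> B \<Longrightarrow> \<bar>V y - \<epsilon> * sin (w y / \<epsilon>)\<bar> \<le> \<epsilon> / 2"
    and eps: "0 < \<epsilon>" "4 * pi * \<epsilon> \<le> 3 / 10 * L"
    and sel: "\<And>j::bool. sel j \<in> borel_measurable borel" "\<And>j z. z \<in> S \<Longrightarrow> sel j z \<in> B"
    and contraction: "\<And>j \<tau>. 0 < \<tau> \<Longrightarrow> \<tau> < 1 \<Longrightarrow> ennreal (\<tau> ^ (CARD('n) - 1)) *
      (\<integral>\<^sup>+z. indicator S z * H (sel j z + \<tau> *\<^sub>R (z - sel j z)) \<partial>lborel) \<le> (\<integral>\<^sup>+z. H z \<partial>lborel)"
    and gap: "\<And>z. z \<in> S \<Longrightarrow> 4 / 5 * L \<le> w (sel True z) - w (sel False z)"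
    and p: "0 < p" "real (CARD('n) - 1) < p" and L: "0 < L" and d: "0 < d" and G: "0 \<le> G"
  shows "(L * (1 - \<alpha>) / (8 * pi * d)) powr p * m \<le> G"
proof -
  have \<alpha>: "\<alpha> < 1" unfolding \<alpha>_def using p by (simp only: pos_divide_less_eq mult_1)
  \<comment> \<open>for this value the term without \<open>G\<close> takes up exactly half of the left-hand side \<open>L / 2 * m\<close>\<close>
  define c0 where "c0 = L * (1 - \<alpha>) / (8 * pi * d)"
  have c0: "0 < c0" unfolding c0_def using L \<alpha> d by simp
  let ?y = "\<lambda>j z \<tau>. sel j z + \<tau> *\<^sub>R (z - sel j z)"
  let ?J = "\<lambda>j z. \<integral>\<^sup>+\<tau>. indicator {0<..<1} \<tau> * ennreal (norm (D (?y j z \<tau>))) \<partial>lborel"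
  have yB: "?y j z \<tau> \<in> B" if "z \<in> S" "0 < \<tau>" "\<tau> < 1" for j z \<tau>
  proof -
    have "(1 - \<tau>) *\<^sub>R sel j z + \<tau> *\<^sub>R z \<in> B" using B(1) sel(2) S(2) that by (intro convexD) auto
    then show ?thesis by (simp add: algebra_simps)
  qed
  have J: "?J j z = ennreal (integral {0..1} (\<lambda>\<tau>. norm (D (?y j z \<tau>))))" for j z
  proof -
    have "(\<lambda>\<tau>. norm (D (?y j z \<tau>))) integrable_on {0..1}"
      by (intro integrable_continuous_real continuous_intros continuous_on_compose2[OF D]) auto
    then have "((\<lambda>\<tau>. norm (D (?y j z \<tau>))) has_integral integral {0..1} (\<lambda>\<tau>. norm (D (?y j z \<tau>)))) {0<..<1}"
      using integrable_integral has_integral_Icc_iff_Ioo by blast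
    from nn_integral_has_integral_lebesgue[OF _ this] show ?thesis
      by (simp add: ennreal_mult' ennreal_indicator)
  qed
  have pw: "ennreal (L / 2) * indicator S z \<le> ennreal (pi * d) * (indicator S z * ?J True z + indicator S z * ?J False z)" for z
  proof (cases "z \<in> S")
    case True
    let ?I = "\<lambda>j. integral {0..1} (\<lambda>\<tau>. norm (D (?y j z \<tau>)))"
    have I0: "0 \<le> ?I j" for j by (intro Henstock_Kurzweil_Integration.integral_nonneg integrable_continuous_real
          continuous_intros continuous_on_compose2[OF D]) auto
    have zB: "z \<in> B" using True S by blast
    have est: "\<bar>w z - w (sel j z)\<bar> \<le> pi * d * ?I j + 2 * pi * \<epsilon>" for j
    proof -
      have "\<bar>w z - w (sel j z)\<bar> \<le> pi * (norm (z - sel j z) * ?I j) + 2 * pi * \<epsilon>"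
        by (rule increment_le_segment_energy[OF B(1) sel(2)[OF True] zB eps(1) V D w close])
      also have "pi * (norm (z - sel j z) * ?I j) \<le> pi * (d * ?I j)"
        using B(2)[OF sel(2)[OF True] zB] I0 by (intro mult_left_mono mult_right_mono) auto
      finally show ?thesis by (simp add: mult.assoc)
    qed
    have "L / 2 \<le> pi * d * (?I True + ?I False)"
      using est[of True] est[of False] gap[OF True] eps(2) by (simp add: algebra_simps abs_le_iff)
    then have "ennreal (L / 2) \<le> ennreal (pi * d * (?I True + ?I False))" by (rule ennreal_leI)
    also have "\<dots> = ennreal (pi * d) * (ennreal (?I True) + ennreal (?I False))"
      using I0 d by (simp add: ennreal_mult' ennreal_plus)
    finally show ?thesis using True by (simp add: J)
  qed simp
  let ?R = "ennreal (1 / (1 - \<alpha>)) * (ennreal c0 * ennreal m + ennreal (c0 powr (1 - p)) * ennreal G)"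
  have avg: "(\<integral>\<^sup>+z. indicator S z * ?J j z \<partial>lborel) \<le> ?R" for j
  proof -
    have "(\<integral>\<^sup>+z. indicator S z * ?J j z \<partial>lborel)
       \<le> ennreal (1 / (1 - \<alpha>)) * (ennreal c0 * emeasure lborel S + ennreal (c0 powr (1 - p)) * (\<integral>\<^sup>+z. H z \<partial>lborel))"
      unfolding \<alpha>_def
      by (rule averaged_segment_energy[OF H(1) D sel(1) S(1) contraction _ p c0]) (use DH yB in auto)
    also have "\<dots> \<le> ?R" unfolding S(3) using H(2) by (intro mult_left_mono add_left_mono) auto
    finally show ?thesis .
  qed
  have [measurable]: "D \<in> borel_measurable borel" using D by (rule borel_measurable_continuous_onI)
  note [measurable] = sel(1) S(1)
  have "ennreal (L / 2) * ennreal m = (\<integral>\<^sup>+z. ennreal (L / 2) * indicator S z \<partial>lborel)"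
    by (simp add: nn_integral_cmult S(3))
  also have "\<dots> \<le> (\<integral>\<^sup>+z. ennreal (pi * d) * (indicator S z * ?J True z + indicator S z * ?J False z) \<partial>lborel)"
    by (intro nn_integral_mono pw)
  also have "\<dots> = ennreal (pi * d) * ((\<integral>\<^sup>+z. indicator S z * ?J True z \<partial>lborel) + (\<integral>\<^sup>+z. indicator S z * ?J False z \<partial>lborel))"
    by (subst nn_integral_cmult, measurable, subst nn_integral_add) measurable
  also have "\<dots> \<le> ennreal (pi * d) * (?R + ?R)" by (intro mult_left_mono add_mono avg) auto
  also have "\<dots> = ennreal (pi * d * (2 * (1 / (1 - \<alpha>) * (c0 * m + c0 powr (1 - p) * G))))"
    using \<alpha> c0 S(4) G d by (simp add: ennreal_mult'[symmetric] ennreal_plus[symmetric] del: ennreal_plus)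
  finally have "L / 2 * m \<le> pi * d * (2 * (1 / (1 - \<alpha>) * (c0 * m + c0 powr (1 - p) * G)))"
    using \<alpha> c0 S(4) G d L by (simp add: ennreal_mult'[symmetric] ennreal_le_iff)
  also have "\<dots> = L / (4 * c0) * (c0 * m + c0 powr (1 - p) * G)"
    unfolding c0_def using L \<alpha> d by (simp add: field_simps)
  also have "\<dots> = L / 4 * m + L / 4 * (c0 powr - p * G)"
    using c0 by (simp add: powr_diff powr_minus field_simps)
  finally have "L / 2 * m \<le> L / 4 * m + L / 4 * (c0 powr - p * G)" .
  moreover have "L / 2 * m = L / 4 * m + L / 4 * m" by simp
  ultimately have "L / 4 * m \<le> L / 4 * (c0 powr - p * G)" by linarith
  then have "m \<le> c0 powr - p * G" using L by simp
  then have "c0 powr p * m \<le> c0 powr p * (c0 powr - p * G)" by (intro mult_left_mono) auto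
  also have "\<dots> = G" using c0 by (simp add: powr_minus)
  finally show ?thesis unfolding c0_def .
qed

section \<open>Distortion of balls\<close>

text \<open>
  A continuum of diameter \<open>n * h\<close>, for the dimension \<open>n\<close>, extends by at least \<open>h\<close> in one of the coordinate directions.
\<close>

lemma continuum_selection:
  fixes F U S :: "(real ^ 'n::finite) set"
  assumes F: "compact F" "connected F" "F \<subseteq> U" and U: "open U"
    and xy: "x \<in> F" "y \<in> F" "real CARD('n) * h \<le> dist x y" and h: "0 < h"
    and S: "S \<in> sets borel" "S \<subseteq> box (x0 - vec (h / 2)) (x0 + vec (h / 2))"
  obtains sel where "sel \<in> borel_measurable borel" "\<And>z. z \<in> S \<Longrightarrow> sel z \<in> U"
    "\<And>H \<tau>. H \<in> borel_measurable borel \<Longrightarrow> 0 < \<tau> \<Longrightarrow> ennreal (\<tau> ^ (CARD('n) - 1)) *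
      (\<integral>\<^sup>+z. indicator S z * H (sel z + \<tau> *\<^sub>R (z - sel z)) \<partial>lborel) \<le> (\<integral>\<^sup>+z. H z \<partial>lborel)"
proof -
  obtain i where "norm (x - y) / real CARD('n) \<le> \<bar>(x - y) $ i\<bar>" using exists_coordinate_ge by blast
  moreover have "h \<le> norm (x - y) / real CARD('n)" using xy(3) by (simp add: dist_norm field_simps)
  ultimately have "h \<le> \<bar>x $ i - y $ i\<bar>" by simp
  then obtain a b where ab: "a \<in> F" "b \<in> F" "a $ i + h \<le> b $ i"
    using xy(1,2) by (cases "x $ i \<le> y $ i") force+
  obtain N X where N: "0 < (N::nat)" and X: "\<And>k. k < N \<Longrightarrow> X k $ i = a $ i + h * real k / real N"
    "\<And>k s. k < N \<Longrightarrow> 0 \<le> s \<Longrightarrow> s \<le> h / real N \<Longrightarrow> X k + s *\<^sub>R axis i 1 \<in> U"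
    using continuum_staircase_selection[OF F U ab h] by metis
  define lo where "lo = x0 $ i - h / 2"
  have Sb: "lo \<le> z $ i \<and> z $ i < lo + h" if "z \<in> S" for z
  proof -
    have "x0 $ i - h / 2 < z $ i \<and> z $ i < x0 $ i + h / 2" using S(2) that by (auto simp: mem_box_cart subset_iff)
    then show ?thesis by (simp add: lo_def)
  qed
  show thesis
  proof (rule that[of "staircase X i lo h N"])
    show "staircase X i lo h N \<in> borel_measurable borel" by simp
    show "staircase X i lo h N z \<in> U" if "z \<in> S" for z
      using stair_index_bounds[OF h N, of lo "z $ i"] Sb[OF that] unfolding staircase_def Let_def
      by (intro X(2)) auto
    show "ennreal (\<tau> ^ (CARD('n) - 1)) *
      (\<integral>\<^sup>+z. indicator S z * H (staircase X i lo h N z + \<tau> *\<^sub>R (z - staircase X i lo h N z)) \<partial>lborel) \<le> (\<integral>\<^sup>+z. H z \<partial>lborel)"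
      if "H \<in> borel_measurable borel" "0 < \<tau>" for H \<tau>
      by (rule nn_integral_staircase_contraction[OF that h N X(1) S(1) Sb])
  qed
qed

lemma emeasure_lborel_cube:
  assumes "0 < h"
  shows "emeasure lborel (box (x - vec (h / 2)) (x + vec (h / 2)) :: (real ^ 'n::finite) set) = ennreal (h ^ CARD('n))"
proof -
  have c: "((x + vec (h / 2)) - (x - vec (h / 2))) \<bullet> b = h" if "b \<in> Basis" for b :: "real ^ 'n"
    using that by (auto simp: Basis_vec_def inner_axis)
  have "(x - vec (h / 2)) \<bullet> b \<le> (x + vec (h / 2)) \<bullet> b" if "b \<in> Basis" for b :: "real ^ 'n"
    using c[OF that] assms unfolding inner_diff_left by linarith
  then have "emeasure lborel (box (x - vec (h / 2)) (x + vec (h / 2)))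
      = ennreal (\<Prod>b\<in>(Basis :: (real ^ 'n) set). ((x + vec (h / 2)) - (x - vec (h / 2))) \<bullet> b)"
    by (simp add: emeasure_lborel_box_eq)
  also have "(\<Prod>b\<in>(Basis :: (real ^ 'n) set). ((x + vec (h / 2)) - (x - vec (h / 2))) \<bullet> b) = (\<Prod>b\<in>(Basis :: (real ^ 'n) set). h)"
    by (intro prod.cong refl c)
  finally show ?thesis by (simp add: DIM_cart)
qed

lemma L_dist_attained:
  fixes \<phi> :: "real ^ 'n::finite \<Rightarrow> real ^ 'n"
  assumes "continuous_on (sphere x0 r) \<phi>" "0 \<le> r"
  obtains y0 where "y0 \<in> sphere x0 r" "L_dist \<phi> x0 r = dist (\<phi> x0) (\<phi> y0)"
proof -
  obtain i :: 'n where True by blast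
  have "x0 + r *\<^sub>R axis i 1 \<in> sphere x0 r" using assms(2) by (simp add: dist_norm)
  then have ne: "sphere x0 r \<noteq> {}" by blast
  have "continuous_on (sphere x0 r) (\<lambda>y. dist (\<phi> x0) (\<phi> y))" using assms(1) by (intro continuous_intros)
  then obtain y0 where y0: "y0 \<in> sphere x0 r" "\<And>y. y \<in> sphere x0 r \<Longrightarrow> dist (\<phi> x0) (\<phi> y) \<le> dist (\<phi> x0) (\<phi> y0)"
    using continuous_attains_sup[OF compact_sphere ne] by blast
  have "L_dist \<phi> x0 r = dist (\<phi> x0) (\<phi> y0)"
    unfolding L_dist_def using y0 by (intro cSup_eq_maximum) auto
  then show thesis using y0(1) that by blast
qed

lemma composition_energy_bound:
  fixes \<Omega> \<Omega>' :: "(real ^ 'n::finite) set"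
  assumes open_sets: "open \<Omega>" "open \<Omega>'" and p: "0 < p"
    and K: "\<And>f. f \<in> L1p p \<Omega>' \<Longrightarrow> quasicontinuous p \<Omega>' f \<Longrightarrow> f \<circ> \<phi> \<in> L1p p \<Omega> \<and>
        L1p_seminorm p \<Omega> (f \<circ> \<phi>) \<le> K * L1p_seminorm p \<Omega>' f"
    and f: "\<And>x. (f has_derivative (\<lambda>h. Df x \<bullet> h)) (at x)" "continuous_on UNIV Df"
    and C: "compact C" "\<And>x. x \<notin> C \<Longrightarrow> Df x = 0" and M: "\<And>x. norm (Df x) \<le> M"
  obtains g where "is_weak_gradient \<Omega> (f \<circ> \<phi>) g" "(\<lambda>x. norm (g x) powr p) absolutely_integrable_on \<Omega>"
    "(LINT x:\<Omega>|lebesgue. norm (g x) powr p) \<le> (\<bar>K\<bar> * M) powr p * measure lebesgue C"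
proof -
  have fL: "f \<in> L1p p \<Omega>'" and fs: "L1p_seminorm p \<Omega>' f powr p \<le> M powr p * measure lebesgue C"
    by (rule continuous_gradient_in_L1p[OF open_sets(2) p f C M]; assumption)+
  have "continuous_on UNIV f" using f(1) by (auto intro!: continuous_at_imp_continuous_on has_derivative_continuous)
  then have "quasicontinuous p \<Omega>' f"
    by (intro continuous_imp_quasicontinuous open_sets p) (auto intro: continuous_on_subset)
  from K[OF fL this] have gL: "f \<circ> \<phi> \<in> L1p p \<Omega>"
    and gs: "L1p_seminorm p \<Omega> (f \<circ> \<phi>) \<le> K * L1p_seminorm p \<Omega>' f" by auto
  define g where "g = weak_gradient \<Omega> (f \<circ> \<phi>)"
  have wg: "is_weak_gradient \<Omega> (f \<circ> \<phi>) g"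
  proof -
    have "\<exists>g. is_weak_gradient \<Omega> (f \<circ> \<phi>) g" using gL unfolding L1p_def by blast
    then show ?thesis unfolding g_def weak_gradient_def by (rule someI_ex)
  qed
  have gi: "(\<lambda>x. norm (g x) powr p) absolutely_integrable_on \<Omega>" using gL unfolding L1p_def g_def by blast
  have M0: "0 \<le> M" using M[of 0] norm_ge_zero order_trans by blast
  let ?G = "LINT x:\<Omega>|lebesgue. norm (g x) powr p"
  have G0: "0 \<le> ?G" unfolding set_lebesgue_integral_def by (intro Bochner_Integration.integral_nonneg) auto
  have s: "L1p_seminorm p \<Omega> (f \<circ> \<phi>) powr p = ?G"
    unfolding L1p_seminorm_def g_def[symmetric] using p G0 by (simp add: powr_powr)
  have n0: "0 \<le> L1p_seminorm p \<Omega> (f \<circ> \<phi>)" "0 \<le> L1p_seminorm p \<Omega>' f" unfolding L1p_seminorm_def by simp_all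
  have "L1p_seminorm p \<Omega> (f \<circ> \<phi>) \<le> \<bar>K\<bar> * L1p_seminorm p \<Omega>' f"
    by (rule order_trans[OF gs]) (intro mult_right_mono n0 abs_ge_self)
  then have "?G \<le> (\<bar>K\<bar> * L1p_seminorm p \<Omega>' f) powr p" unfolding s[symmetric] using n0 p by (intro powr_mono2) auto
  also have "\<dots> = \<bar>K\<bar> powr p * L1p_seminorm p \<Omega>' f powr p" using n0 by (simp add: powr_mult)
  also have "\<dots> \<le> \<bar>K\<bar> powr p * (M powr p * measure lebesgue C)" using fs by (intro mult_left_mono) auto
  also have "\<dots> = (\<bar>K\<bar> * M) powr p * measure lebesgue C" using M0 by (simp add: powr_mult)
  finally show thesis using that wg gi by blast
qed

text \<open>
  Continuity is checked on the two open sets \<open>\<Omega>\<close> and \<open>- K\<close>, which cover the space.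
\<close>

lemma continuous_extension_by_zero:
  assumes "open \<Omega>" "continuous_on \<Omega> v" "compact K" "K \<subseteq> \<Omega>" "\<And>x. x \<in> \<Omega> \<Longrightarrow> x \<notin> K \<Longrightarrow> v x = (0::real)"
  shows "continuous_on UNIV (\<lambda>x::'a::t2_space. if x \<in> \<Omega> then v x else 0)"
proof -
  let ?v = "\<lambda>x. if x \<in> \<Omega> then v x else 0"
  have "continuous_on \<Omega> ?v" using assms(2) by (simp cong: continuous_on_cong)
  moreover have "continuous_on (- K) ?v"
    by (rule continuous_on_eq[of _ "\<lambda>_. 0"]) (use assms(5) in auto)
  ultimately have "continuous_on (\<Omega> \<union> - K) ?v"
    using assms by (intro continuous_on_open_Un) (auto simp: compact_imp_closed)
  moreover have "\<Omega> \<union> - K = UNIV" using assms(4) by auto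
  ultimately show ?thesis by simp
qed

text \<open>
  The two continua live in the ball of radius \<open>R1\<close>, the segments and the staircases in that of radius \<open>R2\<close>, and the
  cutoff takes place between the radii \<open>R2\<close> and \<open>R3 = \<kappa> * r\<close>. These radii divide the interval from \<open>r\<close> to
  \<open>\<kappa> * r\<close> equally, so everything scales with \<open>r\<close>.
\<close>

lemma distortion_bound_at_radius:
  fixes \<Omega> \<Omega>' :: "(real ^ 'n::finite) set" and \<phi> :: "real ^ 'n \<Rightarrow> real ^ 'n" and p \<kappa> K r :: real
  defines "\<delta> \<equiv> (\<kappa> - 1) / 3" and "\<alpha> \<equiv> real (CARD('n) - 1) / p"
  assumes open_sets: "open \<Omega>" "open \<Omega>'" and hom: "homeomorphism \<Omega> \<Omega>' \<phi> \<psi>"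
    and p: "1 \<le> p" "real CARD('n) - 1 < p" and \<kappa>: "1 < \<kappa>"
    and K: "\<And>f. f \<in> L1p p \<Omega>' \<Longrightarrow> quasicontinuous p \<Omega>' f \<Longrightarrow> f \<circ> \<phi> \<in> L1p p \<Omega> \<and>
        L1p_seminorm p \<Omega> (f \<circ> \<phi>) \<le> K * L1p_seminorm p \<Omega>' f"
    and r: "0 < r" "cball x0 (\<kappa> * r) \<subseteq> \<Omega>"
  shows "(L_dist \<phi> x0 r * (1 - \<alpha>) / (16 * pi * ((1 + 2 * \<delta>) * r))) powr p * (\<delta> * r / real CARD('n)) ^ CARD('n)
    \<le> (\<bar>K\<bar> * 2) powr p * measure lebesgue (\<phi> ` ball x0 (\<kappa> * r))"
proof -
  have c\<phi>: "continuous_on \<Omega> \<phi>" and c\<psi>: "continuous_on \<Omega>' \<psi>"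
    and inv: "\<And>z. z \<in> \<Omega> \<Longrightarrow> \<psi> (\<phi> z) = z" "\<And>z. z \<in> \<Omega>' \<Longrightarrow> \<phi> (\<psi> z) = z"
    and im: "\<phi> ` \<Omega> = \<Omega>'" "\<psi> ` \<Omega>' = \<Omega>"
    using hom unfolding homeomorphism_def by blast+
  have \<delta>: "0 < \<delta>" using \<kappa> by (simp add: \<delta>_def)
  have radii: "r < (1 + \<delta>) * r" "(1 + \<delta>) * r < (1 + 2 * \<delta>) * r" "(1 + 2 * \<delta>) * r < \<kappa> * r"
  proof -
    have "3 * \<delta> = \<kappa> - 1" by (simp add: \<delta>_def)
    then have "1 < 1 + \<delta>" "1 + \<delta> < 1 + 2 * \<delta>" "1 + 2 * \<delta> < \<kappa>" using \<delta> by auto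
    from this[THEN mult_strict_right_mono, OF r(1)]
    show "r < (1 + \<delta>) * r" "(1 + \<delta>) * r < (1 + 2 * \<delta>) * r" "(1 + 2 * \<delta>) * r < \<kappa> * r" by auto
  qed
  define R1 where "R1 = (1 + \<delta>) * r"
  define R2 where "R2 = (1 + 2 * \<delta>) * r"
  define R3 where "R3 = \<kappa> * r"
  note R = radii[folded R1_def R2_def R3_def] r(2)[folded R3_def]
  define A where "A = \<phi> ` ball x0 R3"
  have sub: "cball x0 R1 \<subseteq> ball x0 R2" "cball x0 R2 \<subseteq> ball x0 R3" "ball x0 R3 \<subseteq> \<Omega>" "cball x0 R2 \<subseteq> \<Omega>" "cball x0 R1 \<subseteq> \<Omega>"
    "sphere x0 r \<subseteq> ball x0 R1"
  proof -
    show 1: "cball x0 R1 \<subseteq> ball x0 R2" "cball x0 R2 \<subseteq> ball x0 R3" using R(2,3) by (auto simp: subset_iff)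
    show 2: "ball x0 R3 \<subseteq> \<Omega>" using R(4) ball_subset_cball by blast
    show 3: "cball x0 R2 \<subseteq> \<Omega>" using 1 2 by blast
    show "cball x0 R1 \<subseteq> \<Omega>" using 1 3 ball_subset_cball by blast
    show "sphere x0 r \<subseteq> ball x0 R1" using R(1) by (auto simp: subset_iff)
  qed
  have "sphere x0 r \<subseteq> \<Omega>" using sub(5,6) ball_subset_cball by blast
  then have cs: "continuous_on (sphere x0 r) \<phi>" using c\<phi> by (rule continuous_on_subset[rotated])
  obtain y0 where y0: "y0 \<in> sphere x0 r" "L_dist \<phi> x0 r = dist (\<phi> x0) (\<phi> y0)"
    using L_dist_attained[OF cs less_imp_le[OF r(1)]] by blast
  define L where "L = dist (\<phi> x0) (\<phi> y0)"
  have x0in: "x0 \<in> ball x0 R1" "y0 \<in> ball x0 R1" using R(1) r(1) y0(1) by (auto simp: dist_commute)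
  have L: "0 < L"
  proof -
    have "x0 \<noteq> y0" using y0(1) r(1) by auto
    moreover have "x0 \<in> \<Omega>" "y0 \<in> \<Omega>" using x0in sub(5) ball_subset_cball by blast+
    ultimately have "\<phi> x0 \<noteq> \<phi> y0" using inv(1) by metis
    then show ?thesis by (simp add: L_def)
  qed
  define e where "e = (1 / L) *\<^sub>R (\<phi> y0 - \<phi> x0)"
  have e: "norm e = 1" "e \<bullet> e = 1"
    using L by (auto simp: e_def L_def dist_norm norm_minus_commute dot_square_norm)
  have y0e: "\<phi> y0 - \<phi> x0 = L *\<^sub>R e" using L by (simp add: e_def)
  define w where "w x = (\<phi> x - \<phi> x0) \<bullet> e" for x
  have cw: "continuous_on \<Omega> w" unfolding w_def by (intro continuous_intros c\<phi>)
  have oA: "open A"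
  proof -
    have "openin (top_of_set \<Omega>') A"
      unfolding A_def using sub by (intro homeomorphism_imp_open_map[OF hom] open_subset) auto
    then show ?thesis using open_sets(2) by (metis openin_open_eq)
  qed
  have A\<Omega>': "A \<subseteq> \<Omega>'" unfolding A_def using sub im by blast
  have Abd: "bounded A"
  proof -
    have "compact (\<phi> ` cball x0 R3)"
      using R c\<phi> by (intro compact_continuous_image) (auto intro: continuous_on_subset)
    moreover have "A \<subseteq> \<phi> ` cball x0 R3" unfolding A_def using ball_subset_cball by blast
    ultimately show ?thesis by (meson bounded_subset compact_imp_bounded)
  qed
  have Kc: "compact (\<phi> ` cball x0 R2)" "\<phi> ` cball x0 R2 \<subseteq> A"
    using sub c\<phi> unfolding A_def by (auto intro!: compact_continuous_image intro: continuous_on_subset)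
  obtain \<epsilon>0 C where \<epsilon>0: "0 < \<epsilon>0" and C: "compact C" "C \<subseteq> A" and osc:
    "\<And>\<epsilon>. 0 < \<epsilon> \<Longrightarrow> \<epsilon> \<le> \<epsilon>0 \<Longrightarrow> \<exists>f Df. (\<forall>x. (f has_derivative (\<lambda>h. Df x \<bullet> h)) (at x)) \<and>
       continuous_on UNIV Df \<and> (\<forall>x. norm (Df x) \<le> 2) \<and> (\<forall>x. x \<notin> C \<longrightarrow> f x = 0 \<and> Df x = 0) \<and>
       (\<forall>x\<in>\<phi> ` cball x0 R2. f x = \<epsilon> * sin (((x - \<phi> x0) \<bullet> e) / \<epsilon>))"
    by (rule oscillating_test_function_exists[OF Kc oA e(1), of "\<phi> x0"], rule that) assumption+
  \<comment> \<open>the second bound makes the errors \<open>2 * pi * \<epsilon>\<close> of two segments leave at least \<open>L / 2\<close> of a gap \<open>4 / 5 * L\<close>\<close>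
  define \<epsilon> where "\<epsilon> = min \<epsilon>0 (3 * L / (40 * pi))"
  have \<epsilon>: "0 < \<epsilon>" "\<epsilon> \<le> \<epsilon>0" "4 * pi * \<epsilon> \<le> 3 / 10 * L"
  proof -
    have "\<epsilon> \<le> 3 * L / (40 * pi)" by (simp add: \<epsilon>_def)
    then show "4 * pi * \<epsilon> \<le> 3 / 10 * L" by (simp add: field_simps)
  qed (use \<epsilon>0 L in \<open>auto simp: \<epsilon>_def\<close>)
  obtain f Df where f: "\<And>x. (f has_derivative (\<lambda>h. Df x \<bullet> h)) (at x)" "continuous_on UNIV Df"
    "\<And>x. norm (Df x) \<le> 2" "\<And>x. x \<notin> C \<Longrightarrow> f x = 0" "\<And>x. x \<notin> C \<Longrightarrow> Df x = 0"
    "\<And>x. x \<in> cball x0 R2 \<Longrightarrow> f (\<phi> x) = \<epsilon> * sin (w x / \<epsilon>)"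
    using osc[OF \<epsilon>(1,2)] unfolding w_def by blast
  have p0: "0 < p" using p by simp
  obtain g where wg: "is_weak_gradient \<Omega> (f \<circ> \<phi>) g" and gi: "(\<lambda>x. norm (g x) powr p) absolutely_integrable_on \<Omega>"
    and gG: "(LINT x:\<Omega>|lebesgue. norm (g x) powr p) \<le> (\<bar>K\<bar> * 2) powr p * measure lebesgue C"
    using composition_energy_bound[OF open_sets p0 K f(1,2) C(1) f(5,3)] by blast
  define G where "G = (LINT x:\<Omega>|lebesgue. norm (g x) powr p)"
  have G0: "0 \<le> G" unfolding G_def set_lebesgue_integral_def by (intro Bochner_Integration.integral_nonneg) auto
  \<comment> \<open>the support of \<open>f\<close> is carried by \<open>\<psi>\<close> to a compact subset of \<open>\<Omega>\<close>, so extension by zero is continuous\<close>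
  define v where "v x = (if x \<in> \<Omega> then f (\<phi> x) else 0)" for x
  have cf: "continuous_on UNIV f" using f(1) by (auto intro!: continuous_at_imp_continuous_on has_derivative_continuous)
  have KC: "compact (\<psi> ` C)" "\<psi> ` C \<subseteq> \<Omega>"
  proof -
    have "C \<subseteq> \<Omega>'" using C(2) A\<Omega>' by blast
    then show "compact (\<psi> ` C)" "\<psi> ` C \<subseteq> \<Omega>"
      using C(1) im(2) by (auto intro!: compact_continuous_image continuous_on_subset[OF c\<psi>])
  qed
  have v0: "f (\<phi> x) = 0" if "x \<in> \<Omega>" "x \<notin> \<psi> ` C" for x
    using that inv(1) f(4) by (metis imageI)
  have cv: "continuous_on UNIV v"
    unfolding v_def by (rule continuous_extension_by_zero[OF open_sets(1) _ KC v0])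
       (auto intro!: continuous_on_compose2[OF cf c\<phi>])
  obtain V D H where V: "\<And>x. (V has_derivative (\<lambda>h. D x \<bullet> h)) (at x)" "continuous_on UNIV D"
    "\<And>x. \<bar>V x - v x\<bar> \<le> \<epsilon> / 2" and H: "H \<in> borel_measurable borel" "(\<integral>\<^sup>+x. H x \<partial>lborel) \<le> ennreal G"
    and DH: "\<And>x c. x \<in> cball x0 R2 \<Longrightarrow> 0 < c \<Longrightarrow> ennreal (norm (D x)) \<le> ennreal c + ennreal (c powr (1 - p)) * H x"
  proof -
    have vw: "(f \<circ> \<phi>) x = v x" if "x \<in> \<Omega>" for x using that by (simp add: v_def)
    have v0': "v x = 0" if "x \<notin> \<psi> ` C" for x using v0 that by (simp add: v_def)
    have e2: "0 < \<epsilon> / 2" using \<epsilon>(1) by simp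
    show thesis
      using mollification[OF open_sets(1) wg vw cv KC v0' p(1) gi compact_cball sub(4) e2] that
      unfolding G_def by blast
  qed
  have dist_R1: "\<delta> * r \<le> R1" "\<delta> * r = R1 - r" using r(1) by (auto simp: R1_def algebra_simps)
  define h where "h = \<delta> * r / real CARD('n)"
  have h: "0 < h" "real CARD('n) * h = \<delta> * r" using \<delta> r(1) by (auto simp: h_def)
  \<comment> \<open>the side \<open>h\<close> is a lower bound for the extent of both continua in some coordinate direction\<close>
  define S where "S = box (x0 - vec (h / 2)) (x0 + vec (h / 2))"
  have SB: "S \<subseteq> ball x0 R2"
  proof
    fix z assume "z \<in> S"
    then have zi: "x0 $ i - h / 2 < z $ i" "z $ i < x0 $ i + h / 2" for i
      unfolding S_def by (auto simp: mem_box_cart)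
    have "\<bar>(z - x0) $ i\<bar> \<le> h / 2" for i
      unfolding vector_minus_component using zi[of i] by linarith
    then have "(\<Sum>i\<in>UNIV. \<bar>(z - x0) $ i\<bar>) \<le> (\<Sum>i\<in>(UNIV::'n set). h / 2)" by (intro sum_mono)
    then have "norm (z - x0) \<le> \<delta> * r / 2" using norm_le_l1_cart[of "z - x0"] h(2) by simp
    also have "\<dots> < R2" using dist_R1 R \<delta> r(1) by (smt (verit) half_gt_zero_iff mult_pos_pos field_sum_of_halves)
    finally show "z \<in> ball x0 R2" by (simp add: dist_norm norm_minus_commute)
  qed
  have Sm: "emeasure lborel S = ennreal (h ^ CARD('n))" unfolding S_def by (rule emeasure_lborel_cube[OF h(1)])
  have open_w: "open {x \<in> ball x0 R2. w x \<in> T}" if "open T" for T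
  proof -
    have "continuous_on (ball x0 R2) w" using cw sub ball_subset_cball by (meson continuous_on_subset order_trans)
    then have "open (ball x0 R2 \<inter> w -` T)" using that by (intro continuous_open_preimage) auto
    then show ?thesis by (simp add: vimage_def Int_def)
  qed
  obtain sel0 where sel0: "sel0 \<in> borel_measurable borel" "\<And>z. z \<in> S \<Longrightarrow> sel0 z \<in> {x \<in> ball x0 R2. w x \<in> {..< L / 10}}"
    "\<And>H \<tau>. H \<in> borel_measurable borel \<Longrightarrow> 0 < \<tau> \<Longrightarrow> ennreal (\<tau> ^ (CARD('n) - 1)) *
      (\<integral>\<^sup>+z. indicator S z * H (sel0 z + \<tau> *\<^sub>R (z - sel0 z)) \<partial>lborel) \<le> (\<integral>\<^sup>+z. H z \<partial>lborel)"
  proof -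
    obtain F y where F: "compact F" "connected F" "F \<subseteq> cball x0 R1" "x0 \<in> F" "y \<in> F" "dist x0 y = R1"
        "\<And>z. z \<in> F \<Longrightarrow> \<exists>s\<ge>0. \<phi> z = \<phi> x0 + s *\<^sub>R (- e)"
      using preimage_of_ray_continuum[OF hom open_sets(2) sub(5) x0in(1), of "- e"] e by (metis neg_equal_0_iff_equal norm_zero zero_neq_one)
    \<comment> \<open>\<open>w\<close> is nonpositive on the preimage of this ray; the margin \<open>L / 10\<close> makes room for an open neighbourhood\<close>
    have "F \<subseteq> {x \<in> ball x0 R2. w x \<in> {..< L / 10}}"
    proof
      fix z assume "z \<in> F"
      moreover from F(7)[OF this] obtain s where "s \<ge> 0" "\<phi> z = \<phi> x0 + s *\<^sub>R (- e)" by blast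
      then have "w z = - s" unfolding w_def using e(2) by simp
      ultimately show "z \<in> {x \<in> ball x0 R2. w x \<in> {..< L / 10}}"
        using F(3) sub(1) L \<open>s \<ge> 0\<close> by auto
    qed
    from continuum_selection[OF F(1,2) this open_w F(4,5) _ h(1), of S x0] show thesis
      using that F(6) dist_R1 h(2) by (auto simp: S_def)
  qed
  obtain sel1 where sel1: "sel1 \<in> borel_measurable borel" "\<And>z. z \<in> S \<Longrightarrow> sel1 z \<in> {x \<in> ball x0 R2. w x \<in> {9 / 10 * L <..}}"
    "\<And>H \<tau>. H \<in> borel_measurable borel \<Longrightarrow> 0 < \<tau> \<Longrightarrow> ennreal (\<tau> ^ (CARD('n) - 1)) *
      (\<integral>\<^sup>+z. indicator S z * H (sel1 z + \<tau> *\<^sub>R (z - sel1 z)) \<partial>lborel) \<le> (\<integral>\<^sup>+z. H z \<partial>lborel)"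
  proof -
    obtain F y where F: "compact F" "connected F" "F \<subseteq> cball x0 R1" "y0 \<in> F" "y \<in> F" "dist x0 y = R1"
        "\<And>z. z \<in> F \<Longrightarrow> \<exists>s\<ge>0. \<phi> z = \<phi> y0 + s *\<^sub>R e"
      using preimage_of_ray_continuum[OF hom open_sets(2) sub(5) x0in(2), of e] e by (metis norm_zero zero_neq_one)
    have "F \<subseteq> {x \<in> ball x0 R2. w x \<in> {9 / 10 * L <..}}"
    proof
      fix z assume "z \<in> F"
      moreover from F(7)[OF this] obtain s where "s \<ge> 0" "\<phi> z = \<phi> y0 + s *\<^sub>R e" by blast
      then have "\<phi> z - \<phi> x0 = (L + s) *\<^sub>R e" using y0e by (simp add: algebra_simps)
      then have "w z = L + s" unfolding w_def using e(2) by simp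
      ultimately show "z \<in> {x \<in> ball x0 R2. w x \<in> {9 / 10 * L <..}}"
        using F(3) sub(1) L \<open>s \<ge> 0\<close> by auto
    qed
    moreover have "\<delta> * r \<le> dist y0 y"
      using dist_triangle[of x0 y y0] F(6) y0(1) dist_R1 by simp
    ultimately show thesis
      using continuum_selection[OF F(1,2) _ open_w F(4,5) _ h(1), of "{9 / 10 * L <..}" S x0] that h(2) by (auto simp: S_def)
  qed
  define sel where "sel j = (if j then sel1 else sel0)" for j
  have "(L * (1 - \<alpha>) / (8 * pi * (2 * R2))) powr p * h ^ CARD('n) \<le> G"
    unfolding \<alpha>_def
  proof (rule oscillation_energy_bound[of H G V D S "ball x0 R2" _ "2 * R2" p w \<epsilon> L sel])
    show "norm (z - x) \<le> 2 * R2" if "x \<in> ball x0 R2" "z \<in> ball x0 R2" for x z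
      using that dist_triangle3[of z x x0] by (simp add: dist_norm)
    show "\<bar>V y - \<epsilon> * sin (w y / \<epsilon>)\<bar> \<le> \<epsilon> / 2" if "y \<in> ball x0 R2" for y
    proof -
      have "y \<in> cball x0 R2" using that by simp
      then have "v y = \<epsilon> * sin (w y / \<epsilon>)" using f(6) sub(4) by (auto simp: v_def)
      then show ?thesis using V(3)[of y] by simp
    qed
    show "continuous_on (ball x0 R2) w" using cw sub ball_subset_cball by (meson continuous_on_subset order_trans)
    show "4 / 5 * L \<le> w (sel True z) - w (sel False z)" if "z \<in> S" for z
      using sel0(2)[OF that] sel1(2)[OF that] by (simp add: sel_def)
    show "real (CARD('n) - 1) < p" using p(2) by simp
    show "0 < 2 * R2" using R r(1) by linarith
    show "S \<in> sets borel" unfolding S_def by simp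
    show "sel j \<in> borel_measurable borel" for j using sel0(1) sel1(1) by (simp add: sel_def)
    show "sel j z \<in> ball x0 R2" if "z \<in> S" for j z using sel0(2)[OF that] sel1(2)[OF that] by (simp add: sel_def)
    show "ennreal (\<tau> ^ (CARD('n) - 1)) *
      (\<integral>\<^sup>+z. indicator S z * H (sel j z + \<tau> *\<^sub>R (z - sel j z)) \<partial>lborel) \<le> (\<integral>\<^sup>+z. H z \<partial>lborel)"
      if "0 < \<tau>" "\<tau> < 1" for j \<tau>
      using sel0(3)[OF H(1) that(1)] sel1(3)[OF H(1) that(1)] by (cases j) (simp_all add: sel_def)
    show "ennreal (norm (D x)) \<le> ennreal c + ennreal (c powr (1 - p)) * H x" if "x \<in> ball x0 R2" "0 < c" for x c
      using that ball_subset_cball by (intro DH) blast+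
    show "0 \<le> h ^ CARD('n)" using h(1) by simp
  qed (fact H V(1,2) SB Sm \<epsilon> p0 L G0 convex_ball)+
  also have "G \<le> (\<bar>K\<bar> * 2) powr p * measure lebesgue C" using gG by (simp add: G_def)
  also have "\<dots> \<le> (\<bar>K\<bar> * 2) powr p * measure lebesgue A"
  proof -
    have "C \<in> lmeasurable" "A \<in> lmeasurable" using C(1) oA Abd by (auto simp: lmeasurable_compact lmeasurable_open)
    then show ?thesis using C(2) by (intro mult_left_mono measure_mono_fmeasurable) (auto simp: fmeasurableD)
  qed
  finally show ?thesis
    unfolding A_def R3_def h_def L_def[folded y0(2)] R2_def by (simp add: mult.assoc)
qed


theorem theorem3p5:
  fixes \<Omega> \<Omega>' :: "(real ^ 'n::finite) set" and \<phi> :: "real ^ 'n \<Rightarrow> real ^ 'n" and p :: real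
  assumes "open \<Omega>" and "connected \<Omega>" and "\<Omega> \<noteq> {}"
    and "open \<Omega>'" and "connected \<Omega>'" and "\<Omega>' \<noteq> {}"
    and "1 \<le> p" and "real CARD('n) - 1 < p" and "p < real CARD('n)"
    and "\<exists>\<psi>. homeomorphism \<Omega> \<Omega>' \<phi> \<psi>"
    and "bounded_composition_operator p \<Omega> \<Omega>' \<phi>"
  shows "\<forall>\<kappa>>1. \<exists>H::real. \<forall>x0\<in>\<Omega>.
    Limsup (at_right 0)
      (\<lambda>r. ereal (L_dist \<phi> x0 r powr p * r powr (real CARD('n) - p)
                  / measure lebesgue (\<phi> ` ball x0 (\<kappa> * r))))
    \<le> ereal H"
proof (intro allI impI)
  fix \<kappa> :: real assume \<kappa>: "1 < \<kappa>"
  obtain \<psi> where hom: "homeomorphism \<Omega> \<Omega>' \<phi> \<psi>" using assms(10) by blast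
  obtain K where K: "\<And>f. f \<in> L1p p \<Omega>' \<Longrightarrow> quasicontinuous p \<Omega>' f \<Longrightarrow> f \<circ> \<phi> \<in> L1p p \<Omega> \<and>
        L1p_seminorm p \<Omega> (f \<circ> \<phi>) \<le> K * L1p_seminorm p \<Omega>' f"
    using assms(11) unfolding bounded_composition_operator_def by blast
  define n where "n = CARD('n)"
  define \<delta> where "\<delta> = (\<kappa> - 1) / 3"
  define \<alpha> where "\<alpha> = real (CARD('n) - 1) / p"
  define a where "a = (1 - \<alpha>) / (16 * pi * (1 + 2 * \<delta>))"
  define M where "M = a powr p * (\<delta> / real n) ^ n"
  define Q where "Q = (\<bar>K\<bar> * 2) powr p"
  have n: "0 < n" by (simp add: n_def)
  have \<delta>: "0 < \<delta>" using \<kappa> by (simp add: \<delta>_def)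
  have "real (CARD('n) - 1) < p" "0 < p" using assms(7,8) by simp_all
  then have "\<alpha> < 1" unfolding \<alpha>_def by (simp only: pos_divide_less_eq mult_1)
  then have a: "0 < a" using \<delta> by (simp add: a_def)
  have M: "0 < M" using a \<delta> n by (simp add: M_def)
  have bound: "L_dist \<phi> x0 r powr p * r powr (real n - p) / measure lebesgue (\<phi> ` ball x0 (\<kappa> * r)) \<le> Q / M"
    if r: "0 < r" "cball x0 (\<kappa> * r) \<subseteq> \<Omega>" for x0 r
  proof -
    let ?L = "L_dist \<phi> x0 r" and ?m = "measure lebesgue (\<phi> ` ball x0 (\<kappa> * r))"
    have "r \<le> \<kappa> * r" using \<kappa> r(1) by simp
    then have "sphere x0 r \<subseteq> \<Omega>" using r(2) by (auto simp: subset_iff)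
    then have "continuous_on (sphere x0 r) \<phi>"
      using hom unfolding homeomorphism_def by (meson continuous_on_subset)
    then have L: "0 \<le> ?L" using L_dist_attained[of x0 r \<phi>] r(1) by (metis less_imp_le zero_le_dist)
    have "(?L * (1 - \<alpha>) / (16 * pi * ((1 + 2 * \<delta>) * r))) powr p * (\<delta> * r / real n) ^ n \<le> Q * ?m"
      unfolding \<alpha>_def \<delta>_def Q_def n_def
      by (rule distortion_bound_at_radius[OF assms(1,4) hom assms(7,8) \<kappa> K r])
    also have "?L * (1 - \<alpha>) / (16 * pi * ((1 + 2 * \<delta>) * r)) = a * (?L * (1 / r))"
      unfolding a_def by (simp add: mult_ac)
    also have "(a * (?L * (1 / r))) powr p = a powr p * (?L powr p * r powr - p)"
      using a L r(1) by (simp add: powr_mult powr_minus powr_divide inverse_eq_divide)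
    also have "(\<delta> * r / real n) ^ n = (\<delta> / real n) ^ n * r powr real n"
      using r(1) by (simp add: powr_realpow power_mult_distrib power_divide)
    also have "a powr p * (?L powr p * r powr - p) * ((\<delta> / real n) ^ n * r powr real n)
        = M * (?L powr p * (r powr - p * r powr real n))"
      by (simp add: M_def)
    also have "r powr - p * r powr real n = r powr (real n - p)"
      by (simp add: powr_add[symmetric])
    finally have "?L powr p * r powr (real n - p) \<le> Q / M * ?m"
      using M by (simp add: field_simps)
    moreover have "0 \<le> Q / M" using M by (simp add: Q_def)
    ultimately show ?thesis
      \<comment> \<open>if the measure were zero, the quotient would be zero by the convention for division\<close>
      by (cases "?m = 0") (simp_all add: divide_le_eq order_less_le)
  qed
  show "\<exists>H::real. \<forall>x0\<in>\<Omega>. Limsup (at_right 0)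
      (\<lambda>r. ereal (L_dist \<phi> x0 r powr p * r powr (real CARD('n) - p)
                  / measure lebesgue (\<phi> ` ball x0 (\<kappa> * r)))) \<le> ereal H"
  proof (intro exI[of _ "Q / M"] ballI Limsup_bounded)
    fix x0 assume "x0 \<in> \<Omega>"
    then obtain R where R: "0 < R" "cball x0 R \<subseteq> \<Omega>" using assms(1) open_contains_cball by blast
    have "\<forall>\<^sub>F r in at_right 0. 0 < r \<and> r < R / \<kappa>"
      using R \<kappa> by (auto simp: eventually_at_right_field intro!: exI[of _ "R / \<kappa>"])
    then show "\<forall>\<^sub>F r in at_right 0. ereal (L_dist \<phi> x0 r powr p * r powr (real CARD('n) - p)
                  / measure lebesgue (\<phi> ` ball x0 (\<kappa> * r))) \<le> ereal (Q / M)"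
    proof (rule eventually_mono)
      fix r assume r: "0 < r \<and> r < R / \<kappa>"
      then have "\<kappa> * r \<le> R" using \<kappa> by (simp add: field_simps)
      then have "cball x0 (\<kappa> * r) \<subseteq> \<Omega>" using R(2) by (auto simp: subset_iff)
      then show "ereal (L_dist \<phi> x0 r powr p * r powr (real CARD('n) - p)
                  / measure lebesgue (\<phi> ` ball x0 (\<kappa> * r))) \<le> ereal (Q / M)"
        using bound[of r x0] r by (simp add: n_def)
    qed
  qed
qed

end
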